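(* Let $p>1/3$ and $\tilde u\in\mathbb{R}$, and let the far field states satisfy $u_-=u_+=\tilde u$. Assume $f\in C^3(\mathbb{R})$ and $\sigma\in C^2(\mathbb{R})$ with $$\sigma(0)=0,\qquad \sigma'(v)>0\ (v\in\mathbb{R}),\qquad |\sigma(v)|\sim|v|^p,\quad |\sigma'(v)|\sim|v|^{p-1}\quad(|v|\to\infty),$$ and $u_0-\tilde u\in H^2$. Then the unique global in time solution $u$ of the Cauchy problem $$\partial_t u+\partial_x\big(f(u)-\sigma(\partial_x u)\big)=0\ \ (t>0,\ x\in\mathbb{R}),\qquad u(0,x)=u_0(x)\to\tilde u\ \ (x\to\pm\infty)$$ satisfies, for every $q\in[2,\infty)$ and every $\epsilon>0$, $$\|u(t)-\tilde u\|_{L^q}\le C_{u_0}(1+t)^{-\frac14\left(1-\frac2q\right)}\quad(t\ge0),$$ $$\|u(t)-\tilde u\|_{L^\infty}\le C_{u_0,\epsilon}(1+t)^{-\frac14+\epsilon}\quad(t\ge0).$$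
   Context: $L^q=L^q(\mathbb{R})$ and $H^k=H^k(\mathbb{R})$ are the usual Lebesgue and $L^2$-based Sobolev spaces in $x$. The notation $g(v)\sim h(v)$ as $|v|\to\infty$ means that there is a constant $C\ge1$ with $C^{-1}h(v)\le g(v)\le C\,h(v)$ for all sufficiently large $|v|$. The unique global in time solution is the one in the class $u-\tilde u\in C^0\cap L^\infty([0,\infty);H^2)$, $\partial_x u\in L^2(0,\infty;H^2)$, $\partial_t u\in C^0\cap L^\infty([0,\infty);L^2)\cap L^2(0,\infty;H^1)$. $C_{\alpha,\beta,\dots}$ denotes a generic positive constant independent of $t$, the subscripts emphasizing dependence; such constants may also depend on the fixed data ($f,\sigma,p,\tilde u$) and on the exponent $q$. *)

theory Defs
  imports "HOL-Analysis.Analysis" "HOL-Probability.Essential_Supremum"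
begin

definition C_diff :: "nat \<Rightarrow> (real \<Rightarrow> real) \<Rightarrow> bool" where
  "C_diff k f \<longleftrightarrow>
     (\<forall>j<k. \<forall>x. (deriv ^^ j) f differentiable (at x)) \<and> continuous_on UNIV ((deriv ^^ k) f)"

definition comparable_at_infinity :: "(real \<Rightarrow> real) \<Rightarrow> (real \<Rightarrow> real) \<Rightarrow> bool" where
  "comparable_at_infinity g h \<longleftrightarrow>
     (\<exists>C\<ge>1. \<forall>\<^sub>F v in at_infinity. inverse C * h v \<le> g v \<and> g v \<le> C * h v)"

text \<open>
  Elements of \<open>L\<^sup>q\<close> and \<open>H\<^sup>k\<close> are represented by functions, not by classes modulo null sets; all norms
  below are therefore seminorms vanishing on functions that are zero almost everywhere.
  The real-valued norms are meaningful only on the corresponding space.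
\<close>

definition Lq :: "real \<Rightarrow> (real \<Rightarrow> real) set" where
  "Lq q = {f. f \<in> borel_measurable lebesgue \<and> integrable lebesgue (\<lambda>x. \<bar>f x\<bar> powr q)}"

definition Lq_norm :: "real \<Rightarrow> (real \<Rightarrow> real) \<Rightarrow> real" where
  "Lq_norm q f = (LINT x|lebesgue. \<bar>f x\<bar> powr q) powr (1 / q)"

text \<open>Extended-real valued: it is \<open>\<infinity>\<close> if \<open>f\<close> is not essentially bounded or not measurable.\<close>

definition Linf_norm :: "(real \<Rightarrow> real) \<Rightarrow> ereal" where
  "Linf_norm f = esssup lebesgue (\<lambda>x. ereal \<bar>f x\<bar>)"

definition test_function :: "(real \<Rightarrow> real) \<Rightarrow> bool" where
  "test_function \<phi> \<longleftrightarrow> (\<forall>k. C_diff k \<phi>) \<and> compact (closure {x. \<phi> x \<noteq> 0})"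

definition locally_integrable :: "(real \<Rightarrow> real) \<Rightarrow> bool" where
  "locally_integrable f \<longleftrightarrow> (\<forall>a b. set_integrable lebesgue {a..b} f)"

definition has_weak_deriv :: "nat \<Rightarrow> (real \<Rightarrow> real) \<Rightarrow> (real \<Rightarrow> real) \<Rightarrow> bool" where
  "has_weak_deriv k f g \<longleftrightarrow> locally_integrable f \<and> locally_integrable g \<and>
     (\<forall>\<phi>. test_function \<phi> \<longrightarrow>
        (LINT x|lebesgue. f x * (deriv ^^ k) \<phi> x) = (- 1) ^ k * (LINT x|lebesgue. g x * \<phi> x))"

text \<open>A chosen representative; weak derivatives are unique up to null sets.\<close>

definition weak_deriv :: "nat \<Rightarrow> (real \<Rightarrow> real) \<Rightarrow> real \<Rightarrow> real" where
  "weak_deriv k f = (SOME g. has_weak_deriv k f g)"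

definition Hk :: "nat \<Rightarrow> (real \<Rightarrow> real) set" where
  "Hk k = {f \<in> Lq 2. \<forall>j\<le>k. \<exists>g\<in>Lq 2. has_weak_deriv j f g}"

definition Hk_norm :: "nat \<Rightarrow> (real \<Rightarrow> real) \<Rightarrow> real" where
  "Hk_norm k f = sqrt (\<Sum>j\<le>k. (Lq_norm 2 (weak_deriv j f))\<^sup>2)"

text \<open>
  Spaces of functions of time \<open>t\<close> with values in a function space \<open>X\<close> (in \<open>x\<close>) with norm \<open>N\<close>.
  \<open>Bochner_measurable\<close> is strong measurability on \<open>(0,\<infinity>)\<close>: almost everywhere the limit, in the
  norm \<open>N\<close>, of measurable functions with finitely many values in \<open>X\<close>.
\<close>

definition C0_time :: "(real \<Rightarrow> real) set \<Rightarrow> ((real \<Rightarrow> real) \<Rightarrow> real) \<Rightarrow> (real \<Rightarrow> real \<Rightarrow> real) set" where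
  "C0_time X N = {v. (\<forall>t\<ge>0. v t \<in> X) \<and>
     (\<forall>t\<ge>0. ((\<lambda>s. N (\<lambda>x. v s x - v t x)) \<longlongrightarrow> 0) (at t within {0..}))}"

definition Bochner_measurable ::
    "(real \<Rightarrow> real) set \<Rightarrow> ((real \<Rightarrow> real) \<Rightarrow> real) \<Rightarrow> (real \<Rightarrow> real \<Rightarrow> real) \<Rightarrow> bool" where
  "Bochner_measurable X N v \<longleftrightarrow>
     (AE t in lebesgue. t > 0 \<longrightarrow> v t \<in> X) \<and>
     (\<exists>s :: nat \<Rightarrow> real \<Rightarrow> real \<Rightarrow> real.
        (\<forall>n. finite (range (s n)) \<and> range (s n) \<subseteq> X \<and> (\<forall>g. {t. s n t = g} \<in> sets lebesgue)) \<and>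
        (AE t in lebesgue. t > 0 \<longrightarrow> (\<lambda>n. N (\<lambda>x. s n t x - v t x)) \<longlonglongrightarrow> 0))"

definition Linf_time :: "(real \<Rightarrow> real) set \<Rightarrow> ((real \<Rightarrow> real) \<Rightarrow> real) \<Rightarrow> (real \<Rightarrow> real \<Rightarrow> real) set" where
  "Linf_time X N = {v. Bochner_measurable X N v \<and>
     (\<exists>M. AE t in lebesgue. t > 0 \<longrightarrow> N (v t) \<le> M)}"

definition L2_time :: "(real \<Rightarrow> real) set \<Rightarrow> ((real \<Rightarrow> real) \<Rightarrow> real) \<Rightarrow> (real \<Rightarrow> real \<Rightarrow> real) set" where
  "L2_time X N = {v. Bochner_measurable X N v \<and>
     set_integrable lebesgue {0<..} (\<lambda>t. (N (v t))\<^sup>2)}"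

text \<open>
  \<open>w\<close> is the time derivative of \<open>u\<close> on \<open>[0,\<infinity>)\<close> (one-sided at \<open>0\<close>) as a limit of difference
  quotients in \<open>L\<^sup>2\<close>; this is the meaning of \<open>\<partial>\<^sub>t u\<close> for \<open>\<partial>\<^sub>t u \<in> C\<^sup>0([0,\<infinity>);L\<^sup>2)\<close>.
\<close>

definition has_time_deriv :: "(real \<Rightarrow> real \<Rightarrow> real) \<Rightarrow> (real \<Rightarrow> real \<Rightarrow> real) \<Rightarrow> bool" where
  "has_time_deriv u w \<longleftrightarrow> (\<forall>t\<ge>0.
     (\<forall>s\<ge>0. (\<lambda>x. u s x - u t x) \<in> Lq 2) \<and> w t \<in> Lq 2 \<and>
     ((\<lambda>s. Lq_norm 2 (\<lambda>x. (u s x - u t x) / (s - t) - w t x)) \<longlongrightarrow> 0) (at t within {0..}))"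

text \<open>
  Arguments: flux, viscosity, far field state, initial datum, solution \<open>u t x\<close>.
  The equation \<open>\<partial>\<^sub>x (f(u) - \<sigma>(\<partial>\<^sub>x u)) = - \<partial>\<^sub>t u\<close> is understood for each \<open>t > 0\<close> with the weak
  derivative in \<open>x\<close>. Nothing is required of \<open>u t\<close> for \<open>t < 0\<close>.
\<close>

definition global_solution ::
    "(real \<Rightarrow> real) \<Rightarrow> (real \<Rightarrow> real) \<Rightarrow> real \<Rightarrow> (real \<Rightarrow> real) \<Rightarrow> (real \<Rightarrow> real \<Rightarrow> real) \<Rightarrow> bool" where
  "global_solution f \<sigma> ut u0 u \<longleftrightarrow>
     (\<lambda>t x. u t x - ut) \<in> C0_time (Hk 2) (Hk_norm 2) \<inter> Linf_time (Hk 2) (Hk_norm 2) \<and>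
     (\<lambda>t. weak_deriv 1 (u t)) \<in> L2_time (Hk 2) (Hk_norm 2) \<and>
     (\<exists>w. has_time_deriv u w \<and>
        w \<in> C0_time (Lq 2) (Lq_norm 2) \<inter> Linf_time (Lq 2) (Lq_norm 2)
            \<inter> L2_time (Hk 1) (Hk_norm 1) \<and>
        (\<forall>t>0. has_weak_deriv 1 (\<lambda>x. f (u t x) - \<sigma> (weak_deriv 1 (u t) x)) (\<lambda>x. - w t x))) \<and>
     (AE x in lebesgue. u 0 x = u0 x)"

end

theory Submission
  imports Defs
begin

text \<open>
  Write \<open>v = u - ut\<close>.  A solution of the given class has \<open>v\<close> bounded in \<open>H\<^sup>2\<close> uniformly in time, so \<open>v\<close> and
  \<open>\<partial>\<^sub>xv\<close> take values in a fixed bounded interval.  There \<open>\<sigma>'\<close> has a positive minimum, and the viscosity is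
  uniformly parabolic: \<open>\<sigma>(z) z \<ge> c z\<^sup>2\<close>.  Testing the equation with \<open>v\<^sup>2\<^sup>m\<^sup>-\<^sup>1\<close> eliminates the flux, whose
  contribution is the integral of an exact derivative (\<open>energy_identity\<close>), and leaves
  \<open>y' \<le> - 2 m (2 m - 1) c D\<close> for \<open>y = \<integral>v\<^sup>2\<^sup>m\<close> and \<open>D = \<integral>v\<^sup>2\<^sup>m\<^sup>-\<^sup>2 |\<partial>\<^sub>xv|\<^sup>2\<close>
  (\<open>power_integral_derivative_le\<close>).

  For \<open>m = 1\<close> this bounds \<open>\<integral>v\<^sup>2\<close>.  Given that bound, the one-dimensional inequality of Nash type
  \<open>y\<^sup>m\<^sup>+\<^sup>1 \<le> K D\<^sup>m\<^sup>-\<^sup>1\<close> (\<open>Nash_type_inequality\<close>) turns the energy inequality into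
  \<open>y' \<le> - \<kappa> y\<^sup>1\<^sup>+\<^sup>p\<close> with \<open>p = 2 / (m - 1)\<close>, hence \<open>y = O((1 + t)\<^sup>-\<^sup>1\<^sup>/\<^sup>p)\<close>
  (\<open>power_integral_decay\<close>).  This is the rate of the heat equation with square integrable data.
  A rate affine in \<open>1/q\<close> is preserved by interpolation between \<open>L\<^sup>2\<close> and \<open>L\<^sup>2\<^sup>m\<close>, which covers
  all real \<open>q \<ge> 2\<close> (\<open>Lq_decay\<close>); and \<open>v\<^sup>2\<^sup>m \<le> 2 m \<integral>|v|\<^sup>2\<^sup>m\<^sup>-\<^sup>1 |\<partial>\<^sub>xv|\<close> gives the uniform
  rate up to the loss \<open>1/(4 m)\<close> (\<open>sup_decay\<close>).

  The constants obtained in this way depend on the solution through the bound for \<open>\<partial>\<^sub>xv\<close>.  They are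
  constants of the datum since the datum determines the solution, by a Gronwall argument for the
  \<open>L\<^sup>2\<close> distance of two solutions (\<open>strong_solution_unique\<close>).

  The remaining work is to justify these computations for weak derivatives and for time derivatives
  that are limits in \<open>L\<^sup>2\<close>.  A function with a weak derivative is almost everywhere the primitive of it
  (\<open>has_weak_deriv_primitive\<close>): test functions approximating trapezoids, together with the Lebesgue
  differentiation theorem, recover increments as integrals of the weak derivative.
  For such primitives integration by parts is Fubini's theorem on a triangle.  In time, power
  integrals of a bounded function that is differentiable as an \<open>L\<^sup>2\<close> valued function are
  differentiable in the classical sense (\<open>LINT_power_has_derivative\<close>).
\<close>

section \<open>Smooth compactly supported functions\<close>

definition times_diff :: "nat \<Rightarrow> (real \<Rightarrow> real) \<Rightarrow> bool" where
  "times_diff n f \<longleftrightarrow> (\<forall>j<n. \<forall>x. (deriv ^^ j) f differentiable (at x))"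

lemma times_diff_0 [simp]: "times_diff 0 f"
  by (simp add: times_diff_def)

lemma times_diff_Suc:
  "times_diff (Suc n) f \<longleftrightarrow> (\<forall>x. f differentiable (at x)) \<and> times_diff n (deriv f)"
  unfolding times_diff_def
  by (subst All_less_Suc2) (simp add: funpow_swap1)

lemma times_diff_SucI:
  assumes "\<And>x. (f has_real_derivative f' x) (at x)" "times_diff n f'"
  shows "times_diff (Suc n) f"
proof -
  have "deriv f = f'" using assms(1) by (auto intro: DERIV_imp_deriv)
  then show ?thesis
    using assms by (auto simp: times_diff_Suc real_differentiable_def)
qed

lemma times_diff_SucD:
  assumes "times_diff (Suc n) f"
  shows "(f has_real_derivative deriv f x) (at x)" "times_diff n (deriv f)"
  using assms by (auto simp: times_diff_Suc DERIV_deriv_iff_real_differentiable)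

lemma times_diff_mono: "times_diff n f \<Longrightarrow> m \<le> n \<Longrightarrow> times_diff m f"
  by (auto simp: times_diff_def)

lemma times_diff_const: "times_diff n (\<lambda>x. c)"
proof (induction n arbitrary: c)
  case (Suc n)
  show ?case by (rule times_diff_SucI[where f' = "\<lambda>x. 0"]) (auto simp: Suc)
qed simp

lemma times_diff_add: "times_diff n f \<Longrightarrow> times_diff n g \<Longrightarrow> times_diff n (\<lambda>x. f x + g x)"
proof (induction n arbitrary: f g)
  case (Suc n)
  show ?case
    by (rule times_diff_SucI[where f' = "\<lambda>x. deriv f x + deriv g x"])
       (use Suc in \<open>auto dest: times_diff_SucD intro!: derivative_intros\<close>)
qed simp

lemma times_diff_mult: "times_diff n f \<Longrightarrow> times_diff n g \<Longrightarrow> times_diff n (\<lambda>x. f x * g x)"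
proof (induction n arbitrary: f g)
  case (Suc n)
  show ?case
  proof (rule times_diff_SucI[where f' = "\<lambda>x. deriv f x * g x + deriv g x * f x"])
    show "((\<lambda>x. f x * g x) has_real_derivative deriv f x * g x + deriv g x * f x) (at x)" for x
      using Suc.prems by (auto dest!: times_diff_SucD(1)[of _ _ x] intro!: derivative_eq_intros)
    have "times_diff n f" "times_diff n g" "times_diff n (deriv f)" "times_diff n (deriv g)"
      using Suc.prems by (auto dest: times_diff_SucD times_diff_mono[where m=n])
    then show "times_diff n (\<lambda>x. deriv f x * g x + deriv g x * f x)"
      by (intro times_diff_add Suc.IH)
  qed
qed simp

lemma times_diff_affine: "times_diff n f \<Longrightarrow> times_diff n (\<lambda>x. f (a * x + b))"
proof (induction n arbitrary: f)
  case (Suc n)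
  show ?case
  proof (rule times_diff_SucI[where f' = "\<lambda>x. a * deriv f (a * x + b)"])
    show "((\<lambda>x. f (a * x + b)) has_real_derivative a * deriv f (a * x + b)) (at x)" for x
    proof -
      have "((\<lambda>x. a * x + b) has_real_derivative a) (at x)"
        by (auto intro!: derivative_eq_intros)
      from DERIV_chain2[OF times_diff_SucD(1)[OF Suc.prems] this]
      show ?thesis by (simp only: mult.commute)
    qed
    show "times_diff n (\<lambda>x. a * deriv f (a * x + b))"
      using Suc by (intro times_diff_mult times_diff_const) (auto dest: times_diff_SucD)
  qed
qed simp

lemma C_diff_all_iff: "(\<forall>k. C_diff k f) \<longleftrightarrow> (\<forall>n. times_diff n f)"
proof
  assume "\<forall>k. C_diff k f"
  then show "\<forall>n. times_diff n f" by (auto simp: C_diff_def times_diff_def)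
next
  assume *: "\<forall>n. times_diff n f"
  have "(deriv ^^ k) f differentiable (at x)" for k x
    using *[rule_format, of "Suc k"] by (auto simp: times_diff_def)
  then show "\<forall>k. C_diff k f"
    by (auto simp: C_diff_def intro!: differentiable_imp_continuous_on
        simp: differentiable_on_def intro: differentiable_at_withinI)
qed

text \<open>
  The functions \<open>x\<^sup>-\<^sup>k e\<^sup>-\<^sup>c\<^sup>/\<^sup>x\<close> on the positive half line, extended by \<open>0\<close>.
  The exponent \<open>k\<close> is a parameter because the derivative of one such function is a combination of
  two others; smoothness of the whole family then follows by induction on the order.
\<close>

definition flat_exp :: "real \<Rightarrow> nat \<Rightarrow> real \<Rightarrow> real" where
  "flat_exp c k x = (if x > 0 then inverse x ^ k * exp (- c * inverse x) else 0)"

lemma power_times_exp_tendsto_0: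
  assumes "c > 0"
  shows "((\<lambda>y. y ^ k * exp (- c * y)) \<longlongrightarrow> (0::real)) at_top"
proof -
  have "filterlim (\<lambda>y::real. c * y) at_top at_top"
    using assms by (intro filterlim_tendsto_pos_mult_at_top[OF tendsto_const]) (auto simp: filterlim_ident)
  then have "((\<lambda>y. (c * y) ^ k / exp (c * y)) \<longlongrightarrow> 0) at_top"
    by (rule filterlim_compose[OF tendsto_power_div_exp_0])
  then have "((\<lambda>y. inverse (c ^ k) * ((c * y) ^ k / exp (c * y))) \<longlongrightarrow> inverse (c ^ k) * 0) at_top"
    by (intro tendsto_intros)
  moreover have "inverse (c ^ k) * ((c * y) ^ k / exp (c * y)) = y ^ k * exp (- c * y)" for y
    using assms by (simp add: power_mult_distrib exp_minus field_simps)
  ultimately show ?thesis by simp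
qed

lemma flat_exp_has_derivative:
  assumes c: "c > 0"
  shows "(flat_exp c k has_real_derivative
            c * flat_exp c (k + 2) x + (- real k) * flat_exp c (k + 1) x) (at x)"
proof (cases "x = 0")
  case False
  show ?thesis
  proof (cases "x > 0")
    case True
    have p: "m = 0 \<or> x ^ m = x * x ^ (m - Suc 0)" for m and x :: real
      by (cases m) auto
    have "((\<lambda>x. inverse x ^ k * exp (- c * inverse x)) has_real_derivative
            c * flat_exp c (k + 2) x + (- real k) * flat_exp c (k + 1) x) (at x)"
      using True by (cases k)
        (auto intro!: derivative_eq_intros simp: flat_exp_def algebra_simps power2_eq_square p)
    then show ?thesis
      by (rule has_field_derivative_transform_within_open[of _ _ _ "{0<..}"])
         (use True in \<open>auto simp: flat_exp_def\<close>)
  next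
    case neg: False
    have "((\<lambda>x. 0) has_real_derivative c * flat_exp c (k + 2) x + (- real k) * flat_exp c (k + 1) x) (at x)"
      using neg by (auto simp: flat_exp_def)
    then show ?thesis
      by (rule has_field_derivative_transform_within_open[of _ _ _ "{..<0}"])
         (use neg False in \<open>auto simp: flat_exp_def\<close>)
  qed
next
  case True
  have "((\<lambda>y. inverse y ^ Suc k * exp (- c * inverse y)) \<longlongrightarrow> 0) (at_right 0)"
    using filterlim_compose[OF power_times_exp_tendsto_0[OF c, of "Suc k"] filterlim_inverse_at_top_right] .
  then have R: "((\<lambda>y. (flat_exp c k y - flat_exp c k 0) / (y - 0)) \<longlongrightarrow> 0) (at_right 0)"
    by (rule Lim_transform_eventually)
       (auto simp: eventually_at_filter flat_exp_def field_simps)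
  have "((\<lambda>y. 0) \<longlongrightarrow> (0::real)) (at_left 0)" by simp
  then have "((\<lambda>y. (flat_exp c k y - flat_exp c k 0) / (y - 0)) \<longlongrightarrow> 0) (at_left 0)"
    by (rule Lim_transform_eventually) (auto simp: eventually_at_filter flat_exp_def)
  with R have "((\<lambda>y. (flat_exp c k y - flat_exp c k 0) / (y - 0)) \<longlongrightarrow> 0) (at 0)"
    by (simp add: filterlim_split_at_real)
  then show ?thesis
    using True by (auto simp: has_field_derivative_iff flat_exp_def)
qed

lemma times_diff_flat_exp: "c > 0 \<Longrightarrow> times_diff n (flat_exp c k)"
proof (induction n arbitrary: k)
  case (Suc n)
  show ?case
    by (rule times_diff_SucI[OF flat_exp_has_derivative[OF \<open>c > 0\<close>]])
       (intro times_diff_add times_diff_mult times_diff_const Suc)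
qed simp

text \<open>
  As \<open>n\<close> grows the exponentials flatten, so these smooth functions increase to the indicator of
  \<open>(0,h)\<close> while staying between \<open>0\<close> and \<open>1\<close>.
\<close>

definition bump :: "real \<Rightarrow> nat \<Rightarrow> real \<Rightarrow> real" where
  "bump h n x = flat_exp (1 / Suc n) 0 x * flat_exp (1 / Suc n) 0 (h - x)"

lemma times_diff_bump: "times_diff k (bump h n)"
proof -
  have "times_diff k (\<lambda>x. flat_exp (1 / Suc n) 0 (- 1 * x + h))"
    by (intro times_diff_affine times_diff_flat_exp) simp
  then show ?thesis
    unfolding bump_def by (intro times_diff_mult times_diff_flat_exp) simp_all
qed

lemma bump_bounds: "0 \<le> bump h n x" "bump h n x \<le> 1"
proof -
  have *: "0 \<le> flat_exp (1 / Suc n) 0 y" "flat_exp (1 / Suc n) 0 y \<le> 1" for y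
    by (auto simp: flat_exp_def)
  show "0 \<le> bump h n x" "bump h n x \<le> 1"
    unfolding bump_def using * by (auto intro!: mult_le_one)
qed

lemma bump_eq_0: "x \<le> 0 \<or> x \<ge> h \<Longrightarrow> bump h n x = 0"
  by (auto simp: bump_def flat_exp_def)

lemma bump_continuous: "continuous_on S (bump h n)"
  by (rule DERIV_continuous_on[OF has_field_derivative_at_within])
     (rule times_diff_SucD(1)[OF times_diff_bump[of "Suc 0" h n]])

lemma flat_exp_tendsto_1:
  assumes "y > 0" shows "(\<lambda>n. flat_exp (1 / Suc n) 0 y) \<longlonglongrightarrow> 1"
proof -
  have "(\<lambda>n. exp (- (1 / real (Suc n)) * inverse y)) \<longlonglongrightarrow> exp (- 0 * inverse y)"
    by (intro tendsto_intros LIMSEQ_Suc[OF lim_1_over_n])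
  then show ?thesis using assms by (simp add: flat_exp_def)
qed

lemma bump_tendsto: "(\<lambda>n. bump h n x) \<longlonglongrightarrow> indicator {0<..<h} x"
proof (cases "0 < x \<and> x < h")
  case True
  then have "(\<lambda>n. bump h n x) \<longlonglongrightarrow> 1 * 1"
    unfolding bump_def by (intro tendsto_mult flat_exp_tendsto_1) auto
  with True show ?thesis by (simp add: indicator_def)
next
  case False
  then have "bump h n x = 0" for n using bump_eq_0[of x h n] by auto
  with False show ?thesis by (auto simp: indicator_def)
qed

lemma continuous_antiderivative:
  fixes q :: "real \<Rightarrow> real"
  assumes "continuous_on UNIV q"
  obtains H where "\<And>x. (H has_real_derivative q x) (at x)"
proof -
  have "continuous (at x) q" for x using assms by (simp add: continuous_on_eq_continuous_at)
  then obtain H where "\<forall>x::real. - \<infinity> < ereal x \<longrightarrow> ereal x < \<infinity> \<longrightarrow> (H has_vector_derivative q x) (at x)"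
    using einterval_antiderivative[of "-\<infinity>" "\<infinity>" q] by auto
  then show thesis using that by (auto simp: has_real_derivative_iff_has_vector_derivative)
qed

section \<open>Weak derivatives as derivatives almost everywhere\<close>

text \<open>
  The primitive of the indicator of \<open>(0,h)\<close> that vanishes on the negative half line.  A difference of
  two translates is a compactly supported trapezoid, the limit of test functions used below.
\<close>

definition ramp :: "real \<Rightarrow> real \<Rightarrow> real" where
  "ramp h x = max 0 (min h x)"

text \<open>
  The primitives of the bumps; the convergence is dominated convergence under the integral.
\<close>

lemma ramp_approx:
  assumes h: "h > 0"
  obtains Q where "\<And>n x. (Q n has_real_derivative bump h n x) (at x)"
    "\<And>n x. x \<le> 0 \<Longrightarrow> Q n x = 0" "\<And>n x. x \<ge> h \<Longrightarrow> Q n x = Q n h"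
    "\<And>n x. 0 \<le> Q n x" "\<And>n x. Q n x \<le> h"
    "\<And>x. (\<lambda>n. Q n x) \<longlonglongrightarrow> ramp h x"
proof -
  have "\<exists>F. \<forall>x. (F has_real_derivative bump h n x) (at x)" for n
    using continuous_antiderivative[OF bump_continuous] by blast
  then obtain F where F: "\<And>n x. (F n has_real_derivative bump h n x) (at x)" by metis
  define Q where "Q n x = F n x - F n 0" for n x
  have D: "(Q n has_real_derivative bump h n x) (at x)" for n x
    unfolding Q_def using F[of n x] by (auto intro!: derivative_eq_intros)
  have mono: "Q n x \<le> Q n y" if "x \<le> y" for n x y
    using that D bump_bounds(1) by (intro DERIV_nonneg_imp_nondecreasing[of x y "Q n"]) blast+
  have Q0: "Q n 0 = 0" for n by (simp add: Q_def)
  have neg: "Q n x = 0" if "x \<le> 0" for n x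
  proof (cases "x = 0")
    case False
    have "((\<lambda>x. bump h n x) has_integral (Q n 0 - Q n x)) {x..0}"
      using that D by (intro fundamental_theorem_of_calculus)
        (auto simp: has_real_derivative_iff_has_vector_derivative intro: has_vector_derivative_at_within)
    moreover have "((\<lambda>x. bump h n x) has_integral 0) {x..0}"
      by (rule has_integral_is_0) (auto intro: bump_eq_0)
    ultimately have "Q n 0 - Q n x = 0" by (rule has_integral_unique)
    then show ?thesis using Q0[of n] by simp
  qed (simp add: Q0)
  have pos: "Q n x = Q n h" if "x \<ge> h" for n x
  proof -
    have "((\<lambda>x. bump h n x) has_integral (Q n x - Q n h)) {h..x}"
      using that D by (intro fundamental_theorem_of_calculus)
        (auto simp: has_real_derivative_iff_has_vector_derivative intro: has_vector_derivative_at_within)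
    moreover have "((\<lambda>x. bump h n x) has_integral 0) {h..x}"
      by (rule has_integral_is_0) (auto intro: bump_eq_0)
    ultimately have "Q n x - Q n h = 0" by (rule has_integral_unique)
    then show ?thesis by simp
  qed
  have int: "((\<lambda>x. bump h n x) has_integral Q n x) {0..x}" if "0 \<le> x" for n x
  proof -
    have "((\<lambda>x. bump h n x) has_integral (Q n x - Q n 0)) {0..x}"
      using that D by (intro fundamental_theorem_of_calculus)
        (auto simp: has_real_derivative_iff_has_vector_derivative intro: has_vector_derivative_at_within)
    then show ?thesis using Q0 by simp
  qed
  have le: "Q n x \<le> h" for n x
  proof -
    have "Q n h \<le> h"
      using has_integral_le[OF int[of h n] has_integral_const_real[of 1 0 h]] h bump_bounds(2) by auto
    then show ?thesis using mono[of x h n] pos[of x n] by (cases "x \<le> h") auto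
  qed
  have lim: "(\<lambda>n. Q n x) \<longlonglongrightarrow> ramp h x" if x: "0 \<le> x" "x \<le> h" for x
  proof -
    have "(\<lambda>n. integral {0..x} (bump h n)) \<longlonglongrightarrow> integral {0..x} (indicator {0<..<h})"
    proof (rule dominated_convergence(2)[where h = "\<lambda>x. 1"])
      show "bump h k integrable_on {0..x}" for k
        using int[OF x(1)] by blast
    qed (use bump_bounds bump_tendsto in auto)
    moreover have "integral {0..x} (bump h n) = Q n x" for n
      using int[OF x(1)] by (rule integral_unique)
    moreover have "integral {0..x} (indicator {0<..<h} :: real \<Rightarrow> real) = integral {0..x} (\<lambda>x. 1)"
      by (rule integral_spike[where S = "{0,x}"]) (use x in \<open>auto simp: indicator_def\<close>)
    ultimately show ?thesis using x by (simp add: ramp_def)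
  qed
  have "(\<lambda>n. Q n x) \<longlonglongrightarrow> ramp h x" for x
  proof -
    consider "x \<le> 0" | "0 \<le> x" "x \<le> h" | "x \<ge> h" by linarith
    then show ?thesis
    proof cases
      case 1 then show ?thesis using neg[of x] h by (simp add: ramp_def)
    next
      case 3 then show ?thesis using pos[of x] lim[of h] h by (simp add: ramp_def)
    qed (rule lim)
  qed
  moreover have "0 \<le> Q n x" for n x
    using mono[of 0 x n] neg[of x n] Q0[of n] by (cases "x \<le> 0") auto
  ultimately show thesis
    using that[OF D neg pos _ le] by blast
qed

lemma AE_lebesgue_neq: "AE x in lebesgue. x \<noteq> (c::real)"
  by (rule AE_completion) (rule AE_lborel_singleton)

text \<open>
  The defining identity of the weak derivative, extended from test functions to a difference of
  two translated ramps: its smooth approximants converge boundedly, together with their derivatives,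
  inside the fixed interval \<open>[a,b+h]\<close>.
\<close>

lemma has_weak_deriv_trapezoid:
  assumes w: "has_weak_deriv 1 f g" and ab: "a < b" and h: "h > 0"
  shows "integral {a..a+h} f - integral {b..b+h} f
       = - (LINT x|lebesgue. (indicator {a..b+h} x *\<^sub>R g x) * (ramp h (x - a) - ramp h (x - b)))"
proof -
  define I where "I = {a..b+h}"
  define f0 where "f0 x = indicator I x *\<^sub>R f x" for x
  define g0 where "g0 x = indicator I x *\<^sub>R g x" for x
  have f0: "integrable lebesgue f0" and g0: "integrable lebesgue g0"
    using w by (auto simp: has_weak_deriv_def locally_integrable_def set_integrable_def f0_def[abs_def] g0_def[abs_def] I_def)
  have fi: "set_integrable lebesgue {c..d} f" for c d
    using w by (auto simp: has_weak_deriv_def locally_integrable_def)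
  obtain Q where Q: "\<And>n x. (Q n has_real_derivative bump h n x) (at x)"
    "\<And>n x. x \<le> 0 \<Longrightarrow> Q n x = 0" "\<And>n x. x \<ge> h \<Longrightarrow> Q n x = Q n h"
    "\<And>n x. 0 \<le> Q n x" "\<And>n x. Q n x \<le> h"
    "\<And>x. (\<lambda>n. Q n x) \<longlonglongrightarrow> ramp h x"
    using ramp_approx[OF h] by blast
  define \<phi> where "\<phi> n x = Q n (x - a) - Q n (x - b)" for n x
  have D: "(\<phi> n has_real_derivative bump h n (x - a) - bump h n (x - b)) (at x)" for n x
  proof -
    have "((\<lambda>x. Q n (x + (- c))) has_real_derivative bump h n (x + (- c))) (at x)" for c
      using Q(1)[of n "x + (-c)"] by (simp only: DERIV_shift)
    then show ?thesis
      unfolding \<phi>_def by (auto intro!: derivative_eq_intros)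
  qed
  have deriv_\<phi>: "deriv (\<phi> n) = (\<lambda>x. bump h n (x - a) - bump h n (x - b))" for n
    using D by (auto intro: DERIV_imp_deriv)
  have supp: "\<phi> n x = 0" "bump h n (x - a) - bump h n (x - b) = 0" if "x \<notin> I" for n x
  proof -
    from that consider "x < a" | "x > b + h" by (fastforce simp: I_def)
    then have "\<phi> n x = 0 \<and> bump h n (x - a) - bump h n (x - b) = 0"
    proof cases
      case 1 then show ?thesis using ab by (simp add: \<phi>_def Q(2) bump_eq_0)
    next
      case 2 then show ?thesis
        using ab Q(3)[of "x - a" n] Q(3)[of "x - b" n] by (simp add: \<phi>_def bump_eq_0)
    qed
    then show "\<phi> n x = 0" "bump h n (x - a) - bump h n (x - b) = 0" by auto
  qed
  have test: "test_function (\<phi> n)" for n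
    unfolding test_function_def
  proof
    have "times_diff k (\<lambda>x. bump h n (x - c))" for k c
      using times_diff_affine[OF times_diff_bump[of k h n], of 1 "- c"] by simp
    then have "times_diff k (\<lambda>x. bump h n (x - a) + - 1 * bump h n (x - b))" for k
      by (intro times_diff_add times_diff_mult times_diff_const)
    then have "times_diff (Suc k) (\<phi> n)" for k
      using D by (intro times_diff_SucI) auto
    then have "times_diff k (\<phi> n)" for k
      using times_diff_mono[of "Suc k" "\<phi> n" k] by simp
    then show "\<forall>k. C_diff k (\<phi> n)" by (simp add: C_diff_all_iff)
    have "{x. \<phi> n x \<noteq> 0} \<subseteq> I" using supp(1) by blast
    then show "compact (closure {x. \<phi> n x \<noteq> 0})"
      using bounded_subset[OF bounded_closed_interval[of a "b + h"]] by (simp add: I_def)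
  qed
  have eq: "(LINT x|lebesgue. f0 x * (bump h n (x - a) - bump h n (x - b)))
      = - (LINT x|lebesgue. g0 x * \<phi> n x)" for n
  proof -
    have "(LINT x|lebesgue. f x * deriv (\<phi> n) x) = - (LINT x|lebesgue. g x * \<phi> n x)"
      using w test[of n] by (simp add: has_weak_deriv_def)
    moreover have "f x * deriv (\<phi> n) x = f0 x * (bump h n (x - a) - bump h n (x - b))"
      "g x * \<phi> n x = g0 x * \<phi> n x" for x
      using supp[of x n] by (cases "x \<in> I"; simp add: f0_def g0_def deriv_\<phi>)+
    ultimately show ?thesis by simp
  qed
  have cont_b: "continuous_on UNIV (\<lambda>x. bump h n (x - a) - bump h n (x - b))" for n
    by (intro continuous_intros continuous_on_compose2[OF bump_continuous[of UNIV]]) auto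
  have cont_\<phi>: "continuous_on UNIV (\<phi> n)" for n
    by (rule DERIV_continuous_on[OF D])
  have cont_r: "continuous_on UNIV (\<lambda>x. ramp h (x - a) - ramp h (x - b))"
    unfolding ramp_def by (intro continuous_intros)
  have meas: "k \<in> borel_measurable lebesgue" if "continuous_on UNIV k" for k :: "real \<Rightarrow> real"
    using that by (intro measurable_completion) (simp add: borel_measurable_continuous_onI)
  have L1: "(\<lambda>n. LINT x|lebesgue. g0 x * \<phi> n x) \<longlonglongrightarrow>
      (LINT x|lebesgue. g0 x * (ramp h (x - a) - ramp h (x - b)))"
  proof (rule integral_dominated_convergence[where w = "\<lambda>x. \<bar>g0 x\<bar> * h"])
    show "AE x in lebesgue. norm (g0 x * \<phi> n x) \<le> \<bar>g0 x\<bar> * h" for n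
    proof (rule AE_I2)
      fix x
      have "\<bar>\<phi> n x\<bar> \<le> h"
        using Q(4)[of n "x-a"] Q(5)[of n "x-a"] Q(4)[of n "x-b"] Q(5)[of n "x-b"]
        by (auto simp: \<phi>_def)
      then show "norm (g0 x * \<phi> n x) \<le> \<bar>g0 x\<bar> * h"
        by (auto simp: abs_mult intro: mult_left_mono)
    qed
    show "AE x in lebesgue. (\<lambda>n. g0 x * \<phi> n x) \<longlonglongrightarrow> g0 x * (ramp h (x - a) - ramp h (x - b))"
      unfolding \<phi>_def by (intro AE_I2 tendsto_intros Q(6))
  qed (use g0 meas[OF cont_\<phi>] meas[OF cont_r] in auto)
  have ind_m: "(indicator {0<..<h} (x - c) :: real) = indicator {c<..<c+h} x" for x c
    by (auto simp: indicator_def)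
  have L2: "(\<lambda>n. LINT x|lebesgue. f0 x * (bump h n (x - a) - bump h n (x - b))) \<longlonglongrightarrow>
      (LINT x|lebesgue. f0 x * (indicator {a<..<a+h} x - indicator {b<..<b+h} x))"
  proof (rule integral_dominated_convergence[where w = "\<lambda>x. \<bar>f0 x\<bar>"])
    show "AE x in lebesgue. norm (f0 x * (bump h n (x - a) - bump h n (x - b))) \<le> \<bar>f0 x\<bar>" for n
    proof (rule AE_I2)
      fix x
      have "\<bar>bump h n (x - a) - bump h n (x - b)\<bar> \<le> 1"
        using bump_bounds[of h n "x-a"] bump_bounds[of h n "x-b"] by auto
      then show "norm (f0 x * (bump h n (x - a) - bump h n (x - b))) \<le> \<bar>f0 x\<bar>"
        by (auto simp: abs_mult intro: mult_left_le)
    qed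
    show "AE x in lebesgue. (\<lambda>n. f0 x * (bump h n (x - a) - bump h n (x - b))) \<longlonglongrightarrow>
       f0 x * (indicator {a<..<a+h} x - indicator {b<..<b+h} x)"
      unfolding ind_m[symmetric] by (intro AE_I2 tendsto_intros bump_tendsto)
    show "(\<lambda>x. f0 x * (indicator {a<..<a+h} x - indicator {b<..<b+h} x)) \<in> borel_measurable lebesgue"
      unfolding right_diff_distrib
      using f0 by (intro borel_measurable_integrable Bochner_Integration.integrable_diff
          integrable_real_mult_indicator) auto
  qed (use f0 meas[OF cont_b] in auto)
  have sub: "(LINT x|lebesgue. f0 x * indicator {c<..<c+h} x) = integral {c..c+h} f"
    if "a \<le> c" "c \<le> b" for c
  proof -
    have "(LINT x|lebesgue. f0 x * indicator {c<..<c+h} x) = (LINT x:{c..c+h}|lebesgue. f x)"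
      unfolding set_lebesgue_integral_def
    proof (rule integral_cong_AE)
      show "AE x in lebesgue. f0 x * indicator {c<..<c+h} x = indicator {c..c+h} x *\<^sub>R f x"
        using AE_lebesgue_neq[of c] AE_lebesgue_neq[of "c+h"]
        by eventually_elim (use that in \<open>auto simp: f0_def I_def indicator_def\<close>)
      show "(\<lambda>x. f0 x * indicator {c<..<c+h} x) \<in> borel_measurable lebesgue"
        using f0 by (intro borel_measurable_integrable integrable_real_mult_indicator) auto
    qed (use f0 fi[of c "c+h"] in \<open>auto simp: set_integrable_def\<close>)
    then show ?thesis using set_lebesgue_integral_eq_integral(2)[OF fi] by simp
  qed
  have "(LINT x|lebesgue. f0 x * (indicator {a<..<a+h} x - indicator {b<..<b+h} x))
     = - (LINT x|lebesgue. g0 x * (ramp h (x - a) - ramp h (x - b)))"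
    using LIMSEQ_unique[OF L2] tendsto_minus[OF L1] by (simp add: eq)
  moreover have "(LINT x|lebesgue. f0 x * (indicator {a<..<a+h} x - indicator {b<..<b+h} x))
     = integral {a..a+h} f - integral {b..b+h} f"
    unfolding right_diff_distrib
    using f0 ab by (subst Bochner_Integration.integral_diff)
      (auto simp: sub intro!: integrable_real_mult_indicator)
  ultimately show ?thesis by (simp add: g0_def I_def)
qed

text \<open>
  Dividing the trapezoid identity by \<open>h\<close> and letting \<open>h\<close> tend to \<open>0\<close>, the averages of \<open>f\<close> converge to
  \<open>f(a)\<close> and \<open>f(b)\<close> at Lebesgue points, and the normalized trapezoid converges to the indicator of
  \<open>(a,b]\<close>.
\<close>

lemma has_weak_deriv_increment:
  assumes w: "has_weak_deriv 1 f g"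
  obtains N where "negligible N"
    "\<And>a b. a \<notin> N \<Longrightarrow> b \<notin> N \<Longrightarrow> a < b \<Longrightarrow> f b - f a = integral {a..b} g"
proof -
  have fi: "set_integrable lebesgue {c..d} f" and gi: "set_integrable lebesgue {c..d} g" for c d
    using w by (auto simp: has_weak_deriv_def locally_integrable_def)
  have "f integrable_on cbox c d" for c d
    using set_lebesgue_integral_eq_integral(1)[OF fi] by simp
  then obtain N where N: "negligible N"
    "\<And>x e. x \<notin> N \<Longrightarrow> 0 < e \<Longrightarrow> \<exists>d>0. \<forall>h. 0 < h \<and> h < d \<longrightarrow>
        norm (integral (cbox x (x + h *\<^sub>R One)) f /\<^sub>R h ^ DIM(real) - f x) < e"
    using integrable_ccontinuous_explicit by blast
  define h where "h n = 1 / real (Suc n)" for n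
  have hpos: "h n > 0" and h0: "h \<longlonglongrightarrow> 0" and h1: "h n \<le> 1" for n
    unfolding h_def using LIMSEQ_Suc[OF lim_1_over_n] by auto
  have avg: "(\<lambda>n. integral {a..a + h n} f / h n) \<longlonglongrightarrow> f a" if "a \<notin> N" for a
  proof (rule LIMSEQ_I)
    fix e :: real assume "e > 0"
    from N(2)[OF that this] obtain d where d: "d > 0"
      "\<And>h. 0 < h \<Longrightarrow> h < d \<Longrightarrow> norm (integral {a..a+h} f / h - f a) < e"
      by (auto simp: divide_inverse mult.commute)
    obtain n0 where "\<And>n. n \<ge> n0 \<Longrightarrow> h n < d"
      using order_tendstoD(2)[OF h0 d(1)] by (auto simp: eventually_sequentially)
    then show "\<exists>no. \<forall>n\<ge>no. norm (integral {a..a + h n} f / h n - f a) < e"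
      using d(2) hpos by blast
  qed
  have "f b - f a = integral {a..b} g" if "a \<notin> N" "b \<notin> N" "a < b" for a b
  proof -
    define g0 where "g0 x = indicator {a..b+1} x *\<^sub>R g x" for x
    have g0: "integrable lebesgue g0"
      using gi[of a "b+1"] by (simp add: set_integrable_def g0_def[abs_def])
    define r where "r n x = (ramp (h n) (x - a) - ramp (h n) (x - b)) / h n" for n x
    have r_bd: "\<bar>r n x\<bar> \<le> 1" for n x
      using hpos[of n] by (auto simp: r_def ramp_def abs_le_iff field_simps)
    have step: "(\<lambda>n. ramp (h n) y / h n) \<longlonglongrightarrow> indicator {0<..} y" for y
    proof (cases "y > 0")
      case True
      have "eventually (\<lambda>n. h n < y) sequentially" by (rule order_tendstoD(2)[OF h0 True])
      then have "eventually (\<lambda>n. ramp (h n) y / h n = 1) sequentially"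
        by eventually_elim (use hpos in \<open>auto simp: ramp_def less_imp_neq[OF hpos, symmetric]\<close>)
      then show ?thesis using True by (simp add: tendsto_eventually)
    next
      case False
      then have "ramp (h n) y = 0" for n using hpos[of n] by (simp add: ramp_def)
      then show ?thesis using False by simp
    qed
    have r_lim: "(\<lambda>n. r n x) \<longlonglongrightarrow> indicator {a<..b} x" for x
    proof -
      have "(\<lambda>n. r n x) \<longlonglongrightarrow> indicator {0<..} (x - a) - indicator {0<..} (x - b)"
        unfolding r_def diff_divide_distrib by (intro tendsto_diff step)
      also have "indicator {0<..} (x - a) - indicator {0<..} (x - b) = (indicator {a<..b} x :: real)"
        using that by (auto simp: indicator_def)
      finally show ?thesis .
    qed
    have "continuous_on UNIV (\<lambda>x. r n x)" for n
      unfolding r_def ramp_def using hpos[of n] by (intro continuous_intros) auto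
    then have rm: "r n \<in> borel_measurable lebesgue" for n
      by (intro measurable_completion) (simp add: borel_measurable_continuous_onI)
    have L: "(\<lambda>n. LINT x|lebesgue. g0 x * r n x) \<longlonglongrightarrow> (LINT x|lebesgue. g0 x * indicator {a<..b} x)"
    proof (rule integral_dominated_convergence[where w = "\<lambda>x. \<bar>g0 x\<bar>"])
      show "AE x in lebesgue. norm (g0 x * r n x) \<le> \<bar>g0 x\<bar>" for n
        by (rule AE_I2) (use r_bd[of n] in \<open>simp add: abs_mult mult_left_le\<close>)
      show "AE x in lebesgue. (\<lambda>n. g0 x * r n x) \<longlonglongrightarrow> g0 x * indicator {a<..b} x"
        by (intro AE_I2 tendsto_mult tendsto_const r_lim)
      show "(\<lambda>x. g0 x * indicator {a<..b} x) \<in> borel_measurable lebesgue"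
        using g0 by (intro borel_measurable_integrable integrable_real_mult_indicator) auto
    qed (use g0 rm in auto)
    have eq: "integral {b..b + h n} f / h n - integral {a..a + h n} f / h n = (LINT x|lebesgue. g0 x * r n x)" for n
    proof -
      have "(LINT x|lebesgue. g0 x * r n x) = (LINT x|lebesgue. (g0 x * (ramp (h n) (x - a) - ramp (h n) (x - b))) / h n)"
        by (simp add: r_def)
      also have "\<dots> = (LINT x|lebesgue. g0 x * (ramp (h n) (x - a) - ramp (h n) (x - b))) / h n"
        by (rule integral_divide_zero)
      also have "(LINT x|lebesgue. g0 x * (ramp (h n) (x - a) - ramp (h n) (x - b)))
         = (LINT x|lebesgue. (indicator {a..b+h n} x *\<^sub>R g x) * (ramp (h n) (x - a) - ramp (h n) (x - b)))"
      proof (rule Bochner_Integration.integral_cong)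
        fix x
        show "g0 x * (ramp (h n) (x - a) - ramp (h n) (x - b))
          = (indicator {a..b+h n} x *\<^sub>R g x) * (ramp (h n) (x - a) - ramp (h n) (x - b))"
        proof (cases "x \<le> b + h n")
          case True then show ?thesis using h1[of n] by (auto simp: g0_def indicator_def)
        next
          case False
          then have "ramp (h n) (x - a) - ramp (h n) (x - b) = 0"
            using that hpos[of n] by (simp add: ramp_def)
          then show ?thesis by simp
        qed
      qed simp
      also have "\<dots> = integral {b..b + h n} f - integral {a..a + h n} f"
        using has_weak_deriv_trapezoid[OF w \<open>a < b\<close> hpos[of n]] by simp
      finally show ?thesis by (simp add: diff_divide_distrib)
    qed
    have "(\<lambda>n. LINT x|lebesgue. g0 x * r n x) \<longlonglongrightarrow> f b - f a"
      unfolding eq[symmetric] by (intro tendsto_diff avg that)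
    from LIMSEQ_unique[OF this L]
    have "f b - f a = (LINT x|lebesgue. g0 x * indicator {a<..b} x)" .
    also have "\<dots> = (LINT x:{a..b}|lebesgue. g x)"
      unfolding set_lebesgue_integral_def
    proof (rule integral_cong_AE)
      show "AE x in lebesgue. g0 x * indicator {a<..b} x = indicator {a..b} x *\<^sub>R g x"
        using AE_lebesgue_neq[of a] by eventually_elim (auto simp: g0_def indicator_def)
      show "(\<lambda>x. g0 x * indicator {a<..b} x) \<in> borel_measurable lebesgue"
        using g0 by (intro borel_measurable_integrable integrable_real_mult_indicator) auto
    qed (use g0 gi[of a b] in \<open>auto simp: set_integrable_def\<close>)
    finally show ?thesis using set_lebesgue_integral_eq_integral(2)[OF gi] by simp
  qed
  with N(1) that show thesis by blast
qed

section \<open>Square integrable functions\<close>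

definition sq_integrable :: "(real \<Rightarrow> real) \<Rightarrow> bool" where
  "sq_integrable f \<longleftrightarrow> f \<in> borel_measurable lebesgue \<and> integrable lebesgue (\<lambda>x. (f x)\<^sup>2)"

lemma abs_powr_2: "\<bar>x::real\<bar> powr 2 = x\<^sup>2"
  by (cases "x = 0") (auto simp: powr_numeral)

lemma Lq_2_iff: "f \<in> Lq 2 \<longleftrightarrow> sq_integrable f"
  by (simp add: Lq_def sq_integrable_def abs_powr_2)

lemma Lq_norm_2: "Lq_norm 2 f = sqrt (LINT x|lebesgue. (f x)\<^sup>2)"
  by (simp add: Lq_norm_def abs_powr_2 powr_half_sqrt)

lemma sq_integrable_meas: "sq_integrable f \<Longrightarrow> f \<in> borel_measurable lebesgue"
  and sq_integrable_int: "sq_integrable f \<Longrightarrow> integrable lebesgue (\<lambda>x. (f x)\<^sup>2)"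
  by (auto simp: sq_integrable_def)

lemma sq_integrable_bound:
  assumes g: "sq_integrable g" and f: "f \<in> borel_measurable lebesgue"
    and le: "AE x in lebesgue. \<bar>f x\<bar> \<le> K * \<bar>g x\<bar>"
  shows "sq_integrable f"
proof -
  have "integrable lebesgue (\<lambda>x. (f x)\<^sup>2)"
  proof (rule Bochner_Integration.integrable_bound)
    show "integrable lebesgue (\<lambda>x. K\<^sup>2 * (g x)\<^sup>2)"
      using sq_integrable_int[OF g] by simp
    show "AE x in lebesgue. norm ((f x)\<^sup>2) \<le> norm (K\<^sup>2 * (g x)\<^sup>2)"
      using le
    proof eventually_elim
      case (elim x)
      have "\<bar>f x\<bar>\<^sup>2 \<le> (K * \<bar>g x\<bar>)\<^sup>2" using elim by (intro power_mono) auto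
      then show ?case by (simp add: power_mult_distrib)
    qed
  qed (use f in measurable)
  then show ?thesis using f by (simp add: sq_integrable_def)
qed

lemma sq_integrable_cong:
  assumes "sq_integrable f" "g \<in> borel_measurable lebesgue" "AE x in lebesgue. f x = g x"
  shows "sq_integrable g"
  using assms by (intro sq_integrable_bound[of f g 1]) auto

lemma sq_integrable_mult:
  assumes "sq_integrable f" "sq_integrable g"
  shows "integrable lebesgue (\<lambda>x. f x * g x)"
proof (rule Bochner_Integration.integrable_bound)
  show "integrable lebesgue (\<lambda>x. (f x)\<^sup>2 + (g x)\<^sup>2)"
    using assms by (auto simp: sq_integrable_def)
  show "AE x in lebesgue. norm (f x * g x) \<le> norm ((f x)\<^sup>2 + (g x)\<^sup>2)"
  proof (rule AE_I2)
    fix x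
    have "2 * \<bar>f x * g x\<bar> \<le> (f x)\<^sup>2 + (g x)\<^sup>2"
      using sum_squares_bound[of "\<bar>f x\<bar>" "\<bar>g x\<bar>"] by (simp add: abs_mult)
    moreover have "0 \<le> \<bar>f x * g x\<bar>" by simp
    ultimately show "norm (f x * g x) \<le> norm ((f x)\<^sup>2 + (g x)\<^sup>2)"
      unfolding real_norm_def by linarith
  qed
qed (use assms in \<open>auto simp: sq_integrable_def\<close>)

lemma sq_integrable_cmult: "sq_integrable f \<Longrightarrow> sq_integrable (\<lambda>x. c * f x)"
  by (auto simp: sq_integrable_def power_mult_distrib)

lemma sq_integrable_add:
  assumes "sq_integrable f" "sq_integrable g"
  shows "sq_integrable (\<lambda>x. f x + g x)"
proof -
  have "integrable lebesgue (\<lambda>x. (f x)\<^sup>2 + (g x)\<^sup>2 + 2 * (f x * g x))"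
    using assms sq_integrable_mult[OF assms] by (auto simp: sq_integrable_def)
  then have "integrable lebesgue (\<lambda>x. (f x + g x)\<^sup>2)"
    by (simp add: power2_sum mult.assoc)
  then show ?thesis using assms by (auto simp: sq_integrable_def)
qed

lemma sq_integrable_diff:
  assumes "sq_integrable f" "sq_integrable g"
  shows "sq_integrable (\<lambda>x. f x - g x)"
  using sq_integrable_add[OF assms(1) sq_integrable_cmult[OF assms(2), of "-1"]] by simp

lemma sq_integrable_mult_bounded:
  assumes "sq_integrable g" "f \<in> borel_measurable lebesgue" "AE x in lebesgue. \<bar>f x\<bar> \<le> K"
  shows "sq_integrable (\<lambda>x. f x * g x)"
proof (rule sq_integrable_bound[OF assms(1)])
  show "AE x in lebesgue. \<bar>f x * g x\<bar> \<le> K * \<bar>g x\<bar>"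
    using assms(3) by eventually_elim (auto simp: abs_mult intro: mult_right_mono)
qed (use assms in \<open>auto simp: sq_integrable_def\<close>)

text \<open>
  The quadratic \<open>\<integral>(f - l g)\<^sup>2\<close> in \<open>l\<close> is nonnegative, hence has nonpositive discriminant.
\<close>

lemma Cauchy_Schwarz_LINT:
  assumes "sq_integrable f" "sq_integrable g"
  shows "(LINT x|lebesgue. f x * g x)\<^sup>2 \<le> (LINT x|lebesgue. (f x)\<^sup>2) * (LINT x|lebesgue. (g x)\<^sup>2)"
proof -
  define A where "A = (LINT x|lebesgue. (f x)\<^sup>2)"
  define B where "B = (LINT x|lebesgue. f x * g x)"
  define C where "C = (LINT x|lebesgue. (g x)\<^sup>2)"
  have "0 \<le> C" by (auto simp: C_def)
  have *: "0 \<le> A - 2 * l * B + l\<^sup>2 * C" for l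
  proof -
    have "0 \<le> (LINT x|lebesgue. (f x - l * g x)\<^sup>2)" by simp
    also have "(\<lambda>x. (f x - l * g x)\<^sup>2) = (\<lambda>x. (f x)\<^sup>2 - (2 * l) * (f x * g x) + l\<^sup>2 * (g x)\<^sup>2)"
      by (auto simp: power2_eq_square algebra_simps)
    also have "(LINT x|lebesgue. (f x)\<^sup>2 - (2 * l) * (f x * g x) + l\<^sup>2 * (g x)\<^sup>2) = A - 2 * l * B + l\<^sup>2 * C"
      using assms sq_integrable_mult[OF assms]
      by (simp add: sq_integrable_def A_def B_def C_def)
    finally show ?thesis .
  qed
  have "B\<^sup>2 \<le> A * C"
  proof (cases "C = 0")
    case True
    have "B = 0"
    proof (rule ccontr)
      assume "B \<noteq> 0"
      then show False using *[of "(A + 1) / (2 * B)"] True by (simp add: field_simps)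
    qed
    then show ?thesis using True by simp
  next
    case False
    then have "C > 0" using \<open>0 \<le> C\<close> by simp
    then have "A - 2 * (B / C) * B + (B / C)\<^sup>2 * C = A - B\<^sup>2 / C"
      by (simp add: power2_eq_square field_simps)
    then have "B\<^sup>2 / C \<le> A" using *[of "B / C"] by simp
    then show ?thesis using \<open>C > 0\<close> by (simp add: field_simps)
  qed
  then show ?thesis by (simp add: A_def B_def C_def)
qed

lemma Cauchy_Schwarz_LINT_abs:
  assumes "sq_integrable f" "sq_integrable g"
  shows "(LINT x|lebesgue. \<bar>f x * g x\<bar>) \<le> sqrt (LINT x|lebesgue. (f x)\<^sup>2) * sqrt (LINT x|lebesgue. (g x)\<^sup>2)"
proof -
  have "sq_integrable (\<lambda>x. \<bar>f x\<bar>)" "sq_integrable (\<lambda>x. \<bar>g x\<bar>)"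
    using assms by (auto simp: sq_integrable_def)
  from Cauchy_Schwarz_LINT[OF this]
  have "(LINT x|lebesgue. \<bar>f x * g x\<bar>)\<^sup>2 \<le> (LINT x|lebesgue. (f x)\<^sup>2) * (LINT x|lebesgue. (g x)\<^sup>2)"
    by (simp add: abs_mult)
  then show ?thesis
    by (simp add: real_le_rsqrt flip: real_sqrt_mult)
qed

lemma sq_integrable_indicator: "sq_integrable (indicator {a..b})"
proof -
  have "integrable lebesgue (indicator {a..b} :: real \<Rightarrow> real)"
    using lmeasurable_cbox[of a b] by (simp add: lmeasurable_iff_integrable)
  moreover have "(\<lambda>x. (indicator {a..b} x :: real)\<^sup>2) = indicator {a..b}"
    by (auto simp: indicator_def)
  ultimately show ?thesis by (simp add: sq_integrable_def)
qed

lemma continuous_measurable_lebesgue: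
  "continuous_on UNIV f \<Longrightarrow> f \<in> borel_measurable lebesgue" for f :: "real \<Rightarrow> real"
  by (intro measurable_completion) (simp add: borel_measurable_continuous_onI)

section \<open>Absolutely continuous representatives\<close>

text \<open>
  \<open>F\<close> is locally absolutely continuous and \<open>g\<close> is a version of its derivative.
\<close>

definition primitive :: "(real \<Rightarrow> real) \<Rightarrow> (real \<Rightarrow> real) \<Rightarrow> bool" where
  "primitive F g \<longleftrightarrow> locally_integrable g \<and> (\<forall>a b. a \<le> b \<longrightarrow> F b - F a = integral {a..b} g)"

lemma locally_integrable_integrable_on: "locally_integrable g \<Longrightarrow> g integrable_on {a..b}"
  by (auto simp: locally_integrable_def intro: set_lebesgue_integral_eq_integral)

lemma LINT_locally_integrable:
  "locally_integrable g \<Longrightarrow> (LINT x|lebesgue. indicator {a..b} x * g x) = integral {a..b} g"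
  using set_lebesgue_integral_eq_integral(2)[of "{a..b}" g]
  by (auto simp: locally_integrable_def set_lebesgue_integral_def)

lemma primitive_increment: "primitive F g \<Longrightarrow> a \<le> b \<Longrightarrow> F b - F a = integral {a..b} g"
  by (simp add: primitive_def)

lemma primitive_integrable: "primitive F g \<Longrightarrow> locally_integrable g"
  by (simp add: primitive_def)

lemma primitive_continuous:
  assumes "primitive F g" shows "continuous_on UNIV F"
proof -
  have "continuous (at x) F" for x
  proof -
    have "continuous_on {x-1..x+1} (\<lambda>y. F (x-1) + integral {x-1..y} g)"
      using locally_integrable_integrable_on[OF primitive_integrable[OF assms]]
      by (intro continuous_intros indefinite_integral_continuous_1)
    moreover have "F (x-1) + integral {x-1..y} g = F y" if "y \<in> {x-1..x+1}" for y
      using primitive_increment[OF assms, of "x-1" y] that by auto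
    ultimately have "continuous_on {x-1..x+1} F" by (rule continuous_on_eq)
    then show ?thesis by (rule continuous_on_interior) (auto simp: interior_atLeastAtMost_real)
  qed
  then show ?thesis by (simp add: continuous_at_imp_continuous_on)
qed

lemma primitive_DERIV:
  assumes "primitive F g" "continuous_on UNIV g"
  shows "(F has_real_derivative g x) (at x)"
proof -
  have "((\<lambda>y. integral {x-1..y} g) has_real_derivative g x) (at x within {x-1..x+1})"
    using assms(2) by (intro integral_has_real_derivative continuous_on_subset[OF assms(2)]) auto
  then have "((\<lambda>y. integral {x-1..y} g) has_real_derivative g x) (at x)"
    by (rule at_within_interior[THEN subst, rotated]) (auto simp: interior_atLeastAtMost_real)
  then have "((\<lambda>y. F (x-1) + integral {x-1..y} g) has_real_derivative g x) (at x)"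
    by (auto intro!: derivative_eq_intros)
  then show ?thesis
  proof (rule has_field_derivative_transform_within_open)
    show "F (x-1) + integral {x-1..y} g = F y" if "y \<in> {x-1<..}" for y
      using primitive_increment[OF assms(1), of "x-1" y] that by auto
  qed auto
qed

lemma DERIV_primitive:
  assumes "\<And>x. (F has_real_derivative g x) (at x)" "continuous_on UNIV g"
  shows "primitive F g"
  unfolding primitive_def locally_integrable_def
proof (intro conjI allI impI)
  fix a b :: real
  show "set_integrable lebesgue {a..b} g"
    using assms(2) by (intro absolutely_integrable_continuous_real continuous_on_subset[OF assms(2)]) auto
  assume "a \<le> b"
  then have "(g has_integral (F b - F a)) {a..b}"
    using assms(1) by (intro fundamental_theorem_of_calculus)
        (auto simp: has_real_derivative_iff_has_vector_derivative intro: has_vector_derivative_at_within)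
  then show "F b - F a = integral {a..b} g" by (simp add: integral_unique)
qed

text \<open>
  A function with a locally integrable weak derivative has a locally absolutely continuous
  representative; it is anchored at a point outside the exceptional null set.
\<close>

lemma has_weak_deriv_primitive:
  assumes w: "has_weak_deriv 1 f g"
  obtains F where "primitive F g" "AE x in lebesgue. F x = f x"
proof -
  have g: "locally_integrable g" using w by (simp add: has_weak_deriv_def)
  obtain N where N: "negligible N"
    "\<And>a b. a \<notin> N \<Longrightarrow> b \<notin> N \<Longrightarrow> a < b \<Longrightarrow> f b - f a = integral {a..b} g"
    using has_weak_deriv_increment[OF w] by blast
  have "N \<noteq> UNIV" using N(1) by auto
  then obtain z where z: "z \<notin> N" by auto
  define F where "F x = f z + (if z \<le> x then integral {z..x} g else - integral {x..z} g)" for x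
  have comb: "integral {a..b} g + integral {b..c} g = integral {a..c} g" if "a \<le> b" "b \<le> c" for a b c
    by (rule Henstock_Kurzweil_Integration.integral_combine[OF that locally_integrable_integrable_on[OF g]])
  have "primitive F g"
    unfolding primitive_def
  proof (intro conjI allI impI g)
    fix a b :: real assume "a \<le> b"
    then consider "z \<le> a" | "a < z" "z \<le> b" | "b < z" by linarith
    then show "F b - F a = integral {a..b} g"
    proof cases
      case 1 then show ?thesis using \<open>a \<le> b\<close> comb[of z a b] by (auto simp: F_def)
    next
      case 2 then show ?thesis using comb[of a z b] by (auto simp: F_def)
    next
      case 3 then show ?thesis using \<open>a \<le> b\<close> comb[of a b z] by (auto simp: F_def)
    qed
  qed
  moreover have "AE x in lebesgue. F x = f x"
  proof -
    have "F x = f x" if "x \<notin> N" for x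
      using N(2)[OF z that] N(2)[OF that z] by (cases x z rule: linorder_cases) (auto simp: F_def)
    then have "{x. F x \<noteq> f x} \<subseteq> N" by auto
    then show ?thesis
      using N(1) by (auto simp: negligible_iff_null_sets intro!: AE_I'[of N])
  qed
  ultimately show thesis by (rule that)
qed

lemma continuous_AE_eq:
  fixes F G :: "real \<Rightarrow> real"
  assumes "continuous_on UNIV F" "continuous_on UNIV G" "AE x in lebesgue. F x = G x"
  shows "F x = G x"
proof -
  have "open {x. F x - G x \<noteq> 0}"
    using assms(1,2) by (intro open_Collect_neq continuous_intros)
  moreover have "negligible {x. F x - G x \<noteq> 0}"
    using assms(3) by (auto simp: negligible_iff_null_sets AE_iff_null_sets sets.sets_into_space
      completion.complete2 eventually_ae_filter)
  ultimately have "{x. F x - G x \<noteq> 0} = {}"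
    using open_not_negligible by blast
  then show ?thesis by auto
qed

text \<open>
  The difference of the two derivatives has vanishing integral over every interval, so it vanishes
  at each of its Lebesgue points.
\<close>

lemma primitive_unique:
  assumes "primitive F g" "primitive F h"
  shows "AE x in lebesgue. g x = h x"
proof -
  define k where "k x = g x - h x" for x
  have gi: "g integrable_on {a..b}" and hi: "h integrable_on {a..b}" for a b
    using assms by (auto intro: locally_integrable_integrable_on primitive_integrable)
  have k0: "integral {a..b} k = 0" if "a \<le> b" for a b
    unfolding k_def using primitive_increment[OF assms(1) that] primitive_increment[OF assms(2) that]
    by (subst integral_diff[OF gi hi]) auto
  have "k integrable_on cbox a b" for a b :: real
    unfolding k_def using integrable_diff[OF gi hi] by simp
  then obtain N where N: "negligible N"
    "\<And>x e. x \<notin> N \<Longrightarrow> 0 < e \<Longrightarrow> \<exists>d>0. \<forall>h. 0 < h \<and> h < d \<longrightarrow>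
        norm (integral (cbox x (x + h *\<^sub>R One)) k /\<^sub>R h ^ DIM(real) - k x) < e"
    using integrable_ccontinuous_explicit by blast
  have "k x = 0" if x: "x \<notin> N" for x
  proof (rule ccontr)
    assume "k x \<noteq> 0"
    then obtain d where d: "d > 0" "\<And>h. 0 < h \<Longrightarrow> h < d \<Longrightarrow>
        norm (integral {x..x + h} k /\<^sub>R h - k x) < \<bar>k x\<bar>"
      using N(2)[OF x, of "\<bar>k x\<bar>"] by auto
    show False using d(2)[of "d/2"] d(1) k0[of x "x + d/2"] by simp
  qed
  then show ?thesis
    using N(1) by (auto simp: k_def negligible_iff_null_sets intro!: AE_I'[of N])
qed

lemma has_weak_deriv_unique:
  assumes "has_weak_deriv 1 f g" "has_weak_deriv 1 f h"
  shows "AE x in lebesgue. g x = h x"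
proof -
  obtain F where F: "primitive F g" "AE x in lebesgue. F x = f x"
    using has_weak_deriv_primitive[OF assms(1)] .
  obtain G where G: "primitive G h" "AE x in lebesgue. G x = f x"
    using has_weak_deriv_primitive[OF assms(2)] .
  have "AE x in lebesgue. F x = G x" using F(2) G(2) by eventually_elim simp
  then have "F = G"
    by (intro ext continuous_AE_eq primitive_continuous[OF F(1)] primitive_continuous[OF G(1)])
  then show ?thesis using primitive_unique[of F g h] F(1) G(1) by simp
qed

section \<open>Products of absolutely continuous functions\<close>

lemma locally_integrable_mult_continuous:
  assumes "locally_integrable g" "continuous_on UNIV F"
  shows "locally_integrable (\<lambda>x. F x * g x)"
  unfolding locally_integrable_def
proof (intro allI)
  fix a b :: real
  have "bounded (F ` {a..b})"
    using assms(2) by (intro compact_imp_bounded compact_continuous_image)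
      (auto intro: continuous_on_subset)
  then obtain K where "\<forall>x\<in>{a..b}. \<bar>F x\<bar> \<le> K" by (auto simp: bounded_iff)
  then have K: "\<bar>F x\<bar> \<le> K" if "x \<in> {a..b}" for x using that by blast
  have g: "integrable lebesgue (\<lambda>x. indicator {a..b} x *\<^sub>R g x)"
    using assms(1) by (auto simp: locally_integrable_def set_integrable_def)
  have "integrable lebesgue (\<lambda>x. F x * (indicator {a..b} x *\<^sub>R g x))"
  proof (rule Bochner_Integration.integrable_bound)
    show "integrable lebesgue (\<lambda>x. K * (indicator {a..b} x *\<^sub>R g x))"
      using g by (rule integrable_mult_right)
    show "AE x in lebesgue. norm (F x * (indicator {a..b} x *\<^sub>R g x)) \<le> norm (K * (indicator {a..b} x *\<^sub>R g x))"
    proof (rule AE_I2)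
      fix x show "norm (F x * (indicator {a..b} x *\<^sub>R g x)) \<le> norm (K * (indicator {a..b} x *\<^sub>R g x))"
        using K[of x] by (cases "x \<in> {a..b}") (auto simp: abs_mult intro!: mult_right_mono)
    qed
    show "(\<lambda>x. F x * (indicator {a..b} x *\<^sub>R g x)) \<in> borel_measurable lebesgue"
      using continuous_measurable_lebesgue[OF assms(2)] g
      by (intro borel_measurable_times) auto
  qed
  then show "set_integrable lebesgue {a..b} (\<lambda>x. F x * g x)"
    by (simp add: set_integrable_def mult.left_commute)
qed

lemma locally_integrable_add:
  "locally_integrable f \<Longrightarrow> locally_integrable g \<Longrightarrow> locally_integrable (\<lambda>x. f x + g x)"
  by (auto simp: locally_integrable_def intro: set_integral_add)

text \<open>
  Integration by parts for absolutely continuous functions, by Fubini: integrating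
  \<open>g(x) h(y)\<close> over the triangle \<open>a \<le> x \<le> y \<le> b\<close> in either order gives
  \<open>\<integral> (F(y) - F(a)) h(y) dy = \<integral> (G(b) - G(x)) g(x) dx\<close>.
\<close>

lemma primitive_product_increment:
  assumes Fg: "primitive F g" and Gh: "primitive G h" and ab: "a \<le> b"
  shows "F b * G b - F a * G a
     = (LINT x|lebesgue. indicator {a..b} x * (F x * h x)) + (LINT x|lebesgue. indicator {a..b} x * (G x * g x))"
proof -
  define g1 where "g1 x = indicator {a..b} x * g x" for x
  define h1 where "h1 x = indicator {a..b} x * h x" for x
  note lg = primitive_integrable[OF Fg] and lh = primitive_integrable[OF Gh]
  have g1: "integrable lebesgue g1" and h1: "integrable lebesgue h1"
    using lg lh by (auto simp: locally_integrable_def set_integrable_def g1_def[abs_def] h1_def[abs_def])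
  \<comment> \<open>Fubini is applied on the Borel product, hence to Borel versions of the two derivatives.\<close>
  obtain g0 where g0 [measurable]: "g0 \<in> borel_measurable lborel" and g0_eq: "AE x in lborel. g1 x = g0 x"
    using completion_ex_borel_measurable_real[of g1 lborel] g1 by auto
  obtain h0 where h0 [measurable]: "h0 \<in> borel_measurable lborel" and h0_eq: "AE x in lborel. h1 x = h0 x"
    using completion_ex_borel_measurable_real[of h1 lborel] h1 by auto
  have g0i: "integrable lborel g0"
  proof -
    have "integrable lebesgue g0"
      using g1 AE_completion[OF g0_eq] measurable_completion[OF g0] by (metis integrable_cong_AE_imp AE_symmetric)
    then show ?thesis using integrable_completion[OF g0] by simp
  qed
  have h0i: "integrable lborel h0"
  proof -
    have "integrable lebesgue h0"
      using h1 AE_completion[OF h0_eq] measurable_completion[OF h0] by (metis integrable_cong_AE_imp AE_symmetric)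
    then show ?thesis using integrable_completion[OF h0] by simp
  qed
  define K where "K x y = (g0 x * h0 y) * (if x \<le> y then 1 else 0)" for x y :: real
  have Km [measurable]: "case_prod K \<in> borel_measurable (lborel \<Otimes>\<^sub>M lborel)"
    unfolding K_def by measurable
  have Ki: "integrable (lborel \<Otimes>\<^sub>M lborel) (case_prod K)"
  proof (rule lborel_pair.Fubini_integrable[OF Km])
    have le: "\<bar>K x y\<bar> \<le> \<bar>g0 x\<bar> * \<bar>h0 y\<bar>" for x y by (auto simp: K_def abs_mult)
    have Kiy: "integrable lborel (\<lambda>y. K x y)" for x
    proof (rule Bochner_Integration.integrable_bound)
      show "integrable lborel (\<lambda>y. \<bar>g0 x\<bar> * \<bar>h0 y\<bar>)" using h0i by simp
    qed (use le in \<open>auto simp: K_def\<close>)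
    then show "AE x in lborel. integrable lborel (\<lambda>y. case_prod K (x, y))" by simp
    show "integrable lborel (\<lambda>x. LINT y|lborel. norm (case_prod K (x, y)))"
    proof (rule Bochner_Integration.integrable_bound)
      show "integrable lborel (\<lambda>x. \<bar>g0 x\<bar> * (LINT y|lborel. \<bar>h0 y\<bar>))" using g0i by simp
      show "AE x in lborel. norm (LINT y|lborel. norm (case_prod K (x, y))) \<le> norm (\<bar>g0 x\<bar> * (LINT y|lborel. \<bar>h0 y\<bar>))"
      proof (rule AE_I2)
        fix x
        have "(LINT y|lborel. \<bar>K x y\<bar>) \<le> (LINT y|lborel. \<bar>g0 x\<bar> * \<bar>h0 y\<bar>)"
          using Kiy h0i le by (intro integral_mono) auto
        then show "norm (LINT y|lborel. norm (case_prod K (x, y))) \<le> norm (\<bar>g0 x\<bar> * (LINT y|lborel. \<bar>h0 y\<bar>))"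
          by simp
      qed
    qed measurable
  qed
  have Fm [measurable]: "F \<in> borel_measurable borel" and Gm [measurable]: "G \<in> borel_measurable borel"
    using primitive_continuous[OF Fg] primitive_continuous[OF Gh]
    by (auto intro: borel_measurable_continuous_onI)
  have inner1: "AE y in lborel. (LINT x|lborel. K x y) = h0 y * (F y - F a)"
    using h0_eq
  proof eventually_elim
    case (elim y)
    show ?case
    proof (cases "y \<in> {a..b}")
      case False
      then have "h0 y = 0" using elim by (simp add: h1_def)
      then show ?thesis by (simp add: K_def)
    next
      case True
      have "(LINT x|lborel. K x y) = h0 y * (LINT x|lborel. g0 x * indicator {..y} x)"
        unfolding integral_mult_right_zero[symmetric]
        by (intro Bochner_Integration.integral_cong) (auto simp: K_def)
      also have "(LINT x|lborel. g0 x * indicator {..y} x) = (LINT x|lebesgue. g0 x * indicator {..y} x)"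
        by (rule integral_completion[symmetric]) measurable
      also have "\<dots> = (LINT x|lebesgue. indicator {a..y} x * g x)"
      proof (rule integral_cong_AE)
        show "AE x in lebesgue. g0 x * indicator {..y} x = indicator {a..y} x * g x"
          using AE_completion[OF g0_eq]
        proof eventually_elim
          case (elim x)
          show ?case unfolding elim[symmetric] using True by (auto simp: g1_def indicator_def)
        qed
        show "(\<lambda>x. g0 x * indicator {..y} x) \<in> borel_measurable lebesgue"
          by (rule measurable_completion) measurable
        show "(\<lambda>x. indicator {a..y} x * g x) \<in> borel_measurable lebesgue"
          using lg by (auto simp: locally_integrable_def set_integrable_def)
      qed
      also have "\<dots> = F y - F a"
        using LINT_locally_integrable[OF lg] primitive_increment[OF Fg] True by auto
      finally show ?thesis .
    qed
  qed
  have inner2: "AE x in lborel. (LINT y|lborel. K x y) = g0 x * (G b - G x)"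
    using g0_eq
  proof eventually_elim
    case (elim x)
    show ?case
    proof (cases "x \<in> {a..b}")
      case False
      then have "g0 x = 0" using elim by (simp add: g1_def)
      then show ?thesis by (simp add: K_def)
    next
      case True
      have "(LINT y|lborel. K x y) = g0 x * (LINT y|lborel. h0 y * indicator {x..} y)"
        unfolding integral_mult_right_zero[symmetric]
        by (intro Bochner_Integration.integral_cong) (auto simp: K_def)
      also have "(LINT y|lborel. h0 y * indicator {x..} y) = (LINT y|lebesgue. h0 y * indicator {x..} y)"
        by (rule integral_completion[symmetric]) measurable
      also have "\<dots> = (LINT y|lebesgue. indicator {x..b} y * h y)"
      proof (rule integral_cong_AE)
        show "AE y in lebesgue. h0 y * indicator {x..} y = indicator {x..b} y * h y"
          using AE_completion[OF h0_eq]
        proof eventually_elim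
          case (elim y)
          show ?case unfolding elim[symmetric] using True by (auto simp: h1_def indicator_def)
        qed
        show "(\<lambda>y. h0 y * indicator {x..} y) \<in> borel_measurable lebesgue"
          by (rule measurable_completion) measurable
        show "(\<lambda>y. indicator {x..b} y * h y) \<in> borel_measurable lebesgue"
          using lh by (auto simp: locally_integrable_def set_integrable_def)
      qed
      also have "\<dots> = G b - G x"
        using LINT_locally_integrable[OF lh] primitive_increment[OF Gh] True by auto
      finally show ?thesis .
    qed
  qed
  have i1: "integrable lebesgue (\<lambda>x. indicator {a..b} x * (F x * h x))"
    and i2: "integrable lebesgue (\<lambda>x. indicator {a..b} x * (G x * g x))"
    using locally_integrable_mult_continuous[OF lh primitive_continuous[OF Fg]]
      locally_integrable_mult_continuous[OF lg primitive_continuous[OF Gh]]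
    by (auto simp: locally_integrable_def set_integrable_def)
  have hh: "(LINT x|lebesgue. h1 x) = G b - G a" and gg: "(LINT x|lebesgue. g1 x) = F b - F a"
    using LINT_locally_integrable[OF lh] LINT_locally_integrable[OF lg]
      primitive_increment[OF Gh ab] primitive_increment[OF Fg ab] by (auto simp: g1_def h1_def)
  have "(LINT y|lborel. (LINT x|lborel. K x y)) = (LINT y|lborel. h0 y * (F y - F a))"
    using inner1 by (rule integral_cong_AE[rotated 2]) measurable
  also have "\<dots> = (LINT y|lebesgue. h0 y * (F y - F a))"
    by (rule integral_completion[symmetric]) measurable
  also have "\<dots> = (LINT y|lebesgue. indicator {a..b} y * (F y * h y) - F a * h1 y)"
  proof (rule integral_cong_AE)
    show "AE y in lebesgue. h0 y * (F y - F a) = indicator {a..b} y * (F y * h y) - F a * h1 y"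
      using AE_completion[OF h0_eq] by eventually_elim (auto simp: h1_def algebra_simps)
    show "(\<lambda>y. h0 y * (F y - F a)) \<in> borel_measurable lebesgue"
      by (rule measurable_completion) measurable
  qed (use i1 h1 in auto)
  also have "\<dots> = (LINT y|lebesgue. indicator {a..b} y * (F y * h y)) - F a * (G b - G a)"
    using i1 h1 by (simp add: hh)
  finally have A: "(LINT y|lborel. (LINT x|lborel. K x y)) = \<dots>" .
  have "(LINT x|lborel. (LINT y|lborel. K x y)) = (LINT x|lborel. g0 x * (G b - G x))"
    using inner2 by (rule integral_cong_AE[rotated 2]) measurable
  also have "\<dots> = (LINT x|lebesgue. g0 x * (G b - G x))"
    by (rule integral_completion[symmetric]) measurable
  also have "\<dots> = (LINT x|lebesgue. G b * g1 x - indicator {a..b} x * (G x * g x))"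
  proof (rule integral_cong_AE)
    show "AE x in lebesgue. g0 x * (G b - G x) = G b * g1 x - indicator {a..b} x * (G x * g x)"
      using AE_completion[OF g0_eq] by eventually_elim (auto simp: g1_def algebra_simps)
    show "(\<lambda>x. g0 x * (G b - G x)) \<in> borel_measurable lebesgue"
      by (rule measurable_completion) measurable
  qed (use i2 g1 in auto)
  also have "\<dots> = G b * (F b - F a) - (LINT x|lebesgue. indicator {a..b} x * (G x * g x))"
    using i2 g1 by (simp add: gg)
  finally have B: "(LINT x|lborel. (LINT y|lborel. K x y)) = \<dots>" .
  show ?thesis
    using lborel_pair.Fubini_integral[OF Ki] A B by (simp add: algebra_simps)
qed

lemma primitive_mult:
  assumes Fg: "primitive F g" and Gh: "primitive G h"
  shows "primitive (\<lambda>x. F x * G x) (\<lambda>x. F x * h x + G x * g x)"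
proof -
  have l1: "locally_integrable (\<lambda>x. F x * h x)" and l2: "locally_integrable (\<lambda>x. G x * g x)"
    using locally_integrable_mult_continuous[OF primitive_integrable[OF Gh] primitive_continuous[OF Fg]]
      locally_integrable_mult_continuous[OF primitive_integrable[OF Fg] primitive_continuous[OF Gh]] by auto
  have "F b * G b - F a * G a = integral {a..b} (\<lambda>x. F x * h x + G x * g x)" if "a \<le> b" for a b
    using primitive_product_increment[OF Fg Gh that]
    by (simp add: LINT_locally_integrable[OF l1] LINT_locally_integrable[OF l2]
        Henstock_Kurzweil_Integration.integral_add locally_integrable_integrable_on[OF l1]
        locally_integrable_integrable_on[OF l2])
  then show ?thesis using l1 l2 by (simp add: primitive_def locally_integrable_add)
qed

lemma primitive_LINT_increment:
  assumes "primitive F g" "a \<le> b"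
  shows "F b - F a = (LINT x|lebesgue. indicator {a..b} x * g x)"
  unfolding LINT_locally_integrable[OF primitive_integrable[OF assms(1)]]
  by (rule primitive_increment[OF assms])

lemma primitive_integral_eq_0:
  assumes F: "primitive F g" and g: "integrable lebesgue g"
    and top: "(F \<longlongrightarrow> L) at_top" and bot: "(F \<longlongrightarrow> L) at_bot"
  shows "(LINT x|lebesgue. g x) = 0"
proof -
  have "(\<lambda>n. LINT x|lebesgue. indicator {- real n..real n} x * g x) \<longlonglongrightarrow> (LINT x|lebesgue. g x)"
  proof (rule integral_dominated_convergence[where w = "\<lambda>x. \<bar>g x\<bar>"])
    show "(\<lambda>x. indicator {- real n..real n} x * g x) \<in> borel_measurable lebesgue" for n
      using primitive_integrable[OF F] by (auto simp: locally_integrable_def set_integrable_def)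
    show "AE x in lebesgue. (\<lambda>n. indicator {- real n..real n} x * g x) \<longlonglongrightarrow> g x"
    proof (rule AE_I2, rule tendsto_eventually)
      fix x :: real
      obtain n0 where "\<bar>x\<bar> \<le> real n0" using real_arch_simple[of "\<bar>x\<bar>"] by auto
      then show "eventually (\<lambda>n. indicator {- real n..real n} x * g x = g x) sequentially"
        by (intro eventually_sequentiallyI[of n0]) (auto simp: indicator_def)
    qed
  qed (use g in \<open>auto simp: indicator_def\<close>)
  then have "(\<lambda>n. F (real n) - F (- real n)) \<longlonglongrightarrow> (LINT x|lebesgue. g x)"
    by (subst primitive_LINT_increment[OF F]) simp_all
  moreover have "(\<lambda>n. F (real n) - F (- real n)) \<longlonglongrightarrow> L - L"
    by (intro tendsto_diff filterlim_compose[OF top filterlim_real_sequentially] filterlim_compose[OF bot])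
       (simp add: filterlim_uminus_at_bot filterlim_real_sequentially)
  ultimately have "(LINT x|lebesgue. g x) = L - L"
    by (rule LIMSEQ_unique)
  then show ?thesis by simp
qed

text \<open>
  The pointwise bound behind both one-dimensional interpolation inequalities of the decay proof.
\<close>

lemma primitive_abs_le_integral:
  assumes F: "primitive F g" and g: "integrable lebesgue g" and bot: "(F \<longlongrightarrow> 0) at_bot"
  shows "\<bar>F x\<bar> \<le> (LINT x|lebesgue. \<bar>g x\<bar>)"
proof -
  have le: "\<bar>F x - F a\<bar> \<le> (LINT x|lebesgue. \<bar>g x\<bar>)" if "a \<le> x" for a
  proof -
    have "\<bar>F x - F a\<bar> \<le> (LINT y|lebesgue. \<bar>indicator {a..x} y * g y\<bar>)"
      unfolding primitive_LINT_increment[OF F that] by (rule integral_abs_bound)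
    also have "\<dots> \<le> (LINT y|lebesgue. \<bar>g y\<bar>)"
      using g primitive_integrable[OF F]
      by (intro integral_mono)
         (auto simp: indicator_def locally_integrable_def set_integrable_def intro!: integrable_abs)
    finally show ?thesis .
  qed
  have "((\<lambda>a. \<bar>F x - F a\<bar>) \<longlongrightarrow> \<bar>F x - 0\<bar>) at_bot"
    by (intro tendsto_intros bot)
  then have "\<bar>F x - 0\<bar> \<le> (LINT x|lebesgue. \<bar>g x\<bar>)"
    by (rule tendsto_upperbound) (auto intro!: eventually_mono[OF eventually_le_at_bot[of x]] le)
  then show ?thesis by simp
qed

section \<open>The Sobolev space of order one on the line\<close>

definition H1_pair :: "(real \<Rightarrow> real) \<Rightarrow> (real \<Rightarrow> real) \<Rightarrow> bool" where
  "H1_pair F g \<longleftrightarrow> sq_integrable F \<and> sq_integrable g \<and> primitive F g"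

lemma H1_pairD: "H1_pair F g \<Longrightarrow> sq_integrable F" "H1_pair F g \<Longrightarrow> sq_integrable g"
  "H1_pair F g \<Longrightarrow> primitive F g" "H1_pair F g \<Longrightarrow> continuous_on UNIV F"
  by (auto simp: H1_pair_def primitive_continuous)

lemma LINT_indicator_Icc: "x \<le> y \<Longrightarrow> (LINT z|lebesgue. indicator {x..y} z) = y - x" for x y :: real
  by simp

text \<open>
  \<open>F(x)\<close> differs from \<open>F(y)\<close>, for \<open>y\<close> in \<open>[x,x+1]\<close>, by at most the \<open>L\<^sup>2\<close> norm of \<open>g\<close> on this
  interval; averaging over \<open>y\<close> gives the claim.  Keeping the integral local yields at once the
  embedding into bounded functions and the decay at infinity.
\<close>

lemma H1_pair_local_bound:
  assumes H: "H1_pair F g"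
  shows "(F x)\<^sup>2 \<le> 2 * (LINT y|lebesgue. indicator {x..x+1} y * ((F y)\<^sup>2 + (g y)\<^sup>2))"
proof -
  define I where "I = {x..x+1}"
  note sF = H1_pairD(1)[OF H] and sg = H1_pairD(2)[OF H]
  define Q where "Q = (LINT y|lebesgue. indicator I y * (g y)\<^sup>2)"
  have iI: "integrable lebesgue (\<lambda>y. indicator I y * k y)" if "integrable lebesgue k" for k :: "real \<Rightarrow> real"
    using integrable_real_mult_indicator[OF _ that, of I] by (auto simp: I_def mult.commute)
  have ind1: "integrable lebesgue (indicator I :: real \<Rightarrow> real)"
    using lmeasurable_cbox[of x "x+1"] by (simp add: lmeasurable_iff_integrable I_def)
  have Q0: "0 \<le> Q" by (auto simp: Q_def)
  have near: "(F y - F x)\<^sup>2 \<le> Q" if y: "y \<in> I" for y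
  proof -
    have sgI: "sq_integrable (\<lambda>z. indicator I z * g z)"
      using sq_integrable_meas[OF sq_integrable_indicator[of x "x+1"]]
      by (intro sq_integrable_mult_bounded[OF sg, of _ 1]) (simp_all add: I_def indicator_le_1)
    have "F y - F x = (LINT z|lebesgue. indicator {x..y} z * (indicator I z * g z))"
      unfolding primitive_LINT_increment[OF H1_pairD(3)[OF H], of x y, OF y[unfolded I_def, simplified, THEN conjunct1]]
      using y by (intro Bochner_Integration.integral_cong) (auto simp: I_def indicator_def)
    then have "(F y - F x)\<^sup>2 \<le> (LINT z|lebesgue. (indicator {x..y} z)\<^sup>2) * (LINT z|lebesgue. (indicator I z * g z)\<^sup>2)"
      using Cauchy_Schwarz_LINT[OF sq_integrable_indicator sgI] by simp
    also have "(LINT z|lebesgue. (indicator {x..y} z :: real)\<^sup>2) = (LINT z|lebesgue. indicator {x..y} z)"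
      by (intro Bochner_Integration.integral_cong) (auto simp: indicator_def)
    also have "\<dots> = y - x" using y by (intro LINT_indicator_Icc) (auto simp: I_def)
    also have "(LINT z|lebesgue. (indicator I z * g z)\<^sup>2) = Q"
      unfolding Q_def by (intro Bochner_Integration.integral_cong) (auto simp: indicator_def)
    also have "(y - x) * Q \<le> 1 * Q" using y Q0 by (intro mult_right_mono) (auto simp: I_def)
    finally show ?thesis by simp
  qed
  have pt: "indicator I y * (F x)\<^sup>2 \<le> 2 * (indicator I y * (F y)\<^sup>2) + 2 * (indicator I y * Q)" for y
  proof (cases "y \<in> I")
    case True
    have "0 \<le> (2 * F y - F x)\<^sup>2" by simp
    then have "(F x)\<^sup>2 \<le> 2 * (F y)\<^sup>2 + 2 * (F y - F x)\<^sup>2"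
      by (simp add: power2_eq_square algebra_simps)
    with near[OF True] True show ?thesis by simp
  qed simp
  have "(F x)\<^sup>2 = (LINT y|lebesgue. indicator I y * (F x)\<^sup>2)"
    using LINT_indicator_Icc[of x "x+1"] by (simp add: I_def)
  also have "\<dots> \<le> (LINT y|lebesgue. 2 * (indicator I y * (F y)\<^sup>2) + 2 * (indicator I y * Q))"
    using pt ind1 iI[OF sq_integrable_int[OF sF]]
    by (intro integral_mono) (auto intro!: Bochner_Integration.integrable_add)
  also have "\<dots> = 2 * (LINT y|lebesgue. indicator I y * (F y)\<^sup>2) + 2 * Q"
    using ind1 iI[OF sq_integrable_int[OF sF]] LINT_indicator_Icc[of x "x+1"]
    by (simp add: I_def)
  also have "\<dots> = 2 * (LINT y|lebesgue. indicator I y * ((F y)\<^sup>2 + (g y)\<^sup>2))"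
    unfolding Q_def distrib_left
    using iI[OF sq_integrable_int[OF sF]] iI[OF sq_integrable_int[OF sg]] by simp
  finally show ?thesis by (simp add: I_def)
qed

lemma H1_pair_bound:
  assumes H: "H1_pair F g"
  shows "(F x)\<^sup>2 \<le> 2 * ((LINT y|lebesgue. (F y)\<^sup>2) + (LINT y|lebesgue. (g y)\<^sup>2))"
proof -
  have i: "integrable lebesgue (\<lambda>y. (F y)\<^sup>2 + (g y)\<^sup>2)"
    using H by (auto simp: H1_pair_def sq_integrable_def)
  have "(LINT y|lebesgue. indicator {x..x+1} y * ((F y)\<^sup>2 + (g y)\<^sup>2)) \<le> (LINT y|lebesgue. (F y)\<^sup>2 + (g y)\<^sup>2)"
    using i integrable_real_mult_indicator[OF _ i, of "{x..x+1}"]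
    by (intro integral_mono) (auto simp: mult.commute indicator_def)
  also have "\<dots> = (LINT y|lebesgue. (F y)\<^sup>2) + (LINT y|lebesgue. (g y)\<^sup>2)"
    using H by (simp add: H1_pair_def sq_integrable_def)
  finally show ?thesis using H1_pair_local_bound[OF H, of x] by simp
qed

lemma H1_pair_tendsto_0:
  assumes H: "H1_pair F g"
  shows "(F \<longlongrightarrow> 0) at_top" "(F \<longlongrightarrow> 0) at_bot"
proof -
  define k where "k y = (F y)\<^sup>2 + (g y)\<^sup>2" for y
  have k: "integrable lebesgue k"
    using H by (auto simp: H1_pair_def sq_integrable_def k_def[abs_def])
  define J where "J x = (LINT y|lebesgue. indicator {x..x+1} y * k y)" for x
  have km: "(\<lambda>y. indicator {x..x+1} y * k y) \<in> borel_measurable lebesgue" for x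
    using integrable_real_mult_indicator[OF _ k, of "{x..x+1}"] by (auto simp: mult.commute)
  have le: "\<bar>indicator {x..x+1} y * k y\<bar> \<le> \<bar>k y\<bar>" for x y by (auto simp: indicator_def)
  have "((\<lambda>t. J t) \<longlongrightarrow> integral\<^sup>L lebesgue (\<lambda>y::real. 0::real)) at_top"
    unfolding J_def
  proof (rule integral_dominated_convergence_at_top[where w = "\<lambda>y. \<bar>k y\<bar>"])
    show "AE y in lebesgue. ((\<lambda>x. indicator {x..x+1} y * k y) \<longlongrightarrow> 0) at_top"
    proof (rule AE_I2, rule tendsto_eventually)
      fix y show "eventually (\<lambda>x. indicator {x..x+1} y * k y = 0) at_top"
        using eventually_gt_at_top[of y] by eventually_elim (auto simp: indicator_def)
    qed
  qed (use k km le in auto)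
  then have T: "(J \<longlongrightarrow> 0) at_top" by simp
  have "((\<lambda>t. J (- t)) \<longlongrightarrow> integral\<^sup>L lebesgue (\<lambda>y::real. 0::real)) at_top"
    unfolding J_def
  proof (rule integral_dominated_convergence_at_top[where w = "\<lambda>y. \<bar>k y\<bar>"])
    show "AE y in lebesgue. ((\<lambda>x. indicator {- x..- x+1} y * k y) \<longlongrightarrow> 0) at_top"
    proof (rule AE_I2, rule tendsto_eventually)
      fix y show "eventually (\<lambda>x. indicator {- x..- x+1} y * k y = 0) at_top"
        using eventually_gt_at_top[of "1 - y"] by eventually_elim (auto simp: indicator_def)
    qed
  qed (use k km[of "- t" for t] le[of "- t" for t] in auto)
  then have B: "(J \<longlongrightarrow> 0) at_bot" by (simp add: filterlim_at_bot_mirror)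
  have lim: "(F \<longlongrightarrow> 0) A" if "(J \<longlongrightarrow> 0) A" for A
  proof -
    have "((\<lambda>x. (F x)\<^sup>2) \<longlongrightarrow> 0) A"
    proof (rule tendsto_sandwich[of "\<lambda>_. 0" _ _ "\<lambda>x. 2 * J x"])
      show "((\<lambda>x. 2 * J x) \<longlongrightarrow> 0) A" using tendsto_mult[OF tendsto_const that, of 2] by simp
      show "eventually (\<lambda>x. (F x)\<^sup>2 \<le> 2 * J x) A"
        using H1_pair_local_bound[OF H] by (simp add: J_def k_def)
    qed auto
    then have "((\<lambda>x. sqrt ((F x)\<^sup>2)) \<longlongrightarrow> sqrt 0) A" by (rule tendsto_real_sqrt)
    then show ?thesis by (simp add: tendsto_rabs_zero_iff)
  qed
  show "(F \<longlongrightarrow> 0) at_top" "(F \<longlongrightarrow> 0) at_bot" using lim T B by auto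
qed

lemma H1_integration_by_parts:
  assumes F: "H1_pair F g" and G: "H1_pair G h"
  shows "(LINT x|lebesgue. F x * h x) = - (LINT x|lebesgue. g x * G x)"
proof -
  have i: "integrable lebesgue (\<lambda>x. F x * h x)" "integrable lebesgue (\<lambda>x. G x * g x)"
    using F G by (auto simp: H1_pair_def intro!: sq_integrable_mult)
  have lim: "((\<lambda>x. F x * G x) \<longlongrightarrow> 0) at_top" "((\<lambda>x. F x * G x) \<longlongrightarrow> 0) at_bot"
    using tendsto_mult[OF H1_pair_tendsto_0(1)[OF F] H1_pair_tendsto_0(1)[OF G]]
      tendsto_mult[OF H1_pair_tendsto_0(2)[OF F] H1_pair_tendsto_0(2)[OF G]] by auto
  have "(LINT x|lebesgue. F x * h x + G x * g x) = 0"
    using i by (intro primitive_integral_eq_0[OF primitive_mult[OF H1_pairD(3)[OF F] H1_pairD(3)[OF G]] _ lim]) auto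
  then show ?thesis using i by (simp add: mult.commute)
qed

section \<open>Weak derivatives of order two and the norm of the Sobolev space\<close>

lemma times_diff_Suc_continuous:
  "times_diff (Suc n) \<phi> \<Longrightarrow> continuous_on UNIV \<phi>"
  by (rule DERIV_continuous_on[OF has_field_derivative_at_within]) (rule times_diff_SucD(1))

text \<open>
  Where a function vanishes on an open set so does its derivative, so the support cannot grow.
\<close>

lemma test_function_deriv:
  assumes "test_function \<phi>" shows "test_function (deriv \<phi>)"
proof -
  have d: "times_diff n \<phi>" for n
    using assms by (auto simp: test_function_def C_diff_all_iff)
  have c: "compact (closure {x. \<phi> x \<noteq> 0})"
    using assms by (auto simp: test_function_def)
  have "times_diff n (deriv \<phi>)" for n
    using d[of "Suc n"] by (rule times_diff_SucD)
  moreover have "{x. deriv \<phi> x \<noteq> 0} \<subseteq> closure {x. \<phi> x \<noteq> 0}"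
  proof (rule ccontr)
    assume "\<not> ?thesis"
    then obtain x where x: "deriv \<phi> x \<noteq> 0" "x \<in> - closure {x. \<phi> x \<noteq> 0}" by auto
    have "((\<lambda>x. 0) has_real_derivative 0) (at x)" by simp
    then have "(\<phi> has_real_derivative 0) (at x)"
      by (rule has_field_derivative_transform_within_open[of _ _ _ "- closure {x. \<phi> x \<noteq> 0}"])
         (use x(2) closure_subset[of "{x. \<phi> x \<noteq> 0}"] in auto)
    then show False using x(1) by (simp add: DERIV_imp_deriv)
  qed
  then have "closure {x. deriv \<phi> x \<noteq> 0} \<subseteq> closure {x. \<phi> x \<noteq> 0}"
    by (simp add: closure_minimal)
  then have "compact (closure {x. deriv \<phi> x \<noteq> 0})"
    using c by (metis closed_closure compact_Int_closed inf.absorb_iff2)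
  ultimately show ?thesis by (auto simp: test_function_def C_diff_all_iff)
qed

lemma test_function_deriv_funpow: "test_function \<phi> \<Longrightarrow> test_function ((deriv ^^ j) \<phi>)"
  by (induction j) (auto intro: test_function_deriv)

lemma test_function_DERIV:
  "test_function \<phi> \<Longrightarrow> (\<phi> has_real_derivative deriv \<phi> x) (at x)"
  using times_diff_SucD(1)[of 0 \<phi>] by (simp add: test_function_def C_diff_all_iff)

lemma test_function_continuous: "test_function \<phi> \<Longrightarrow> continuous_on UNIV \<phi>"
  using times_diff_Suc_continuous[of 0 \<phi>] by (simp add: test_function_def C_diff_all_iff)

lemma test_function_support:
  assumes "test_function \<phi>" obtains R where "\<And>x. x \<notin> {- R..R} \<Longrightarrow> \<phi> x = 0"
proof -
  have "bounded {x. \<phi> x \<noteq> 0}"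
    using assms compact_imp_bounded bounded_subset closure_subset
    unfolding test_function_def by metis
  then obtain R where R: "\<forall>x\<in>{x. \<phi> x \<noteq> 0}. \<bar>x\<bar> \<le> R" by (auto simp: bounded_iff)
  have "\<phi> x = 0" if "x \<notin> {- R..R}" for x
    using R that by (auto simp: abs_le_iff)
  then show thesis by (rule that)
qed

lemma test_function_integrable:
  assumes f: "locally_integrable f" and \<phi>: "test_function \<phi>"
  shows "integrable lebesgue (\<lambda>x. f x * \<phi> x)"
proof -
  obtain R where R: "\<And>x. x \<notin> {- R..R} \<Longrightarrow> \<phi> x = 0" using test_function_support[OF \<phi>] by blast
  have "integrable lebesgue (\<lambda>x. indicator {- R..R} x * (\<phi> x * f x))"
    using locally_integrable_mult_continuous[OF f test_function_continuous[OF \<phi>]]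
    by (auto simp: locally_integrable_def set_integrable_def)
  moreover have "indicator {- R..R} x * (\<phi> x * f x) = f x * \<phi> x" for x
    using R[of x] by (cases "x \<in> {- R..R}") auto
  ultimately show ?thesis by simp
qed

lemma locally_integrable_const: "locally_integrable (\<lambda>x. c)"
  by (auto simp: locally_integrable_def intro!: absolutely_integrable_continuous_real)

lemma test_function_LINT_deriv:
  assumes \<phi>: "test_function \<phi>"
  shows "(LINT x|lebesgue. deriv \<phi> x) = 0"
proof -
  obtain R where R: "\<And>x. x \<notin> {- R..R} \<Longrightarrow> \<phi> x = 0" using test_function_support[OF \<phi>] by blast
  have "primitive \<phi> (deriv \<phi>)"
    using test_function_DERIV[OF \<phi>] test_function_continuous[OF test_function_deriv[OF \<phi>]]
    by (rule DERIV_primitive)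
  moreover have "integrable lebesgue (deriv \<phi>)"
    using test_function_integrable[OF locally_integrable_const[of 1] test_function_deriv[OF \<phi>]] by simp
  moreover have "(\<phi> \<longlongrightarrow> 0) at_top"
    by (rule tendsto_eventually, rule eventually_mono[OF eventually_gt_at_top[of R]]) (auto intro: R)
  moreover have "(\<phi> \<longlongrightarrow> 0) at_bot"
    by (rule tendsto_eventually, rule eventually_mono[OF eventually_gt_at_bot[of "- R"]]) (auto intro: R)
  ultimately show ?thesis by (rule primitive_integral_eq_0)
qed

lemma locally_integrable_diff:
  "locally_integrable f \<Longrightarrow> locally_integrable g \<Longrightarrow> locally_integrable (\<lambda>x. f x - g x)"
  by (auto simp: locally_integrable_def intro: set_integral_diff)

lemma locally_integrable_measurable:
  assumes "locally_integrable f" shows "f \<in> borel_measurable lebesgue"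
proof (rule borel_measurable_LIMSEQ_real)
  show "(\<lambda>x. indicator {- real n..real n} x * f x) \<in> borel_measurable lebesgue" for n
    using assms by (auto simp: locally_integrable_def set_integrable_def)
  show "(\<lambda>n. indicator {- real n..real n} x * f x) \<longlonglongrightarrow> f x" for x
  proof (rule tendsto_eventually)
    obtain n0 where "\<bar>x\<bar> \<le> real n0" using real_arch_simple[of "\<bar>x\<bar>"] by auto
    then show "eventually (\<lambda>n. indicator {- real n..real n} x * f x = f x) sequentially"
      by (intro eventually_sequentiallyI[of n0]) (auto simp: indicator_def)
  qed
qed

lemma has_weak_deriv_diff:
  assumes 1: "has_weak_deriv k f1 g1" and 2: "has_weak_deriv k f2 g2"
  shows "has_weak_deriv k (\<lambda>x. f1 x - f2 x) (\<lambda>x. g1 x - g2 x)"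
proof -
  have l: "locally_integrable f1" "locally_integrable f2" "locally_integrable g1" "locally_integrable g2"
    using assms by (auto simp: has_weak_deriv_def)
  have "(LINT x|lebesgue. (f1 x - f2 x) * (deriv ^^ k) \<phi> x) = (- 1) ^ k * (LINT x|lebesgue. (g1 x - g2 x) * \<phi> x)"
    if \<phi>: "test_function \<phi>" for \<phi>
  proof -
    have "(LINT x|lebesgue. f1 x * (deriv ^^ k) \<phi> x) = (- 1) ^ k * (LINT x|lebesgue. g1 x * \<phi> x)"
      "(LINT x|lebesgue. f2 x * (deriv ^^ k) \<phi> x) = (- 1) ^ k * (LINT x|lebesgue. g2 x * \<phi> x)"
      using assms \<phi> by (auto simp: has_weak_deriv_def)
    then show ?thesis
      using l \<phi> test_function_deriv_funpow[OF \<phi>, of k]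
      by (simp add: left_diff_distrib right_diff_distrib test_function_integrable)
  qed
  then show ?thesis using l by (auto simp: has_weak_deriv_def intro: locally_integrable_diff)
qed

lemma has_weak_deriv_diff_const:
  assumes "has_weak_deriv 1 f g" shows "has_weak_deriv 1 (\<lambda>x. f x - c) g"
proof -
  have "has_weak_deriv 1 (\<lambda>x. c) (\<lambda>x. 0)"
    by (auto simp: has_weak_deriv_def locally_integrable_const test_function_LINT_deriv)
  from has_weak_deriv_diff[OF assms this] show ?thesis by simp
qed

text \<open>
  Test the first derivative identity with \<open>\<phi>'\<close> in place of \<open>\<phi>\<close>.
\<close>

lemma has_weak_deriv_second:
  assumes fg: "has_weak_deriv 1 f g" and fh: "has_weak_deriv 2 f h"
  shows "has_weak_deriv 1 g h"
proof -
  have "(LINT x|lebesgue. g x * deriv \<phi> x) = - (LINT x|lebesgue. h x * \<phi> x)" if \<phi>: "test_function \<phi>" for \<phi>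
  proof -
    have "(LINT x|lebesgue. f x * deriv (deriv \<phi>) x) = - (LINT x|lebesgue. g x * deriv \<phi> x)"
      using fg test_function_deriv[OF \<phi>] by (auto simp: has_weak_deriv_def)
    moreover have "(LINT x|lebesgue. f x * deriv (deriv \<phi>) x) = (LINT x|lebesgue. h x * \<phi> x)"
      using fh \<phi> by (auto simp: has_weak_deriv_def numeral_2_eq_2)
    ultimately show ?thesis by simp
  qed
  then show ?thesis using fg fh by (auto simp: has_weak_deriv_def)
qed

text \<open>
  For order \<open>0\<close> the difference \<open>g - f\<close> is orthogonal to all test functions, that is, it is a weak
  derivative of the zero function.
\<close>

lemma has_weak_deriv_0_unique:
  assumes "has_weak_deriv 0 f g" shows "AE x in lebesgue. g x = f x"
proof -
  have l: "locally_integrable f" "locally_integrable g"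
    using assms by (auto simp: has_weak_deriv_def)
  have "has_weak_deriv 1 (\<lambda>x. 0) (\<lambda>x. g x - f x)"
    using assms l by (auto simp: has_weak_deriv_def locally_integrable_const locally_integrable_diff
        left_diff_distrib test_function_integrable)
  moreover have "has_weak_deriv 1 (\<lambda>x. 0) (\<lambda>x. 0)"
    by (auto simp: has_weak_deriv_def locally_integrable_const)
  ultimately show ?thesis using has_weak_deriv_unique by fastforce
qed

lemma weak_deriv_has_weak_deriv:
  "has_weak_deriv k f g \<Longrightarrow> has_weak_deriv k f (weak_deriv k f)"
  unfolding weak_deriv_def by (rule someI[of "has_weak_deriv k f"])

lemma Hk_2_diff:
  assumes "f \<in> Hk 2" "g \<in> Hk 2" shows "(\<lambda>x. f x - g x) \<in> Hk 2"
  unfolding Hk_def mem_Collect_eq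
proof (intro conjI allI impI)
  show "(\<lambda>x. f x - g x) \<in> Lq 2"
    using assms by (auto simp: Hk_def Lq_2_iff sq_integrable_diff)
  fix j :: nat assume "j \<le> 2"
  then have "\<exists>f'\<in>Lq 2. has_weak_deriv j f f'" "\<exists>g'\<in>Lq 2. has_weak_deriv j g g'"
    using assms by (simp_all add: Hk_def)
  then obtain f' g' where "f' \<in> Lq 2" "has_weak_deriv j f f'" "g' \<in> Lq 2" "has_weak_deriv j g g'"
    by blast
  then show "\<exists>k\<in>Lq 2. has_weak_deriv j (\<lambda>x. f x - g x) k"
    by (intro bexI[of _ "\<lambda>x. f' x - g' x"] has_weak_deriv_diff) (auto simp: Lq_2_iff sq_integrable_diff)
qed

lemma primitive_cong_AE:
  assumes F: "primitive F g" and h: "h \<in> borel_measurable lebesgue" and eq: "AE x in lebesgue. g x = h x"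
  shows "primitive F h"
proof -
  have g: "locally_integrable g" by (rule primitive_integrable[OF F])
  have h': "(\<lambda>x. indicator {a..b} x * h x) \<in> borel_measurable lebesgue" for a b
    using h by (intro borel_measurable_times) (auto intro: sq_integrable_meas[OF sq_integrable_indicator])
  have ae: "AE x in lebesgue. indicator {a..b} x * g x = indicator {a..b} x * h x" for a b
    using eq by eventually_elim simp
  have hl: "locally_integrable h"
    unfolding locally_integrable_def set_integrable_def
  proof (intro allI)
    fix a b
    have "integrable lebesgue (\<lambda>x. indicator {a..b} x * g x)"
      using g by (auto simp: locally_integrable_def set_integrable_def)
    then show "integrable lebesgue (\<lambda>x. indicator {a..b} x *\<^sub>R h x)"
      using integrable_cong_AE_imp[OF _ h' ae] by simp
  qed
  have "integral {a..b} g = integral {a..b} h" for a b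
    unfolding LINT_locally_integrable[OF g, symmetric] LINT_locally_integrable[OF hl, symmetric]
    using g by (intro integral_cong_AE[OF _ h' ae]) (auto simp: locally_integrable_def set_integrable_def)
  then show ?thesis using F hl by (simp add: primitive_def)
qed

lemma LINT_square_cong_AE:
  fixes f g :: "real \<Rightarrow> real"
  assumes "f \<in> borel_measurable lebesgue" "g \<in> borel_measurable lebesgue" "AE x in lebesgue. f x = g x"
  shows "(LINT x|lebesgue. (f x)\<^sup>2) = (LINT x|lebesgue. (g x)\<^sup>2)"
proof (rule integral_cong_AE)
  show "AE x in lebesgue. (f x)\<^sup>2 = (g x)\<^sup>2" using assms(3) by eventually_elim simp
  show "(\<lambda>x. (f x)\<^sup>2) \<in> borel_measurable lebesgue" using assms(1) by measurable
  show "(\<lambda>x. (g x)\<^sup>2) \<in> borel_measurable lebesgue" using assms(2) by measurable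
qed

text \<open>
  The Sobolev norm is built from arbitrarily chosen weak derivatives.  They agree almost everywhere
  with the continuous representative \<open>F\<close>, its continuous derivative \<open>g\<close> and the derivative \<open>h\<close> of \<open>g\<close>,
  so that the norm can be evaluated on these.
\<close>

lemma Hk_2_representative:
  assumes f: "f \<in> Hk 2"
  obtains F g h where "H1_pair F g" "H1_pair g h" "AE x in lebesgue. F x = f x"
    "AE x in lebesgue. weak_deriv 1 f x = g x" "\<exists>g'. has_weak_deriv 1 f g'"
    "(LINT x|lebesgue. (F x)\<^sup>2) + (LINT x|lebesgue. (g x)\<^sup>2) + (LINT x|lebesgue. (h x)\<^sup>2) = (Hk_norm 2 f)\<^sup>2"
proof -
  have ex: "\<exists>g. sq_integrable g \<and> has_weak_deriv j f g" if "j \<le> 2" for j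
  proof -
    have "\<exists>g\<in>Lq 2. has_weak_deriv j f g" using f that by (simp add: Hk_def)
    then show ?thesis by (auto simp: Lq_2_iff)
  qed
  obtain d0 where d0: "has_weak_deriv 0 f d0"
    using ex[of 0] by auto
  obtain d1 where d1: "sq_integrable d1" "has_weak_deriv 1 f d1"
    using ex[of 1] by auto
  obtain h where h: "sq_integrable h" "has_weak_deriv 2 f h"
    using ex[of 2] by auto
  have sf: "sq_integrable f" using f by (simp add: Hk_def Lq_2_iff)
  have d1h: "has_weak_deriv 1 d1 h" by (rule has_weak_deriv_second[OF d1(2) h(2)])
  obtain g where g: "primitive g h" "AE x in lebesgue. g x = d1 x"
    using has_weak_deriv_primitive[OF d1h] by blast
  obtain F where F: "primitive F d1" "AE x in lebesgue. F x = f x"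
    using has_weak_deriv_primitive[OF d1(2)] by blast
  have gm: "g \<in> borel_measurable lebesgue" and Fm: "F \<in> borel_measurable lebesgue"
    using g(1) F(1) by (auto intro!: continuous_measurable_lebesgue primitive_continuous)
  have sg: "sq_integrable g" using sq_integrable_cong[OF d1(1) gm AE_symmetric[OF g(2)]] .
  have sF: "sq_integrable F" using sq_integrable_cong[OF sf Fm AE_symmetric[OF F(2)]] .
  have Fg: "primitive F g" by (rule primitive_cong_AE[OF F(1) gm AE_symmetric[OF g(2)]])
  have P: "H1_pair F g" "H1_pair g h" using sF sg h(1) Fg g(1) by (auto simp: H1_pair_def)
  have wd: "has_weak_deriv 0 f (weak_deriv 0 f)" "has_weak_deriv 1 f (weak_deriv 1 f)"
    "has_weak_deriv 2 f (weak_deriv 2 f)"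
    using weak_deriv_has_weak_deriv[OF d0] weak_deriv_has_weak_deriv[OF d1(2)]
      weak_deriv_has_weak_deriv[OF h(2)] by auto
  have e0: "AE x in lebesgue. weak_deriv 0 f x = F x"
    using has_weak_deriv_0_unique[OF wd(1)] F(2) by eventually_elim simp
  have e1: "AE x in lebesgue. weak_deriv 1 f x = g x"
    using has_weak_deriv_unique[OF wd(2) d1(2)] g(2) by eventually_elim simp
  have e2: "AE x in lebesgue. weak_deriv 2 f x = h x"
    using has_weak_deriv_unique[OF has_weak_deriv_second[OF d1(2) wd(3)] d1h] .
  have m: "weak_deriv j f \<in> borel_measurable lebesgue" if "has_weak_deriv j f (weak_deriv j f)" for j
    using that by (auto simp: has_weak_deriv_def intro: locally_integrable_measurable)
  have "(Hk_norm 2 f)\<^sup>2 = (\<Sum>j\<le>2. (Lq_norm 2 (weak_deriv j f))\<^sup>2)"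
    by (simp add: Hk_norm_def sum_nonneg)
  also have "\<dots> = (LINT x|lebesgue. (weak_deriv 0 f x)\<^sup>2) + (LINT x|lebesgue. (weak_deriv 1 f x)\<^sup>2)
      + (LINT x|lebesgue. (weak_deriv 2 f x)\<^sup>2)"
    by (simp add: numeral_2_eq_2 Lq_norm_2[unfolded numeral_2_eq_2])
  also have "(LINT x|lebesgue. (weak_deriv 0 f x)\<^sup>2) = (LINT x|lebesgue. (F x)\<^sup>2)"
    by (rule LINT_square_cong_AE[OF m[OF wd(1)] Fm e0])
  also have "(LINT x|lebesgue. (weak_deriv 1 f x)\<^sup>2) = (LINT x|lebesgue. (g x)\<^sup>2)"
    by (rule LINT_square_cong_AE[OF m[OF wd(2)] gm e1])
  also have "(LINT x|lebesgue. (weak_deriv 2 f x)\<^sup>2) = (LINT x|lebesgue. (h x)\<^sup>2)"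
    by (rule LINT_square_cong_AE[OF m[OF wd(3)] sq_integrable_meas[OF h(1)] e2])
  finally show thesis using that[OF P F(2) e1] d1(2) by auto
qed

lemma AE_lebesgue_between:
  assumes "AE s in lebesgue. P s" "a < (b::real)"
  obtains s where "a < s" "s < b" "P s"
proof -
  have "negligible {s. \<not> P s}"
    using assms(1) by (auto simp: eventually_ae_filter negligible_iff_null_sets intro: completion.complete2)
  then have "\<not> {a<..<b} \<subseteq> {s. \<not> P s}"
    using open_not_negligible[of "{a<..<b}"] negligible_subset assms(2) by auto
  then show thesis using that by auto
qed

section \<open>Representatives of global solutions\<close>

text \<open>
  What the estimates use of a solution \<open>u = ut + v\<close>, for representatives chosen well at every time:
  \<open>g\<close> is \<open>\<partial>\<^sub>xv\<close>, \<open>w\<close> is \<open>\<partial>\<^sub>tv\<close>, and \<open>G\<close> is an absolutely continuous version of the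
  flux \<open>f(u) - \<sigma>(\<partial>\<^sub>xu)\<close>.  The bound \<open>M\<close> is uniform in time.
\<close>

definition strong_solution ::
  "(real \<Rightarrow> real) \<Rightarrow> (real \<Rightarrow> real) \<Rightarrow> real \<Rightarrow> (real \<Rightarrow> real \<Rightarrow> real) \<Rightarrow> (real \<Rightarrow> real \<Rightarrow> real)
     \<Rightarrow> (real \<Rightarrow> real \<Rightarrow> real) \<Rightarrow> real \<Rightarrow> bool" where
  "strong_solution f \<sigma> ut v g w M \<longleftrightarrow>
     (\<forall>t\<ge>0. H1_pair (v t) (g t) \<and> continuous_on UNIV (g t) \<and> (\<forall>x. \<bar>v t x\<bar> \<le> M \<and> \<bar>g t x\<bar> \<le> M) \<and>
        (LINT x|lebesgue. (g t x)\<^sup>2) \<le> M \<and> sq_integrable (w t) \<and>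
        ((\<lambda>s. LINT x|lebesgue. ((v s x - v t x) / (s - t) - w t x)\<^sup>2) \<longlongrightarrow> 0) (at t within {0..})) \<and>
     (\<forall>t>0. \<exists>G. primitive G (\<lambda>x. - w t x) \<and> (AE x in lebesgue. G x = f (ut + v t x) - \<sigma> (g t x)))"

lemma LINT_square_add_le:
  assumes "sq_integrable a" "sq_integrable b"
  shows "(LINT x|lebesgue. (a x + b x)\<^sup>2) \<le> 2 * (LINT x|lebesgue. (a x)\<^sup>2) + 2 * (LINT x|lebesgue. (b x)\<^sup>2)"
proof -
  have "(LINT x|lebesgue. (a x + b x)\<^sup>2) \<le> (LINT x|lebesgue. 2 * (a x)\<^sup>2 + 2 * (b x)\<^sup>2)"
  proof (rule integral_mono)
    fix x
    have "0 \<le> (a x - b x)\<^sup>2" by simp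
    then show "(a x + b x)\<^sup>2 \<le> 2 * (a x)\<^sup>2 + 2 * (b x)\<^sup>2"
      by (simp add: power2_eq_square algebra_simps)
  qed (use sq_integrable_int[OF sq_integrable_add[OF assms]] assms in \<open>auto simp: sq_integrable_def\<close>)
  also have "\<dots> = 2 * (LINT x|lebesgue. (a x)\<^sup>2) + 2 * (LINT x|lebesgue. (b x)\<^sup>2)"
    using assms by (simp add: sq_integrable_def)
  finally show ?thesis .
qed

lemma H1_pair_sup_bound:
  assumes "H1_pair F g" "(LINT x|lebesgue. (F x)\<^sup>2) + (LINT x|lebesgue. (g x)\<^sup>2) \<le> N\<^sup>2" "N \<ge> 0"
  shows "\<bar>F x\<bar> \<le> 2 * N"
proof -
  have "(F x)\<^sup>2 \<le> 2 * N\<^sup>2" using H1_pair_bound[OF assms(1), of x] assms(2) by simp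
  also have "\<dots> \<le> (2 * N)\<^sup>2" by (simp add: power_mult_distrib)
  finally show ?thesis using assms(3) abs_le_square_iff[of "F x" "2 * N"] by simp
qed

lemma primitive_diff:
  assumes "primitive F g" "primitive G h"
  shows "primitive (\<lambda>x. F x - G x) (\<lambda>x. g x - h x)"
proof -
  have l: "locally_integrable g" "locally_integrable h" using assms by (auto intro: primitive_integrable)
  have "(F b - G b) - (F a - G a) = integral {a..b} (\<lambda>x. g x - h x)" if "a \<le> b" for a b
    using primitive_increment[OF assms(1) that] primitive_increment[OF assms(2) that]
      locally_integrable_integrable_on[OF l(1)] locally_integrable_integrable_on[OF l(2)]
    by (subst Henstock_Kurzweil_Integration.integral_diff) auto
  then show ?thesis using l by (simp add: primitive_def locally_integrable_diff)
qed

lemma H1_pair_diff: "H1_pair F g \<Longrightarrow> H1_pair G h \<Longrightarrow> H1_pair (\<lambda>x. F x - G x) (\<lambda>x. g x - h x)"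
  by (auto simp: H1_pair_def sq_integrable_diff primitive_diff)

text \<open>
  The solution class bounds the \<open>H\<^sup>2\<close> norm only at almost every time.  Continuity in \<open>H\<^sup>2\<close> carries the
  bound to every time: each \<open>t\<close> has a good time \<open>s\<close> nearby, and \<open>v(t)\<close> and \<open>\<partial>\<^sub>xv(t)\<close> differ little from
  \<open>v(s)\<close> and \<open>\<partial>\<^sub>xv(s)\<close>.
\<close>

lemma global_solution_strong:
  assumes sol: "global_solution f \<sigma> ut u0 u"
  obtains v g w M where "strong_solution f \<sigma> ut v g w M"
    "\<forall>t\<ge>0. AE x in lebesgue. u t x = ut + v t x"
    "AE x in lebesgue. v 0 x = u0 x - ut"
proof -
  define V where "V t x = u t x - ut" for t x
  have V: "V t \<in> Hk 2" if "t \<ge> 0" for t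
    using sol that by (auto simp: global_solution_def C0_time_def V_def[abs_def])
  have V_cont: "((\<lambda>s. Hk_norm 2 (\<lambda>x. V s x - V t x)) \<longlongrightarrow> 0) (at t within {0..})" if "t \<ge> 0" for t
    using sol that by (auto simp: global_solution_def C0_time_def V_def[abs_def])
  obtain M0 where M0: "AE t in lebesgue. t > 0 \<longrightarrow> Hk_norm 2 (V t) \<le> M0"
    using sol by (auto simp: global_solution_def Linf_time_def V_def[abs_def])
  obtain w where w: "has_time_deriv u w"
    "\<And>t. t > 0 \<Longrightarrow> has_weak_deriv 1 (\<lambda>x. f (u t x) - \<sigma> (weak_deriv 1 (u t) x)) (\<lambda>x. - w t x)"
    using sol by (auto simp: global_solution_def)
  define R where "R t F g h \<longleftrightarrow> H1_pair F g \<and> H1_pair g h \<and> (AE x in lebesgue. F x = V t x) \<and>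
     (AE x in lebesgue. weak_deriv 1 (V t) x = g x) \<and> (\<exists>g'. has_weak_deriv 1 (V t) g') \<and>
     (LINT x|lebesgue. (F x)\<^sup>2) + (LINT x|lebesgue. (g x)\<^sup>2) + (LINT x|lebesgue. (h x)\<^sup>2) = (Hk_norm 2 (V t))\<^sup>2"
    for t F g h
  have "\<exists>F g h. t \<ge> 0 \<longrightarrow> R t F g h" for t
  proof (cases "t \<ge> 0")
    case True
    obtain F g h where "H1_pair F g" "H1_pair g h" "AE x in lebesgue. F x = V t x"
      "AE x in lebesgue. weak_deriv 1 (V t) x = g x" "\<exists>g'. has_weak_deriv 1 (V t) g'"
      "(LINT x|lebesgue. (F x)\<^sup>2) + (LINT x|lebesgue. (g x)\<^sup>2) + (LINT x|lebesgue. (h x)\<^sup>2) = (Hk_norm 2 (V t))\<^sup>2"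
      by (rule Hk_2_representative[OF V[OF True]])
    then have "R t F g h" unfolding R_def by (intro conjI)
    then show ?thesis by blast
  qed simp
  then obtain v g h where R: "\<And>t. t \<ge> 0 \<Longrightarrow> R t (v t) (g t) (h t)" by metis
  have vg: "\<And>t. t \<ge> 0 \<Longrightarrow> H1_pair (v t) (g t)" and gh: "\<And>t. t \<ge> 0 \<Longrightarrow> H1_pair (g t) (h t)"
    and vV: "\<And>t. t \<ge> 0 \<Longrightarrow> AE x in lebesgue. v t x = V t x"
    and wdV: "\<And>t. t \<ge> 0 \<Longrightarrow> AE x in lebesgue. weak_deriv 1 (V t) x = g t x"
    and exV: "\<And>t. t \<ge> 0 \<Longrightarrow> \<exists>g'. has_weak_deriv 1 (V t) g'"
    and normV: "\<And>t. t \<ge> 0 \<Longrightarrow> (LINT x|lebesgue. (v t x)\<^sup>2) + (LINT x|lebesgue. (g t x)\<^sup>2)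
        + (LINT x|lebesgue. (h t x)\<^sup>2) = (Hk_norm 2 (V t))\<^sup>2"
    using R by (simp_all add: R_def)
  define N where "N = \<bar>M0\<bar>"
  define M where "M = 2 * N\<^sup>2 + 2 * N + 2"
  have bounds: "\<bar>v t x\<bar> \<le> M" "\<bar>g t x\<bar> \<le> M" "(LINT x|lebesgue. (g t x)\<^sup>2) \<le> M" if t: "t \<ge> 0" for t x
  proof -
    have "eventually (\<lambda>s. Hk_norm 2 (\<lambda>x. V s x - V t x) < 1) (at t within {0..})"
      using order_tendstoD(2)[OF V_cont[OF t], of 1] by simp
    then obtain d where d: "d > 0" "\<And>s. s \<ge> 0 \<Longrightarrow> s \<noteq> t \<Longrightarrow> dist s t < d \<Longrightarrow> Hk_norm 2 (\<lambda>x. V s x - V t x) < 1"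
      by (auto simp: eventually_at)
    obtain s where s: "t < s" "s < t + d" "s > 0 \<longrightarrow> Hk_norm 2 (V s) \<le> M0"
      using AE_lebesgue_between[OF M0, of t "t + d"] d(1) by auto
    have s0: "s \<ge> 0" and sM: "Hk_norm 2 (V s) \<le> N" and sd: "Hk_norm 2 (\<lambda>x. V s x - V t x) < 1"
      using s d t by (auto simp: N_def dist_real_def)
    have Hk0: "0 \<le> Hk_norm 2 k" for k by (simp add: Hk_norm_def sum_nonneg)
    have nn: "0 \<le> (LINT x|lebesgue. (k x)\<^sup>2)" for k :: "real \<Rightarrow> real" by simp
    obtain F k l where F: "H1_pair F k" "H1_pair k l" "AE x in lebesgue. F x = V s x - V t x"
        "AE x in lebesgue. weak_deriv 1 (\<lambda>x. V s x - V t x) x = k x"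
        "\<exists>g'. has_weak_deriv 1 (\<lambda>x. V s x - V t x) g'"
      and nF: "(LINT x|lebesgue. (F x)\<^sup>2) + (LINT x|lebesgue. (k x)\<^sup>2) + (LINT x|lebesgue. (l x)\<^sup>2)
         = (Hk_norm 2 (\<lambda>x. V s x - V t x))\<^sup>2"
      by (rule Hk_2_representative[OF Hk_2_diff[OF V[OF s0] V[OF t]]])
    have nF1: "(LINT x|lebesgue. (F x)\<^sup>2) + (LINT x|lebesgue. (k x)\<^sup>2) + (LINT x|lebesgue. (l x)\<^sup>2) \<le> 1\<^sup>2"
      unfolding nF using sd Hk0 by (intro power_mono) auto
    have nS: "(LINT x|lebesgue. (v s x)\<^sup>2) + (LINT x|lebesgue. (g s x)\<^sup>2) + (LINT x|lebesgue. (h s x)\<^sup>2) \<le> N\<^sup>2"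
      unfolding normV[OF s0] using sM Hk0 by (intro power_mono) auto
    have "AE x in lebesgue. F x = v s x - v t x"
      using F(3) vV[OF s0] vV[OF t] by eventually_elim simp
    then have F_eq: "F = (\<lambda>x. v s x - v t x)"
      by (intro ext continuous_AE_eq H1_pairD(4)[OF F(1)] continuous_intros
          H1_pairD(4)[OF vg[OF s0]] H1_pairD(4)[OF vg[OF t]])
    have "AE x in lebesgue. k x = g s x - g t x"
      using primitive_unique[OF H1_pairD(3)[OF F(1)]] H1_pairD(3)[OF H1_pair_diff[OF vg[OF s0] vg[OF t]]]
      unfolding F_eq by blast
    then have k_eq: "k = (\<lambda>x. g s x - g t x)"
      by (intro ext continuous_AE_eq H1_pairD(4)[OF F(2)] continuous_intros
          H1_pairD(4)[OF gh[OF s0]] H1_pairD(4)[OF gh[OF t]])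
    have N0: "N \<ge> 0" by (simp add: N_def)
    have "(LINT x|lebesgue. (v s x)\<^sup>2) + (LINT x|lebesgue. (g s x)\<^sup>2) \<le> N\<^sup>2"
      "(LINT x|lebesgue. (g s x)\<^sup>2) + (LINT x|lebesgue. (h s x)\<^sup>2) \<le> N\<^sup>2"
      "(LINT x|lebesgue. (F x)\<^sup>2) + (LINT x|lebesgue. (k x)\<^sup>2) \<le> 1\<^sup>2"
      "(LINT x|lebesgue. (k x)\<^sup>2) + (LINT x|lebesgue. (l x)\<^sup>2) \<le> 1\<^sup>2"
      using nS nF1 nn[of "v s"] nn[of "h s"] nn[of F] nn[of l] by linarith+
    note sup = H1_pair_sup_bound[OF vg[OF s0] this(1) N0] H1_pair_sup_bound[OF gh[OF s0] this(2) N0]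
      H1_pair_sup_bound[OF F(1) this(3)] H1_pair_sup_bound[OF F(2) this(4)]
    have "\<bar>v s x\<bar> \<le> 2 * N" "\<bar>g s x\<bar> \<le> 2 * N" by (fact sup)+
    moreover have "\<bar>F x\<bar> \<le> 2 * 1" "\<bar>k x\<bar> \<le> 2 * 1" by (rule sup; simp)+
    ultimately show "\<bar>v t x\<bar> \<le> M" "\<bar>g t x\<bar> \<le> M"
      unfolding F_eq k_eq M_def using zero_le_power2[of N] by linarith+
    have "(LINT x|lebesgue. (g t x)\<^sup>2) = (LINT x|lebesgue. (g s x + (-1) * k x)\<^sup>2)"
      by (simp add: k_eq)
    also have "\<dots> \<le> 2 * (LINT x|lebesgue. (g s x)\<^sup>2) + 2 * (LINT x|lebesgue. ((-1) * k x)\<^sup>2)"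
      by (intro LINT_square_add_le sq_integrable_cmult H1_pairD(2)[OF vg[OF s0]] H1_pairD(2)[OF F(1)])
    also have "\<dots> \<le> 2 * N\<^sup>2 + 2 * 1\<^sup>2"
    proof -
      have "(LINT x|lebesgue. ((-1) * k x)\<^sup>2) = (LINT x|lebesgue. (k x)\<^sup>2)" by simp
      then show ?thesis using nS nF1 nn[of "v s"] nn[of "h s"] nn[of F] nn[of l] by linarith
    qed
    also have "\<dots> \<le> M" using N0 by (simp add: M_def)
    finally show "(LINT x|lebesgue. (g t x)\<^sup>2) \<le> M" .
  qed
  have wt: "sq_integrable (w t)" if "t \<ge> 0" for t
    using w(1) that by (auto simp: has_time_deriv_def Lq_2_iff)
  have td: "((\<lambda>s. LINT x|lebesgue. ((v s x - v t x) / (s - t) - w t x)\<^sup>2) \<longlongrightarrow> 0) (at t within {0..})"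
    if t: "t \<ge> 0" for t
  proof -
    have "((\<lambda>s. Lq_norm 2 (\<lambda>x. (u s x - u t x) / (s - t) - w t x)) \<longlongrightarrow> 0) (at t within {0..})"
      using w(1) t by (auto simp: has_time_deriv_def)
    then have "((\<lambda>s. (Lq_norm 2 (\<lambda>x. (u s x - u t x) / (s - t) - w t x))\<^sup>2) \<longlongrightarrow> 0\<^sup>2) (at t within {0..})"
      by (rule tendsto_power)
    then have "((\<lambda>s. LINT x|lebesgue. ((u s x - u t x) / (s - t) - w t x)\<^sup>2) \<longlongrightarrow> 0) (at t within {0..})"
      by (simp add: Lq_norm_2)
    moreover have "eventually (\<lambda>s. (LINT x|lebesgue. ((u s x - u t x) / (s - t) - w t x)\<^sup>2)
        = (LINT x|lebesgue. ((v s x - v t x) / (s - t) - w t x)\<^sup>2)) (at t within {0..})"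
      unfolding eventually_at_filter
    proof (intro always_eventually allI impI)
      fix s :: real assume "s \<noteq> t" and s: "s \<in> {0..}"
      then have s0: "s \<ge> 0" by simp
      have "sq_integrable (\<lambda>x. u s x - u t x)"
        using w(1) t s0 by (auto simp: has_time_deriv_def Lq_2_iff)
      then have m1: "(\<lambda>x. u s x - u t x) \<in> borel_measurable lebesgue" by (rule sq_integrable_meas)
      have m2: "(\<lambda>x. v s x - v t x) \<in> borel_measurable lebesgue"
        using sq_integrable_diff[OF H1_pairD(1)[OF vg[OF s0]] H1_pairD(1)[OF vg[OF t]]]
        by (rule sq_integrable_meas)
      show "(LINT x|lebesgue. ((u s x - u t x) / (s - t) - w t x)\<^sup>2)
        = (LINT x|lebesgue. ((v s x - v t x) / (s - t) - w t x)\<^sup>2)"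
      proof (rule LINT_square_cong_AE)
        show "AE x in lebesgue. (u s x - u t x) / (s - t) - w t x = (v s x - v t x) / (s - t) - w t x"
          using vV[OF s0] vV[OF t] by eventually_elim (simp add: V_def)
      qed (use m1 m2 sq_integrable_meas[OF wt[OF t]] in auto)
    qed
    ultimately show ?thesis by (rule Lim_transform_eventually)
  qed
  have pde: "\<exists>G. primitive G (\<lambda>x. - w t x) \<and> (AE x in lebesgue. G x = f (ut + v t x) - \<sigma> (g t x))"
    if t: "t > 0" for t
  proof -
    have t0: "t \<ge> 0" using t by simp
    obtain g' where g': "has_weak_deriv 1 (V t) g'" using exV[OF t0] by blast
    have "has_weak_deriv 1 (\<lambda>x. V t x - (- ut)) g'" by (rule has_weak_deriv_diff_const[OF g'])
    then have "has_weak_deriv 1 (u t) g'" by (simp add: V_def)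
    note has_weak_deriv_unique[OF this weak_deriv_has_weak_deriv[OF this]]
      has_weak_deriv_unique[OF g' weak_deriv_has_weak_deriv[OF g']]
    then have wd: "AE x in lebesgue. weak_deriv 1 (u t) x = g t x"
      using wdV[OF t0] by eventually_elim simp
    obtain G where G: "primitive G (\<lambda>x. - w t x)"
      "AE x in lebesgue. G x = f (u t x) - \<sigma> (weak_deriv 1 (u t) x)"
      using has_weak_deriv_primitive[OF w(2)[OF t]] by blast
    have "AE x in lebesgue. G x = f (ut + v t x) - \<sigma> (g t x)"
      using G(2) wd vV[OF t0] by eventually_elim (simp add: V_def)
    with G(1) show ?thesis by blast
  qed
  show thesis
  proof (rule that)
    show "strong_solution f \<sigma> ut v g w M"
      unfolding strong_solution_def
      using vg gh bounds wt td pde by (auto intro: H1_pairD(4))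
    show "\<forall>t\<ge>0. AE x in lebesgue. u t x = ut + v t x"
    proof (intro allI impI)
      fix t :: real assume "t \<ge> 0"
      from vV[OF this] show "AE x in lebesgue. u t x = ut + v t x"
        by eventually_elim (simp add: V_def)
    qed
    have "AE x in lebesgue. u 0 x = u0 x" using sol by (simp add: global_solution_def)
    with vV[of 0, simplified] show "AE x in lebesgue. v 0 x = u0 x - ut"
      by eventually_elim (simp add: V_def)
  qed
qed

section \<open>Differentiation of power integrals in time\<close>

text \<open>
  The remainders satisfy \<open>R\<^sub>n\<^sub>+\<^sub>1 = b R\<^sub>n + n a\<^sup>n\<^sup>-\<^sup>1 (b - a)\<^sup>2\<close>, which makes the bound an induction on \<open>n\<close>.
\<close>

lemma power_taylor_bound:
  fixes M :: real
  assumes "M \<ge> 0"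
  shows "\<exists>K\<ge>0. \<forall>a b. \<bar>a\<bar> \<le> M \<longrightarrow> \<bar>b\<bar> \<le> M \<longrightarrow>
           \<bar>b ^ n - a ^ n - real n * a ^ (n - 1) * (b - a)\<bar> \<le> K * (b - a)\<^sup>2"
proof (induction n)
  case 0
  then show ?case by (auto intro: exI[of _ 0])
next
  case (Suc n)
  then obtain K where K: "K \<ge> 0" "\<And>a b. \<bar>a\<bar> \<le> M \<Longrightarrow> \<bar>b\<bar> \<le> M \<Longrightarrow>
       \<bar>b ^ n - a ^ n - real n * a ^ (n - 1) * (b - a)\<bar> \<le> K * (b - a)\<^sup>2" by blast
  show ?case
  proof (intro exI conjI allI impI)
    show "0 \<le> M * K + real n * M ^ (n - 1)" using K(1) assms by auto
    fix a b assume a: "\<bar>a\<bar> \<le> M" and b: "\<bar>b\<bar> \<le> M"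
    have "b ^ Suc n - a ^ Suc n - real (Suc n) * a ^ (Suc n - 1) * (b - a)
       = b * (b ^ n - a ^ n - real n * a ^ (n - 1) * (b - a)) + (real n * a ^ (n - 1)) * (b - a)\<^sup>2"
      by (cases n) (simp_all add: algebra_simps power2_eq_square)
    also have "\<bar>\<dots>\<bar> \<le> \<bar>b\<bar> * \<bar>b ^ n - a ^ n - real n * a ^ (n - 1) * (b - a)\<bar> + \<bar>real n * a ^ (n - 1)\<bar> * (b - a)\<^sup>2"
      by (rule order_trans[OF abs_triangle_ineq]) (simp add: abs_mult)
    also have "\<dots> \<le> M * (K * (b - a)\<^sup>2) + (real n * M ^ (n - 1)) * (b - a)\<^sup>2"
      using K(1) K(2)[OF a b] a b assms
      by (intro add_mono mult_mono mult_right_mono) (auto simp: abs_mult power_abs intro!: mult_left_mono power_mono)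
    finally show "\<bar>b ^ Suc n - a ^ Suc n - real (Suc n) * a ^ (Suc n - 1) * (b - a)\<bar>
        \<le> (M * K + real n * M ^ (n - 1)) * (b - a)\<^sup>2"
      by (simp add: algebra_simps)
  qed
qed

lemma sq_integrable_power:
  assumes "sq_integrable v" "\<And>x. \<bar>v x\<bar> \<le> M" "k \<ge> 1"
  shows "sq_integrable (\<lambda>x. v x ^ k)"
proof -
  have "sq_integrable (\<lambda>x. v x ^ (k - 1) * v x)"
  proof (rule sq_integrable_mult_bounded[OF assms(1)])
    show "AE x in lebesgue. \<bar>v x ^ (k - 1)\<bar> \<le> M ^ (k - 1)"
      using assms(2) by (auto simp: power_abs intro!: power_mono)
  qed (use sq_integrable_meas[OF assms(1)] in auto)
  moreover have "v x ^ (k - 1) * v x = v x ^ k" for x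
    using assms(3) by (cases k) auto
  ultimately show ?thesis by simp
qed

lemma integrable_power_even:
  assumes "sq_integrable v" "\<And>x. \<bar>v x\<bar> \<le> M" "m \<ge> 1"
  shows "integrable lebesgue (\<lambda>x. v x ^ (2 * m))"
  using sq_integrable_int[OF sq_integrable_power[OF assms]]
  by (simp add: power_mult[symmetric] mult.commute)

text \<open>
  The chain rule for \<open>\<integral>v(t)\<^sup>2\<^sup>m\<close> when \<open>v\<close> is bounded and differentiable in time as an \<open>L\<^sup>2\<close> valued function.
  By the quadratic remainder bound the error of the difference quotient is at most
  \<open>K \<parallel>v(s) - v(t)\<parallel>\<^sup>2 / |s - t|\<close>, which is \<open>O(|s - t|)\<close>, plus a multiple of the \<open>L\<^sup>2\<close> error of the difference
  quotient of \<open>v\<close> itself.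
\<close>

lemma LINT_power_has_derivative:
  fixes v :: "real \<Rightarrow> real \<Rightarrow> real"
  assumes t: "t \<ge> 0" and m: "m \<ge> 1"
    and v: "\<And>s. s \<ge> 0 \<Longrightarrow> sq_integrable (v s)" "\<And>s x. s \<ge> 0 \<Longrightarrow> \<bar>v s x\<bar> \<le> M"
    and w: "sq_integrable w"
    and lim: "((\<lambda>s. LINT x|lebesgue. ((v s x - v t x) / (s - t) - w x)\<^sup>2) \<longlongrightarrow> 0) (at t within {0..})"
  shows "((\<lambda>s. LINT x|lebesgue. v s x ^ (2 * m)) has_real_derivative
           real (2 * m) * (LINT x|lebesgue. v t x ^ (2 * m - 1) * w x)) (at t within {0..})"
proof -
  define n where "n = 2 * m"
  define y where "y s = (LINT x|lebesgue. v s x ^ n)" for s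
  define P where "P x = real n * v t x ^ (n - 1)" for x
  define L where "L = (LINT x|lebesgue. P x * w x)"
  define A where "A s = (LINT x|lebesgue. ((v s x - v t x) / (s - t) - w x)\<^sup>2)" for s
  define W where "W = (LINT x|lebesgue. (w x)\<^sup>2)"
  define Q where "Q = (LINT x|lebesgue. (P x)\<^sup>2)"
  have M0: "M \<ge> 0" using v(2)[OF t, of 0] by linarith
  obtain K where K: "K \<ge> 0" "\<And>a b. \<bar>a\<bar> \<le> M \<Longrightarrow> \<bar>b\<bar> \<le> M \<Longrightarrow>
       \<bar>b ^ n - a ^ n - real n * a ^ (n - 1) * (b - a)\<bar> \<le> K * (b - a)\<^sup>2"
    using power_taylor_bound[OF M0, of n] by blast
  have P: "sq_integrable P"
    unfolding P_def using m by (intro sq_integrable_cmult sq_integrable_power[OF v(1)[OF t] v(2)[OF t]]) (auto simp: n_def)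
  have vn: "integrable lebesgue (\<lambda>x. v s x ^ n)" if "s \<ge> 0" for s
    unfolding n_def using integrable_power_even[OF v(1)[OF that] v(2)[OF that] m] .
  have Q0: "0 \<le> Q" by (simp add: Q_def)
  have est: "\<bar>(y s - y t) / (s - t) - L\<bar> \<le> K * \<bar>s - t\<bar> * (2 * A s + 2 * W) + sqrt Q * sqrt (A s)"
    if s: "s \<ge> 0" "s \<noteq> t" for s
  proof -
    define D where "D x = v s x - v t x" for x
    define h where "h x = D x / (s - t) - w x" for x
    have st: "s - t \<noteq> 0" using s(2) by simp
    have D: "sq_integrable D" unfolding D_def by (intro sq_integrable_diff v s t)
    have Dq: "sq_integrable (\<lambda>x. D x / (s - t))"
      using sq_integrable_cmult[OF D, of "1 / (s - t)"] by simp
    have h: "sq_integrable h" unfolding h_def by (intro sq_integrable_diff Dq w)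
    have A_h: "A s = (LINT x|lebesgue. (h x)\<^sup>2)" by (simp add: A_def h_def D_def)
    have D_h: "D x = (s - t) * (h x + w x)" for x using st by (simp add: h_def)
    have "(LINT x|lebesgue. (D x)\<^sup>2) = (s - t)\<^sup>2 * (LINT x|lebesgue. (h x + w x)\<^sup>2)"
      by (simp add: D_h power_mult_distrib)
    also have "\<dots> \<le> (s - t)\<^sup>2 * (2 * A s + 2 * W)"
      unfolding A_h W_def by (intro mult_left_mono LINT_square_add_le h w) auto
    finally have D2: "(LINT x|lebesgue. (D x)\<^sup>2) \<le> (s - t)\<^sup>2 * (2 * A s + 2 * W)" .
    define R where "R x = v s x ^ n - v t x ^ n - P x * D x" for x
    have R: "integrable lebesgue R"
      unfolding R_def using vn[OF s(1)] vn[OF t] sq_integrable_mult[OF P D] by auto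
    have "y s - y t - (s - t) * L = (LINT x|lebesgue. R x + (s - t) * (P x * h x))"
    proof -
      have "R x + (s - t) * (P x * h x) = v s x ^ n - v t x ^ n - (s - t) * (P x * w x)" for x
        by (simp add: R_def D_h algebra_simps)
      then show ?thesis
        using vn[OF s(1)] vn[OF t] sq_integrable_mult[OF P w] by (simp add: y_def L_def)
    qed
    also have "\<dots> = (LINT x|lebesgue. R x) + (s - t) * (LINT x|lebesgue. P x * h x)"
      using R sq_integrable_mult[OF P h] by simp
    finally have eq: "y s - y t - (s - t) * L = (LINT x|lebesgue. R x) + (s - t) * (LINT x|lebesgue. P x * h x)" .
    have R_le: "\<bar>LINT x|lebesgue. R x\<bar> \<le> K * ((s - t)\<^sup>2 * (2 * A s + 2 * W))"
    proof -
      have "\<bar>LINT x|lebesgue. R x\<bar> \<le> (LINT x|lebesgue. \<bar>R x\<bar>)" by (rule integral_abs_bound)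
      also have "\<dots> \<le> (LINT x|lebesgue. K * (D x)\<^sup>2)"
      proof (rule integral_mono)
        show "integrable lebesgue (\<lambda>x. \<bar>R x\<bar>)" using R by (rule integrable_abs)
        show "\<bar>R x\<bar> \<le> K * (D x)\<^sup>2" for x
          using K(2)[OF v(2)[OF t] v(2)[OF s(1)]] by (simp add: R_def P_def D_def)
      qed (use sq_integrable_int[OF D] in simp)
      also have "\<dots> = K * (LINT x|lebesgue. (D x)\<^sup>2)" by simp
      also have "\<dots> \<le> K * ((s - t)\<^sup>2 * (2 * A s + 2 * W))" using D2 K(1) by (rule mult_left_mono)
      finally show ?thesis .
    qed
    have Ph: "\<bar>LINT x|lebesgue. P x * h x\<bar> \<le> sqrt Q * sqrt (A s)"
      using order_trans[OF integral_abs_bound Cauchy_Schwarz_LINT_abs[OF P h]] by (simp add: Q_def A_h)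
    have "(y s - y t) / (s - t) - L = (y s - y t - (s - t) * L) / (s - t)"
      using st by (simp add: field_simps)
    also have "\<dots> = (LINT x|lebesgue. R x) / (s - t) + (LINT x|lebesgue. P x * h x)"
      unfolding eq using st by (simp add: field_simps)
    also have "\<bar>\<dots>\<bar> \<le> \<bar>LINT x|lebesgue. R x\<bar> / \<bar>s - t\<bar> + \<bar>LINT x|lebesgue. P x * h x\<bar>"
      by (rule order_trans[OF abs_triangle_ineq]) simp
    also have "\<dots> \<le> K * ((s - t)\<^sup>2 * (2 * A s + 2 * W)) / \<bar>s - t\<bar> + sqrt Q * sqrt (A s)"
      using R_le Ph by (intro add_mono divide_right_mono) auto
    also have "K * ((s - t)\<^sup>2 * (2 * A s + 2 * W)) / \<bar>s - t\<bar> = K * \<bar>s - t\<bar> * (2 * A s + 2 * W)"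
    proof -
      define r where "r = \<bar>s - t\<bar>"
      have "(s - t)\<^sup>2 = r\<^sup>2" "r \<noteq> 0" using st by (simp_all add: r_def)
      then show ?thesis unfolding r_def[symmetric] by (simp add: power2_eq_square)
    qed
    finally show ?thesis .
  qed
  have Al: "(A \<longlongrightarrow> 0) (at t within {0..})" using lim by (simp add: A_def[abs_def])
  have "((\<lambda>s. K * \<bar>s - t\<bar> * (2 * A s + 2 * W) + sqrt Q * sqrt (A s)) \<longlongrightarrow>
      K * \<bar>t - t\<bar> * (2 * 0 + 2 * W) + sqrt Q * sqrt 0) (at t within {0..})"
    by (intro tendsto_intros Al)
  then have B: "((\<lambda>s. K * \<bar>s - t\<bar> * (2 * A s + 2 * W) + sqrt Q * sqrt (A s)) \<longlongrightarrow> 0) (at t within {0..})"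
    by simp
  have "((\<lambda>s. (y s - y t) / (s - t) - L) \<longlongrightarrow> 0) (at t within {0..})"
    by (rule Lim_null_comparison[OF _ B]) (use est in \<open>auto simp: eventually_at_filter\<close>)
  then have "((\<lambda>s. (y s - y t) / (s - t)) \<longlongrightarrow> L) (at t within {0..})"
    by (rule LIM_zero_cancel)
  then have "(y has_real_derivative L) (at t within {0..})"
    by (simp add: has_field_derivative_iff)
  moreover have "L = real n * (LINT x|lebesgue. v t x ^ (n - 1) * w x)"
    by (simp add: L_def P_def mult.assoc)
  ultimately show ?thesis by (simp add: y_def[abs_def] n_def)
qed

lemma within_atLeast_imp_at:
  "(y has_real_derivative D) (at t within {0..}) \<Longrightarrow> t > 0 \<Longrightarrow> (y has_real_derivative D) (at t)"
  by (metis at_within_interior greaterThan_iff interior_real_atLeast)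

lemma continuous_on_of_derivative_within:
  assumes "\<And>t. t \<ge> 0 \<Longrightarrow> \<exists>D. (y has_real_derivative D) (at t within {0..})"
  shows "continuous_on {0..} y"
  using assms by (auto simp: continuous_on_eq_continuous_within intro: DERIV_continuous)

lemma Lipschitz_of_continuous_deriv:
  fixes F :: "real \<Rightarrow> real"
  assumes "\<And>x. (F has_real_derivative F' x) (at x)" "continuous_on UNIV F'"
  obtains L where "L \<ge> 0" "\<And>a b. \<bar>a\<bar> \<le> M \<Longrightarrow> \<bar>b\<bar> \<le> M \<Longrightarrow> \<bar>F b - F a\<bar> \<le> L * \<bar>b - a\<bar>"
proof -
  have "bounded (F' ` {- M..M})"
    using assms(2) by (intro compact_imp_bounded compact_continuous_image)
      (auto intro: continuous_on_subset)
  then obtain L0 where L0: "\<forall>x\<in>{- M..M}. \<bar>F' x\<bar> \<le> L0" by (auto simp: bounded_iff)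
  define L where "L = max L0 0"
  have "\<bar>F b - F a\<bar> \<le> L * \<bar>b - a\<bar>" if "\<bar>a\<bar> \<le> M" "\<bar>b\<bar> \<le> M" for a b
  proof -
    have "norm (F b - F a) \<le> L * norm (b - a)"
    proof (rule field_differentiable_bound[of "{- M..M}" F F' L])
      show "(F has_field_derivative F' z) (at z within {- M..M})" for z
        using assms(1) by (rule has_field_derivative_at_within)
      show "norm (F' z) \<le> L" if "z \<in> {- M..M}" for z
        using bspec[OF L0 that] by (simp add: L_def)
    qed (use that in auto)
    then show ?thesis by simp
  qed
  moreover have "L \<ge> 0" by (simp add: L_def)
  ultimately show thesis using that by blast
qed

lemma strongly_monotone_of_positive_deriv:
  fixes F :: "real \<Rightarrow> real"
  assumes D: "\<And>x. (F has_real_derivative F' x) (at x)" and cont: "continuous_on UNIV F'"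
    and pos: "\<And>x. F' x > 0"
  obtains c where "c > 0" "\<And>a b. \<bar>a\<bar> \<le> M \<Longrightarrow> \<bar>b\<bar> \<le> M \<Longrightarrow> c * (b - a)\<^sup>2 \<le> (F b - F a) * (b - a)"
proof (cases "M < 0")
  case True
  then show thesis by (intro that[of 1]) auto
next
  case False
  then have "{- M..M} \<noteq> {}" by auto
  then obtain z where z: "\<forall>y\<in>{- M..M}. F' z \<le> F' y"
    using continuous_attains_inf[of "{- M..M}" F'] continuous_on_subset[OF cont] by auto
  have "F' z * (b - a)\<^sup>2 \<le> (F b - F a) * (b - a)" if "\<bar>a\<bar> \<le> M" "\<bar>b\<bar> \<le> M" "a < b" for a b
  proof -
    obtain x where x: "a < x" "x < b" "F b - F a = (b - a) * F' x"
      using MVT2[OF \<open>a < b\<close>, of F F'] D by blast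
    have "F' z * (b - a)\<^sup>2 \<le> F' x * (b - a)\<^sup>2"
    proof (rule mult_right_mono)
      have "x \<in> {- M..M}" using x that by auto
      then show "F' z \<le> F' x" using z by blast
    qed simp
    then show ?thesis by (simp add: x(3) power2_eq_square mult_ac)
  qed
  note * = this
  show thesis
  proof (rule that[OF pos[of z]])
    fix a b assume "\<bar>a\<bar> \<le> M" "\<bar>b\<bar> \<le> M"
    then show "F' z * (b - a)\<^sup>2 \<le> (F b - F a) * (b - a)"
      using *[of a b] *[of b a] by (cases a b rule: linorder_cases) (auto simp: power2_commute algebra_simps)
  qed
qed

section \<open>Energy identities\<close>

lemma strong_solutionD:
  assumes "strong_solution f \<sigma> ut v g w M" "t \<ge> 0"
  shows "H1_pair (v t) (g t)" "continuous_on UNIV (g t)" "\<bar>v t x\<bar> \<le> M" "\<bar>g t x\<bar> \<le> M"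
    "(LINT x|lebesgue. (g t x)\<^sup>2) \<le> M" "sq_integrable (w t)"
    "((\<lambda>s. LINT x|lebesgue. ((v s x - v t x) / (s - t) - w t x)\<^sup>2) \<longlongrightarrow> 0) (at t within {0..})"
    "sq_integrable (v t)" "sq_integrable (g t)" "primitive (v t) (g t)"
    "(v t has_real_derivative g t x) (at x)"
  using assms unfolding strong_solution_def by (auto dest: H1_pairD intro: primitive_DERIV)

lemma strong_solution_equation:
  assumes "strong_solution f \<sigma> ut v g w M" "t > 0"
  obtains G where "primitive G (\<lambda>x. - w t x)" "AE x in lebesgue. G x = f (ut + v t x) - \<sigma> (g t x)"
  using assms unfolding strong_solution_def by blast

text \<open>
  \<open>q(v) v'\<close> is the derivative of \<open>H(v)\<close>, where \<open>H' = q\<close>, and \<open>H(v)\<close> tends to \<open>H(0)\<close> at both ends.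
\<close>

lemma LINT_chain_rule_eq_0:
  assumes H1: "H1_pair v g" and g: "continuous_on UNIV g" and q: "continuous_on UNIV q"
    and int: "integrable lebesgue (\<lambda>x. q (v x) * g x)"
  shows "(LINT x|lebesgue. q (v x) * g x) = 0"
proof -
  obtain H where H: "\<And>x. (H has_real_derivative q x) (at x)"
    using continuous_antiderivative[OF q] by blast
  note v = H1_pairD(4)[OF H1]
  have "continuous_on UNIV (\<lambda>x. q (v x) * g x)"
    by (intro continuous_intros continuous_on_compose2[OF q v] g) auto
  moreover have "((\<lambda>x. H (v x)) has_real_derivative q (v x) * g x) (at x)" for x
    by (rule DERIV_chain2[OF H primitive_DERIV[OF H1_pairD(3)[OF H1] g]])
  ultimately have "primitive (\<lambda>x. H (v x)) (\<lambda>x. q (v x) * g x)" by (intro DERIV_primitive)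
  moreover have "isCont H 0" by (rule DERIV_isCont[OF H])
  then have "((\<lambda>x. H (v x)) \<longlongrightarrow> H 0) at_top" "((\<lambda>x. H (v x)) \<longlongrightarrow> H 0) at_bot"
    using H1_pair_tendsto_0[OF H1] by (auto intro: isCont_tendsto_compose)
  ultimately show ?thesis by (intro primitive_integral_eq_0[OF _ int])
qed

lemma H1_pair_power:
  assumes H1: "H1_pair v g" and g: "continuous_on UNIV g" and M: "\<And>x. \<bar>v x\<bar> \<le> M" and k: "k \<ge> 1"
  shows "H1_pair (\<lambda>x. v x ^ k) (\<lambda>x. real k * v x ^ (k - 1) * g x)"
  unfolding H1_pair_def
proof (intro conjI)
  note v = H1_pairD(4)[OF H1]
  show "sq_integrable (\<lambda>x. v x ^ k)" by (rule sq_integrable_power[OF H1_pairD(1)[OF H1] M k])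
  show "sq_integrable (\<lambda>x. real k * v x ^ (k - 1) * g x)"
  proof (rule sq_integrable_mult_bounded[OF H1_pairD(2)[OF H1]])
    show "AE x in lebesgue. \<bar>real k * v x ^ (k - 1)\<bar> \<le> real k * M ^ (k - 1)"
      using M by (auto simp: abs_mult power_abs intro!: mult_left_mono power_mono)
    show "(\<lambda>x. real k * v x ^ (k - 1)) \<in> borel_measurable lebesgue"
      by (intro continuous_measurable_lebesgue continuous_intros v)
  qed
  show "primitive (\<lambda>x. v x ^ k) (\<lambda>x. real k * v x ^ (k - 1) * g x)"
  proof (rule DERIV_primitive)
    show "((\<lambda>x. v x ^ k) has_real_derivative real k * v x ^ (k - 1) * g x) (at x)" for x
      using DERIV_power[OF primitive_DERIV[OF H1_pairD(3)[OF H1] g], of k x] by (simp add: mult_ac)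
    show "continuous_on UNIV (\<lambda>x. real k * v x ^ (k - 1) * g x)" by (intro continuous_intros v g)
  qed
qed

lemma sq_integrable_comp:
  assumes v: "sq_integrable v" and F: "continuous_on UNIV F" and vc: "continuous_on UNIV v"
    and L: "\<And>x. \<bar>F (v x) - F 0\<bar> \<le> L * \<bar>v x\<bar>"
  shows "sq_integrable (\<lambda>x. F (v x) - F 0)"
  by (rule sq_integrable_bound[OF v, of _ L])
     (use L in \<open>auto intro!: continuous_measurable_lebesgue continuous_intros continuous_on_compose2[OF F vc]\<close>)

locale viscous_conservation_law =
  fixes f \<sigma> f' \<sigma>' :: "real \<Rightarrow> real" and ut :: real
  assumes f': "\<And>x. (f has_real_derivative f' x) (at x)" "continuous_on UNIV f'"
    and \<sigma>': "\<And>x. (\<sigma> has_real_derivative \<sigma>' x) (at x)" "continuous_on UNIV \<sigma>'"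
    and pos: "\<And>x. \<sigma>' x > 0" and \<sigma>0: "\<sigma> 0 = 0"
begin

lemma flux_continuous: "continuous_on UNIV f" "continuous_on UNIV \<sigma>"
  by (rule DERIV_continuous_on[OF has_field_derivative_at_within], rule f'(1) \<sigma>'(1))+

lemma flux_shift_Lipschitz:
  obtains L where "L \<ge> 0"
    "\<And>a b. \<bar>a\<bar> \<le> M \<Longrightarrow> \<bar>b\<bar> \<le> M \<Longrightarrow> \<bar>f (ut + b) - f (ut + a)\<bar> \<le> L * \<bar>b - a\<bar>"
proof -
  obtain L where L: "L \<ge> 0"
    "\<And>a b. \<bar>a\<bar> \<le> \<bar>ut\<bar> + M \<Longrightarrow> \<bar>b\<bar> \<le> \<bar>ut\<bar> + M \<Longrightarrow> \<bar>f b - f a\<bar> \<le> L * \<bar>b - a\<bar>"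
    using Lipschitz_of_continuous_deriv[OF f'] by blast
  have "\<bar>f (ut + b) - f (ut + a)\<bar> \<le> L * \<bar>b - a\<bar>" if "\<bar>a\<bar> \<le> M" "\<bar>b\<bar> \<le> M" for a b
    using L(2)[of "ut + a" "ut + b"] that by (simp add: abs_triangle_ineq[THEN order_trans])
  then show thesis using L(1) that by blast
qed

lemma sq_integrable_flux:
  assumes sol: "strong_solution f \<sigma> ut v g w M" and t: "t \<ge> 0"
  shows "sq_integrable (\<lambda>x. f (ut + v t x) - f ut)" "sq_integrable (\<lambda>x. \<sigma> (g t x))"
proof -
  note S = strong_solutionD[OF sol t]
  have M0: "M \<ge> 0" using S(3)[of 0] by linarith
  obtain L where L: "\<And>a b. \<bar>a\<bar> \<le> M \<Longrightarrow> \<bar>b\<bar> \<le> M \<Longrightarrow> \<bar>f (ut + b) - f (ut + a)\<bar> \<le> L * \<bar>b - a\<bar>"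
    using flux_shift_Lipschitz by blast
  obtain L' where L': "\<And>a b. \<bar>a\<bar> \<le> M \<Longrightarrow> \<bar>b\<bar> \<le> M \<Longrightarrow> \<bar>\<sigma> b - \<sigma> a\<bar> \<le> L' * \<bar>b - a\<bar>"
    using Lipschitz_of_continuous_deriv[OF \<sigma>'] by blast
  have "sq_integrable (\<lambda>x. (\<lambda>z. f (ut + z)) (v t x) - (\<lambda>z. f (ut + z)) 0)"
    using L[of 0 "v t x" for x] M0 S(3)
    by (intro sq_integrable_comp[OF S(8) _ H1_pairD(4)[OF S(1)], of _ L])
       (auto intro!: continuous_on_compose2[OF flux_continuous(1)] continuous_intros)
  then show "sq_integrable (\<lambda>x. f (ut + v t x) - f ut)" by simp
  have "sq_integrable (\<lambda>x. \<sigma> (g t x) - \<sigma> 0)"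
    using L'[of 0 "g t x" for x] M0 S(4)
    by (intro sq_integrable_comp[OF S(9) flux_continuous(2) S(2), of L']) auto
  then show "sq_integrable (\<lambda>x. \<sigma> (g t x))" by (simp add: \<sigma>0)
qed

text \<open>
  The equation tested with \<open>v\<^sup>k\<close>.  After integration by parts the convective flux contributes
  \<open>\<integral> k v\<^sup>k\<^sup>-\<^sup>1 \<partial>\<^sub>xv (f(ut + v) - f(ut))\<close>, the integral of an exact derivative, so only the viscous term survives.
\<close>

lemma energy_identity:
  assumes sol: "strong_solution f \<sigma> ut v g w M" and t: "t > 0" and k: "k \<ge> 1"
  shows "(LINT x|lebesgue. v t x ^ k * w t x) = - (LINT x|lebesgue. real k * v t x ^ (k - 1) * g t x * \<sigma> (g t x))"
proof -
  have t0: "t \<ge> 0" using t by simp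
  note S = strong_solutionD[OF sol t0]
  obtain G where G: "primitive G (\<lambda>x. - w t x)" "AE x in lebesgue. G x = f (ut + v t x) - \<sigma> (g t x)"
    using strong_solution_equation[OF sol t] by blast
  define fl where "fl x = f (ut + v t x) - f ut" for x
  define sg where "sg x = \<sigma> (g t x)" for x
  define P where "P x = real k * v t x ^ (k - 1) * g t x" for x
  define G1 where "G1 x = G x - f ut" for x
  have fl: "sq_integrable fl" and sg: "sq_integrable sg"
    using sq_integrable_flux[OF sol t0] by (simp_all add: fl_def[abs_def] sg_def[abs_def])
  have H1: "H1_pair (\<lambda>x. v t x ^ k) P"
    unfolding P_def using H1_pair_power[OF S(1,2,3) k] .
  note P = H1_pairD(2)[OF H1]
  have G1p: "primitive G1 (\<lambda>x. - w t x)"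
    using G(1) by (auto simp: primitive_def G1_def)
  have ae: "AE x in lebesgue. fl x - sg x = G1 x"
    using G(2) by eventually_elim (simp add: fl_def sg_def G1_def)
  have G1m: "G1 \<in> borel_measurable lebesgue"
    by (intro continuous_measurable_lebesgue primitive_continuous[OF G1p])
  have "sq_integrable G1"
    by (rule sq_integrable_cong[OF sq_integrable_diff[OF fl sg] G1m ae])
  moreover have "sq_integrable (\<lambda>x. - w t x)" using sq_integrable_cmult[OF S(6), of "-1"] by simp
  ultimately have HG: "H1_pair G1 (\<lambda>x. - w t x)" using G1p by (simp add: H1_pair_def)
  have "(LINT x|lebesgue. v t x ^ k * - w t x) = - (LINT x|lebesgue. P x * G1 x)"
    by (rule H1_integration_by_parts[OF H1 HG])
  then have 1: "(LINT x|lebesgue. v t x ^ k * w t x) = (LINT x|lebesgue. P x * G1 x)" by simp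
  have "(LINT x|lebesgue. P x * G1 x) = (LINT x|lebesgue. P x * fl x - P x * sg x)"
  proof (rule integral_cong_AE)
    show "AE x in lebesgue. P x * G1 x = P x * fl x - P x * sg x"
      using ae by eventually_elim (metis right_diff_distrib)
  qed (use sq_integrable_meas[OF P] sq_integrable_meas[OF fl] sq_integrable_meas[OF sg] G1m in auto)
  also have "\<dots> = (LINT x|lebesgue. P x * fl x) - (LINT x|lebesgue. P x * sg x)"
    by (rule Bochner_Integration.integral_diff[OF sq_integrable_mult[OF P fl] sq_integrable_mult[OF P sg]])
  also have "(LINT x|lebesgue. P x * fl x) = 0"
  proof -
    define q where "q z = real k * z ^ (k - 1) * (f (ut + z) - f ut)" for z
    have qP: "q (v t x) * g t x = P x * fl x" for x by (simp add: q_def P_def fl_def)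
    have "continuous_on UNIV q"
      unfolding q_def by (intro continuous_intros continuous_on_compose2[OF flux_continuous(1)]) auto
    from LINT_chain_rule_eq_0[OF S(1,2) this] sq_integrable_mult[OF P fl]
    show ?thesis by (simp add: qP)
  qed
  finally show ?thesis using 1 by (simp add: P_def sg_def)
qed

text \<open>
  On the range of \<open>\<partial>\<^sub>xv\<close>, a bounded interval, the viscosity is uniformly positive:
  \<open>\<sigma>(z) z \<ge> c z\<^sup>2\<close>.  The constant \<open>c\<close> is the same for all exponents and times.
\<close>

lemma power_integral_derivative_le:
  assumes sol: "strong_solution f \<sigma> ut v g w M"
  obtains c where "c > 0" "\<And>m t. m \<ge> 1 \<Longrightarrow> t > 0 \<Longrightarrow>
     \<exists>D. ((\<lambda>s. LINT x|lebesgue. v s x ^ (2 * m)) has_real_derivative D) (at t) \<and>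
         D \<le> - (real (2 * m) * real (2 * m - 1) * c) * (LINT x|lebesgue. (v t x ^ (m - 1) * g t x)\<^sup>2)"
proof -
  obtain c where c: "c > 0" "\<And>a b. \<bar>a\<bar> \<le> M \<Longrightarrow> \<bar>b\<bar> \<le> M \<Longrightarrow> c * (b - a)\<^sup>2 \<le> (\<sigma> b - \<sigma> a) * (b - a)"
    using strongly_monotone_of_positive_deriv[OF \<sigma>' pos] by blast
  show thesis
  proof (rule that[OF c(1)])
    fix m :: nat and t :: real assume m: "m \<ge> 1" and t: "t > 0"
    have t0: "t \<ge> 0" using t by simp
    note S = strong_solutionD[OF sol t0]
    have M0: "M \<ge> 0" using S(3)[of 0] by linarith
    define I where "I = (LINT x|lebesgue. v t x ^ (2 * m - 1) * w t x)"
    have der: "((\<lambda>s. LINT x|lebesgue. v s x ^ (2 * m)) has_real_derivative real (2 * m) * I) (at t)"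
      unfolding I_def
      by (rule within_atLeast_imp_at[OF LINT_power_has_derivative[OF t0 m _ _ S(6,7)] t])
         (use strong_solutionD[OF sol] in auto)
    have e: "v t x ^ (2 * m - 1 - 1) = (v t x ^ (m - 1))\<^sup>2" for x
    proof -
      have "2 * m - 1 - 1 = (m - 1) * 2" by simp
      then show ?thesis by (simp only: power_mult)
    qed
    have vm: "sq_integrable (\<lambda>x. v t x ^ (m - 1) * g t x)"
    proof (rule sq_integrable_mult_bounded[OF S(9)])
      show "AE x in lebesgue. \<bar>v t x ^ (m - 1)\<bar> \<le> M ^ (m - 1)"
        using S(3) by (auto simp: power_abs intro!: power_mono)
    qed (use sq_integrable_meas[OF S(8)] in auto)
    have vs: "sq_integrable (\<lambda>x. v t x ^ (m - 1) * \<sigma> (g t x))"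
    proof (rule sq_integrable_mult_bounded[OF sq_integrable_flux(2)[OF sol t0]])
      show "AE x in lebesgue. \<bar>v t x ^ (m - 1)\<bar> \<le> M ^ (m - 1)"
        using S(3) by (auto simp: power_abs intro!: power_mono)
    qed (use sq_integrable_meas[OF S(8)] in auto)
    define J where "J x = (v t x ^ (m - 1) * g t x) * (v t x ^ (m - 1) * \<sigma> (g t x))" for x
    have J: "integrable lebesgue J" unfolding J_def by (rule sq_integrable_mult[OF vm vs])
    have "I = - (LINT x|lebesgue. real (2 * m - 1) * J x)"
      unfolding I_def using energy_identity[OF sol t, of "2 * m - 1"] m
      by (simp only: e J_def) (simp add: power2_eq_square mult_ac)
    also have "\<dots> = - (real (2 * m - 1) * (LINT x|lebesgue. J x))" by simp
    finally have I: "I = - (real (2 * m - 1) * (LINT x|lebesgue. J x))" .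
    have "c * (LINT x|lebesgue. (v t x ^ (m - 1) * g t x)\<^sup>2) = (LINT x|lebesgue. c * (v t x ^ (m - 1) * g t x)\<^sup>2)"
      by simp
    also have "\<dots> \<le> (LINT x|lebesgue. J x)"
    proof (rule integral_mono[OF _ J])
      fix x
      have "c * (g t x)\<^sup>2 \<le> \<sigma> (g t x) * g t x"
        using c(2)[of 0 "g t x"] M0 S(4)[of x] by (simp add: \<sigma>0)
      then have "(v t x ^ (m - 1))\<^sup>2 * (c * (g t x)\<^sup>2) \<le> (v t x ^ (m - 1))\<^sup>2 * (\<sigma> (g t x) * g t x)"
        by (rule mult_left_mono) simp
      then show "c * (v t x ^ (m - 1) * g t x)\<^sup>2 \<le> J x"
        by (simp add: J_def power2_eq_square mult_ac)
    qed (use sq_integrable_int[OF vm] in simp)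
    finally have "real (2 * m) * real (2 * m - 1) * (c * (LINT x|lebesgue. (v t x ^ (m - 1) * g t x)\<^sup>2))
       \<le> real (2 * m) * real (2 * m - 1) * (LINT x|lebesgue. J x)"
      by (rule mult_left_mono) simp
    then have "real (2 * m) * I \<le> - (real (2 * m) * real (2 * m - 1) * c) * (LINT x|lebesgue. (v t x ^ (m - 1) * g t x)\<^sup>2)"
      unfolding I by (simp only: mult_ac mult_minus_left mult_minus_right neg_le_iff_le)
    with der show "\<exists>D. ((\<lambda>s. LINT x|lebesgue. v s x ^ (2 * m)) has_real_derivative D) (at t) \<and>
         D \<le> - (real (2 * m) * real (2 * m - 1) * c) * (LINT x|lebesgue. (v t x ^ (m - 1) * g t x)\<^sup>2)"
      by blast
  qed
qed

end

section \<open>Uniqueness\<close>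

lemma gronwall_zero:
  fixes y :: "real \<Rightarrow> real"
  assumes cont: "continuous_on {0..} y"
    and der: "\<And>t. t > 0 \<Longrightarrow> \<exists>D. (y has_real_derivative D) (at t) \<and> D \<le> K * y t"
    and nn: "\<And>t. y t \<ge> 0" and y0: "y 0 = 0" and t: "t \<ge> 0"
  shows "y t = 0"
proof (cases "t = 0")
  case False
  then have t: "0 < t" using t by simp
  have "y t * exp (- K * t) \<le> y 0 * exp (- K * 0)"
  proof (rule DERIV_nonpos_imp_decreasing_open[OF less_imp_le[OF t]])
    fix s assume s: "0 < s" "s < t"
    obtain D where D: "(y has_real_derivative D) (at s)" "D \<le> K * y s" using der[OF s(1)] by blast
    have "((\<lambda>s. y s * exp (- K * s)) has_real_derivative (D - K * y s) * exp (- K * s)) (at s)"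
      using D(1) by (auto intro!: derivative_eq_intros simp: algebra_simps)
    moreover have "(D - K * y s) * exp (- K * s) \<le> 0"
      using D(2) by (intro mult_nonpos_nonneg) auto
    ultimately show "\<exists>z. ((\<lambda>s. y s * exp (- K * s)) has_real_derivative z) (at s) \<and> z \<le> 0" by blast
  next
    show "continuous_on {0..t} (\<lambda>s. y s * exp (- K * s))"
      by (intro continuous_intros continuous_on_subset[OF cont]) auto
  qed
  then have "y t * exp (- K * t) \<le> 0" using y0 by simp
  then have "y t \<le> 0" by (simp add: mult_le_0_iff)
  with nn[of t] show ?thesis by simp
qed (simp add: y0)

lemma strong_solution_mono:
  assumes "strong_solution f \<sigma> ut v g w M" "M \<le> M'"
  shows "strong_solution f \<sigma> ut v g w M'"
  using assms unfolding strong_solution_def by (meson order_trans)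

context viscous_conservation_law
begin

text \<open>
  The difference \<open>d\<close> of two solutions satisfies
  \<open>\<integral> d \<partial>\<^sub>td \<le> \<integral> (L |\<partial>\<^sub>xd| |d| - c |\<partial>\<^sub>xd|\<^sup>2) \<le> L\<^sup>2 / (4 c) \<integral> d\<^sup>2\<close>,
  because the flux is Lipschitz and the viscosity strongly monotone on the common range; Gronwall
  then propagates \<open>d = 0\<close>.
\<close>

lemma strong_solution_unique:
  assumes sol1: "strong_solution f \<sigma> ut v1 g1 w1 M" and sol2: "strong_solution f \<sigma> ut v2 g2 w2 M"
    and init: "AE x in lebesgue. v1 0 x = v2 0 x" and t: "t \<ge> 0"
  shows "v1 t x = v2 t x"
proof -
  define d where "d s x = v1 s x - v2 s x" for s x
  define y where "y s = (LINT x|lebesgue. d s x ^ (2 * 1))" for s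
  obtain c where c: "c > 0" "\<And>a b. \<bar>a\<bar> \<le> M \<Longrightarrow> \<bar>b\<bar> \<le> M \<Longrightarrow> c * (b - a)\<^sup>2 \<le> (\<sigma> b - \<sigma> a) * (b - a)"
    using strongly_monotone_of_positive_deriv[OF \<sigma>' pos] by blast
  obtain L where L: "L \<ge> 0"
    "\<And>a b. \<bar>a\<bar> \<le> M \<Longrightarrow> \<bar>b\<bar> \<le> M \<Longrightarrow> \<bar>f (ut + b) - f (ut + a)\<bar> \<le> L * \<bar>b - a\<bar>"
    using flux_shift_Lipschitz by blast
  have ds: "sq_integrable (d s)" "\<bar>d s x\<bar> \<le> 2 * M" if "s \<ge> 0" for s x
    using strong_solutionD(3)[OF sol1 that, of x] strong_solutionD(3)[OF sol2 that, of x]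
      sq_integrable_diff[OF strong_solutionD(8)[OF sol1 that] strong_solutionD(8)[OF sol2 that]]
    by (auto simp: d_def[abs_def])
  have der: "(y has_real_derivative real (2 * 1) * (LINT x|lebesgue. d s x ^ (2 * 1 - 1) * (w1 s x - w2 s x)))
      (at s within {0..})" if s: "s \<ge> 0" for s
    unfolding y_def
  proof (rule LINT_power_has_derivative[OF s _ ds])
    note S1 = strong_solutionD[OF sol1 s] and S2 = strong_solutionD[OF sol2 s]
    show "sq_integrable (\<lambda>x. w1 s x - w2 s x)" by (rule sq_integrable_diff[OF S1(6) S2(6)])
    define a where "a v w r x = (v r x - v s x) / (r - s) - w s x" for v w :: "real \<Rightarrow> real \<Rightarrow> real" and r x
    have a1: "sq_integrable (a v1 w1 r)" if "r \<ge> 0" for r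
      using sq_integrable_diff[OF sq_integrable_cmult[OF sq_integrable_diff[OF strong_solutionD(8)[OF sol1 that] S1(8)], of "1 / (r - s)"] S1(6)]
      by (simp add: a_def[abs_def])
    have a2: "sq_integrable (a v2 w2 r)" if "r \<ge> 0" for r
      using sq_integrable_diff[OF sq_integrable_cmult[OF sq_integrable_diff[OF strong_solutionD(8)[OF sol2 that] S2(8)], of "1 / (r - s)"] S2(6)]
      by (simp add: a_def[abs_def])
    have le: "(LINT x|lebesgue. ((d r x - d s x) / (r - s) - (w1 s x - w2 s x))\<^sup>2)
       \<le> 2 * (LINT x|lebesgue. (a v1 w1 r x)\<^sup>2) + 2 * (LINT x|lebesgue. (a v2 w2 r x)\<^sup>2)" if r: "r \<ge> 0" for r
    proof -
      have "(d r x - d s x) / (r - s) - (w1 s x - w2 s x) = a v1 w1 r x + (- 1) * a v2 w2 r x" for x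
        by (simp add: a_def d_def diff_divide_distrib)
      then have "(LINT x|lebesgue. ((d r x - d s x) / (r - s) - (w1 s x - w2 s x))\<^sup>2)
          = (LINT x|lebesgue. (a v1 w1 r x + (- 1) * a v2 w2 r x)\<^sup>2)" by simp
      also have "\<dots> \<le> 2 * (LINT x|lebesgue. (a v1 w1 r x)\<^sup>2) + 2 * (LINT x|lebesgue. ((- 1) * a v2 w2 r x)\<^sup>2)"
        by (rule LINT_square_add_le[OF a1[OF r] sq_integrable_cmult[OF a2[OF r]]])
      finally show ?thesis by simp
    qed
    have "((\<lambda>r. 2 * (LINT x|lebesgue. (a v1 w1 r x)\<^sup>2) + 2 * (LINT x|lebesgue. (a v2 w2 r x)\<^sup>2)) \<longlongrightarrow> 2 * 0 + 2 * 0)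
        (at s within {0..})"
      unfolding a_def by (intro tendsto_intros S1(7) S2(7))
    then have lim: "((\<lambda>r. 2 * (LINT x|lebesgue. (a v1 w1 r x)\<^sup>2) + 2 * (LINT x|lebesgue. (a v2 w2 r x)\<^sup>2)) \<longlongrightarrow> 0)
        (at s within {0..})" by simp
    show "((\<lambda>r. LINT x|lebesgue. ((d r x - d s x) / (r - s) - (w1 s x - w2 s x))\<^sup>2) \<longlongrightarrow> 0) (at s within {0..})"
      by (rule Lim_null_comparison[OF _ lim]) (use le in \<open>auto simp: eventually_at_filter\<close>)
  qed simp_all
  have "y t = 0"
  proof (rule gronwall_zero[OF _ _ _ _ t])
    show "continuous_on {0..} y" using der by (blast intro: continuous_on_of_derivative_within)
    show "y s \<ge> 0" for s by (simp add: y_def)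
    have "AE x in lebesgue. d 0 x ^ (2 * 1) = 0" using init by eventually_elim (simp add: d_def)
    then show "y 0 = 0" unfolding y_def by (rule integral_eq_zero_AE)
    fix s :: real assume s: "s > 0"
    then have s0: "s \<ge> 0" by simp
    note S1 = strong_solutionD[OF sol1 s0] and S2 = strong_solutionD[OF sol2 s0]
    obtain G1 where G1: "primitive G1 (\<lambda>x. - w1 s x)" "AE x in lebesgue. G1 x = f (ut + v1 s x) - \<sigma> (g1 s x)"
      using strong_solution_equation[OF sol1 s] by blast
    obtain G2 where G2: "primitive G2 (\<lambda>x. - w2 s x)" "AE x in lebesgue. G2 x = f (ut + v2 s x) - \<sigma> (g2 s x)"
      using strong_solution_equation[OF sol2 s] by blast
    define G where "G x = G1 x - G2 x" for x
    define gd where "gd x = g1 s x - g2 s x" for x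
    define E where "E x = (f (ut + v1 s x) - f (ut + v2 s x)) - (\<sigma> (g1 s x) - \<sigma> (g2 s x))" for x
    have Gp: "primitive G (\<lambda>x. - (w1 s x - w2 s x))"
      using primitive_diff[OF G1(1) G2(1)] by (simp add: G_def[abs_def])
    have "sq_integrable (\<lambda>x. ((f (ut + v1 s x) - f ut) - (f (ut + v2 s x) - f ut)) - (\<sigma> (g1 s x) - \<sigma> (g2 s x)))"
      by (intro sq_integrable_diff sq_integrable_flux[OF sol1 s0] sq_integrable_flux[OF sol2 s0])
    then have E: "sq_integrable E" by (simp add: E_def[abs_def])
    have ae: "AE x in lebesgue. E x = G x"
      using G1(2) G2(2) by eventually_elim (simp add: E_def G_def)
    have Gm: "G \<in> borel_measurable lebesgue"
      by (intro continuous_measurable_lebesgue primitive_continuous[OF Gp])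
    have "sq_integrable (\<lambda>x. - (w1 s x - w2 s x))"
      using sq_integrable_cmult[OF sq_integrable_diff[OF S1(6) S2(6)], of "-1"] by simp
    then have HG: "H1_pair G (\<lambda>x. - (w1 s x - w2 s x))"
      using Gp sq_integrable_cong[OF E Gm ae] by (simp add: H1_pair_def)
    have Hd: "H1_pair (d s) gd"
      using H1_pair_diff[OF S1(1) S2(1)] by (simp add: d_def[abs_def] gd_def[abs_def])
    have "(LINT x|lebesgue. d s x * - (w1 s x - w2 s x)) = - (LINT x|lebesgue. gd x * G x)"
      by (rule H1_integration_by_parts[OF Hd HG])
    then have "(LINT x|lebesgue. d s x * (w1 s x - w2 s x)) = (LINT x|lebesgue. gd x * G x)"
      by (simp only: mult_minus_right integral_minus neg_equal_iff_equal)
    also have "\<dots> = (LINT x|lebesgue. gd x * E x)"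
    proof (rule integral_cong_AE)
      show "AE x in lebesgue. gd x * G x = gd x * E x" using ae by eventually_elim simp
    qed (use Gm sq_integrable_meas[OF E] sq_integrable_meas[OF H1_pairD(2)[OF Hd]] in auto)
    also have "\<dots> \<le> (LINT x|lebesgue. L\<^sup>2 / (4 * c) * (d s x)\<^sup>2)"
    proof (rule integral_mono[OF sq_integrable_mult[OF H1_pairD(2)[OF Hd] E]])
      fix x
      have "gd x * (f (ut + v1 s x) - f (ut + v2 s x)) \<le> \<bar>gd x\<bar> * (L * \<bar>d s x\<bar>)"
      proof -
        have "\<bar>f (ut + v1 s x) - f (ut + v2 s x)\<bar> \<le> L * \<bar>d s x\<bar>"
          unfolding d_def by (rule L(2)[OF S2(3) S1(3)])
        from mult_left_mono[OF this abs_ge_zero[of "gd x"]]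
        show ?thesis by (metis abs_ge_self abs_mult order_trans)
      qed
      moreover have "c * (gd x)\<^sup>2 \<le> gd x * (\<sigma> (g1 s x) - \<sigma> (g2 s x))"
        using c(2)[OF S2(4) S1(4), of x x] by (simp add: gd_def mult.commute)
      ultimately have "gd x * E x \<le> \<bar>gd x\<bar> * (L * \<bar>d s x\<bar>) - c * \<bar>gd x\<bar>\<^sup>2"
        by (simp add: E_def right_diff_distrib)
      also have "\<dots> \<le> L\<^sup>2 / (4 * c) * \<bar>d s x\<bar>\<^sup>2"
      proof -
        have "0 \<le> (2 * c * \<bar>gd x\<bar> - L * \<bar>d s x\<bar>)\<^sup>2 / (4 * c)" using c(1) by simp
        also have "\<dots> = c * \<bar>gd x\<bar>\<^sup>2 - \<bar>gd x\<bar> * (L * \<bar>d s x\<bar>) + L\<^sup>2 / (4 * c) * \<bar>d s x\<bar>\<^sup>2"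
          using c(1) by (simp add: power2_eq_square field_simps)
        finally show ?thesis by simp
      qed
      finally show "gd x * E x \<le> L\<^sup>2 / (4 * c) * (d s x)\<^sup>2" by simp
    qed (use sq_integrable_int[OF ds(1)[OF s0]] in simp)
    also have "\<dots> = L\<^sup>2 / (4 * c) * y s" by (simp add: y_def)
    finally have le: "(LINT x|lebesgue. d s x * (w1 s x - w2 s x)) \<le> L\<^sup>2 / (4 * c) * y s" .
    show "\<exists>D. (y has_real_derivative D) (at s) \<and> D \<le> (2 * (L\<^sup>2 / (4 * c))) * y s"
    proof (intro exI conjI)
      show "(y has_real_derivative real (2 * 1) * (LINT x|lebesgue. d s x ^ (2 * 1 - 1) * (w1 s x - w2 s x))) (at s)"
        by (rule within_atLeast_imp_at[OF der[OF s0] s])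
    qed (use le in simp)
  qed
  then have y: "(LINT x|lebesgue. (d t x)\<^sup>2) = 0" by (simp add: y_def)
  have "AE x in lebesgue. (d t x)\<^sup>2 = 0"
    using integral_nonneg_eq_0_iff_AE[OF sq_integrable_int[OF ds(1)[OF t]]] y by simp
  then have "AE x in lebesgue. v1 t x = v2 t x"
    by eventually_elim (simp add: d_def)
  then show ?thesis
    by (intro continuous_AE_eq H1_pairD(4)[OF strong_solutionD(1)[OF sol1 t]]
        H1_pairD(4)[OF strong_solutionD(1)[OF sol2 t]])
qed

end

section \<open>Decay\<close>

text \<open>
  Write \<open>y = \<integral>v\<^sup>2\<^sup>m\<close> and \<open>D = \<integral>v\<^sup>2\<^sup>m\<^sup>-\<^sup>2 g\<^sup>2\<close>.  The derivative of \<open>v\<^sup>2\<^sup>m\<close> is \<open>2 m v\<^sup>m (v\<^sup>m\<^sup>-\<^sup>1 g)\<close>, so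
  \<open>v\<^sup>2\<^sup>m \<le> B\<close> pointwise with \<open>B = 2 m (y D)\<^sup>1\<^sup>/\<^sup>2\<close>.  Taking out all but two of the factors \<open>v\<close> gives
  \<open>y \<le> B\<^sup>(\<^sup>m\<^sup>-\<^sup>1\<^sup>)\<^sup>/\<^sup>m E\<close>, and solving for \<open>D\<close> bounds the dissipation from below by a superlinear power of \<open>y\<close>.
\<close>

lemma Nash_type_inequality:
  assumes H1: "H1_pair v g" and g: "continuous_on UNIV g" and M: "\<And>x. \<bar>v x\<bar> \<le> M" and m: "m \<ge> 2"
    and E: "(LINT x|lebesgue. (v x)\<^sup>2) \<le> E"
  shows "(LINT x|lebesgue. v x ^ (2 * m)) ^ (m + 1)
      \<le> (2 * real m) ^ (2 * (m - 1)) * E ^ (2 * m) * (LINT x|lebesgue. (v x ^ (m - 1) * g x)\<^sup>2) ^ (m - 1)"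
proof -
  define y where "y = (LINT x|lebesgue. v x ^ (2 * m))"
  define D where "D = (LINT x|lebesgue. (v x ^ (m - 1) * g x)\<^sup>2)"
  define B where "B = 2 * real m * (sqrt y * sqrt D)"
  define b where "b = root m B"
  note v = H1_pairD(1)[OF H1] and sg = H1_pairD(2)[OF H1]
  have m0: "m > 0" and m1: "m \<ge> 1" using m by auto
  have y0: "y \<ge> 0" and D0: "D \<ge> 0" by (simp_all add: y_def D_def)
  have B0: "B \<ge> 0" using y0 D0 by (simp add: B_def)
  have E0: "E \<ge> 0" using E by (rule order_trans[rotated]) simp
  have b: "b \<ge> 0" "b ^ m = B" using B0 m0 by (simp_all add: b_def)
  have vm: "sq_integrable (\<lambda>x. v x ^ m)" by (rule sq_integrable_power[OF v M m1])
  have vg: "sq_integrable (\<lambda>x. v x ^ (m - 1) * g x)"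
  proof (rule sq_integrable_mult_bounded[OF sg])
    show "AE x in lebesgue. \<bar>v x ^ (m - 1)\<bar> \<le> M ^ (m - 1)"
      using M by (auto simp: power_abs intro!: power_mono)
  qed (use sq_integrable_meas[OF v] in auto)
  have H2: "H1_pair (\<lambda>x. v x ^ (2 * m)) (\<lambda>x. real (2 * m) * v x ^ (2 * m - 1) * g x)"
    using H1_pair_power[OF H1 g M, of "2 * m"] m by simp
  have e: "real (2 * m) * v x ^ (2 * m - 1) * g x = real (2 * m) * (v x ^ m * (v x ^ (m - 1) * g x))" for x
  proof -
    have "2 * m - 1 = m + (m - 1)" using m by simp
    then show ?thesis by (simp only: power_add mult.assoc)
  qed
  have sup: "v x ^ (2 * m) \<le> B" for x
  proof -
    have i: "integrable lebesgue (\<lambda>x. real (2 * m) * v x ^ (2 * m - 1) * g x)"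
      unfolding e using sq_integrable_mult[OF vm vg] by simp
    have "v x ^ (2 * m) \<le> \<bar>v x ^ (2 * m)\<bar>" by simp
    also have "\<dots> \<le> (LINT x|lebesgue. \<bar>real (2 * m) * v x ^ (2 * m - 1) * g x\<bar>)"
      by (rule primitive_abs_le_integral[OF H1_pairD(3)[OF H2] i H1_pair_tendsto_0(2)[OF H2]])
    also have "\<dots> = real (2 * m) * (LINT x|lebesgue. \<bar>v x ^ m * (v x ^ (m - 1) * g x)\<bar>)"
      unfolding e abs_mult[of "real (2 * m)"] by simp
    also have "\<dots> \<le> real (2 * m) * (sqrt (LINT x|lebesgue. (v x ^ m)\<^sup>2) * sqrt D)"
      unfolding D_def by (intro mult_left_mono Cauchy_Schwarz_LINT_abs[OF vm vg]) simp
    also have "(LINT x|lebesgue. (v x ^ m)\<^sup>2) = y" by (simp add: y_def power_mult[symmetric] mult.commute)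
    finally show ?thesis by (simp add: B_def mult.assoc)
  qed
  have v2: "(v x)\<^sup>2 \<le> b" for x
  proof (rule power_le_imp_le_base[of _ "m - 1"])
    show "(v x)\<^sup>2 ^ Suc (m - 1) \<le> b ^ Suc (m - 1)"
      using sup[of x] b(2) m0 by (simp add: power_mult)
  qed (rule b)
  have "y \<le> (LINT x|lebesgue. b ^ (m - 1) * (v x)\<^sup>2)"
    unfolding y_def
  proof (rule integral_mono)
    fix x
    have "v x ^ (2 * m) = (v x)\<^sup>2 ^ (m - 1) * (v x)\<^sup>2"
    proof -
      have "m = Suc (m - 1)" using m by simp
      then show ?thesis by (metis power_Suc2 power_mult)
    qed
    also have "\<dots> \<le> b ^ (m - 1) * (v x)\<^sup>2" using v2 by (intro mult_right_mono power_mono) auto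
    finally show "v x ^ (2 * m) \<le> b ^ (m - 1) * (v x)\<^sup>2" .
  qed (use integrable_power_even[OF v M m1] sq_integrable_int[OF v] in auto)
  also have "\<dots> = b ^ (m - 1) * (LINT x|lebesgue. (v x)\<^sup>2)" by simp
  also have "\<dots> \<le> b ^ (m - 1) * E" using E b(1) by (intro mult_left_mono) auto
  finally have "y ^ (2 * m) \<le> (b ^ (m - 1) * E) ^ (2 * m)" using y0 by (rule power_mono)
  also have "\<dots> = (b ^ m) ^ (2 * (m - 1)) * E ^ (2 * m)"
    by (simp add: power_mult_distrib power_mult[symmetric] mult_ac)
  also have "(b ^ m) ^ (2 * (m - 1)) = (2 * real m) ^ (2 * (m - 1)) * (y * D) ^ (m - 1)"
  proof -
    have "B ^ 2 = (2 * real m) ^ 2 * (y * D)" using y0 D0 by (simp add: B_def power_mult_distrib)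
    then show ?thesis unfolding b(2) power_mult by (simp add: power_mult_distrib)
  qed
  finally have le: "y ^ (2 * m) \<le> (2 * real m) ^ (2 * (m - 1)) * (y * D) ^ (m - 1) * E ^ (2 * m)" .
  show ?thesis
  proof (cases "y = 0")
    case True
    then show ?thesis using E0 D0 by (simp add: y_def[symmetric] D_def[symmetric])
  next
    case False
    then have "y > 0" using y0 by simp
    have "y ^ (m - 1) * y ^ (m + 1) = y ^ (2 * m)"
    proof -
      have "(m - 1) + (m + 1) = 2 * m" using m by simp
      then show ?thesis by (metis power_add)
    qed
    with le have "y ^ (m - 1) * y ^ (m + 1) \<le> y ^ (m - 1) * ((2 * real m) ^ (2 * (m - 1)) * E ^ (2 * m) * D ^ (m - 1))"
      by (simp add: power_mult_distrib mult_ac)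
    then have "y ^ (m + 1) \<le> (2 * real m) ^ (2 * (m - 1)) * E ^ (2 * m) * D ^ (m - 1)"
      using \<open>y > 0\<close> by (simp add: mult_le_cancel_left_pos del: power_Suc)
    then show ?thesis by (simp add: y_def D_def)
  qed
qed

text \<open>
  While \<open>y\<close> is positive, \<open>y\<^sup>-\<^sup>p\<close> grows at least at the constant rate \<open>p \<kappa>\<close>.
\<close>

lemma decay_of_superlinear_dissipation:
  fixes y :: "real \<Rightarrow> real"
  assumes cont: "continuous_on {0..} y" and nn: "\<And>t. y t \<ge> 0"
    and der: "\<And>t. t > 0 \<Longrightarrow> \<exists>D. (y has_real_derivative D) (at t) \<and> D \<le> 0 \<and>
                (y t > 0 \<longrightarrow> D \<le> - \<kappa> * y t powr (1 + p))"
    and \<kappa>: "\<kappa> > 0" and p: "p > 0"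
  obtains C where "C > 0" "\<And>t. t \<ge> 0 \<Longrightarrow> y t \<le> C * (1 + t) powr (- (1 / p))"
proof -
  have dec: "y t \<le> y s" if "0 \<le> s" "s \<le> t" for s t
  proof (rule DERIV_nonpos_imp_decreasing_open[OF that(2)])
    fix r assume "s < r" "r < t"
    then show "\<exists>z. (y has_real_derivative z) (at r) \<and> z \<le> 0" using der[of r] that by force
  next
    show "continuous_on {s..t} y" by (rule continuous_on_subset[OF cont]) (use that in auto)
  qed
  show thesis
  proof (cases "y 0 = 0")
    case True
    show thesis
      by (rule that[of 1]) (use dec[of 0] True nn in \<open>auto intro: order_trans[OF dec[of 0]]\<close>)
  next
    case False
    then have y0: "y 0 > 0" using nn[of 0] by simp
    \<comment> \<open>Both the initial value and the growth rate of \<open>y\<^sup>-\<^sup>p\<close> dominate \<open>\<delta>\<close>, so \<open>y\<^sup>-\<^sup>p \<ge> \<delta> (1 + t)\<close>.\<close>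
    define \<delta> where "\<delta> = min (y 0 powr (- p)) (p * \<kappa>)"
    have \<delta>: "\<delta> > 0" using y0 p \<kappa> by (simp add: \<delta>_def)
    show thesis
    proof (rule that[of "\<delta> powr (- (1 / p))"])
      fix t :: real assume t: "t \<ge> 0"
      show "y t \<le> \<delta> powr (- (1 / p)) * (1 + t) powr (- (1 / p))"
      proof (cases "y t = 0")
        case False
        then have yt: "y t > 0" using nn[of t] by simp
        then have ypos: "y s > 0" if "0 \<le> s" "s \<le> t" for s using dec[OF that] by simp
        define z where "z s = y s powr (- p) - p * \<kappa> * s" for s
        have "z 0 \<le> z t"
        proof (rule DERIV_nonneg_imp_increasing_open[OF t])
          fix s assume s: "0 < s" "s < t"
          obtain D where D: "(y has_real_derivative D) (at s)" "y s > 0 \<longrightarrow> D \<le> - \<kappa> * y s powr (1 + p)"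
            using der[OF s(1)] by blast
          have ys: "y s > 0" using ypos s by simp
          have "(z has_real_derivative (- p) * y s powr (- p - 1) * D - p * \<kappa>) (at s)"
            unfolding z_def using D(1) ys by (auto intro!: derivative_eq_intros DERIV_fun_powr)
          moreover have "0 \<le> (- p) * y s powr (- p - 1) * D - p * \<kappa>"
          proof -
            have "(p * y s powr (- p - 1)) * D \<le> (p * y s powr (- p - 1)) * (- \<kappa> * y s powr (1 + p))"
              using D(2) ys p by (intro mult_left_mono) auto
            also have "\<dots> = - (p * \<kappa>) * (y s powr (- p - 1) * y s powr (1 + p))" by simp
            also have "y s powr (- p - 1) * y s powr (1 + p) = 1"
              using ys by (simp flip: powr_add)
            finally show ?thesis by simp
          qed
          ultimately show "\<exists>D. (z has_real_derivative D) (at s) \<and> 0 \<le> D" by blast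
        next
          have "continuous_on {0..t} y" by (rule continuous_on_subset[OF cont]) auto
          then show "continuous_on {0..t} z"
            unfolding z_def using ypos by (intro continuous_intros) (auto simp: less_imp_neq[THEN not_sym])
        qed
        then have "y 0 powr (- p) + p * \<kappa> * t \<le> y t powr (- p)" by (simp add: z_def)
        moreover have "\<delta> * (1 + t) \<le> y 0 powr (- p) + p * \<kappa> * t"
          using t by (auto simp: \<delta>_def distrib_left intro!: add_mono mult_right_mono)
        ultimately have le: "\<delta> * (1 + t) \<le> y t powr (- p)" by linarith
        have "y t = (y t powr (- p)) powr (- (1 / p))"
          using yt p by (simp add: powr_powr)
        also have "\<dots> \<le> (\<delta> * (1 + t)) powr (- (1 / p))"
          using le \<delta> t p by (intro powr_mono2') auto
        also have "\<dots> = \<delta> powr (- (1 / p)) * (1 + t) powr (- (1 / p))"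
          using \<delta> t by (simp add: powr_mult)
        finally show ?thesis .
      qed simp
    qed (use \<delta> in simp)
  qed
qed

context viscous_conservation_law
begin

lemma power_integral_continuous:
  assumes sol: "strong_solution f \<sigma> ut v g w M" and m: "m \<ge> 1"
  shows "continuous_on {0..} (\<lambda>t. LINT x|lebesgue. v t x ^ (2 * m))"
proof (rule continuous_on_of_derivative_within)
  fix t :: real assume t: "t \<ge> 0"
  show "\<exists>D. ((\<lambda>t. LINT x|lebesgue. v t x ^ (2 * m)) has_real_derivative D) (at t within {0..})"
    by (rule exI, rule LINT_power_has_derivative[OF t m _ _ strong_solutionD(6,7)[OF sol t]])
       (use strong_solutionD[OF sol] in auto)
qed

lemma energy_nonincreasing:
  assumes sol: "strong_solution f \<sigma> ut v g w M" and t: "t \<ge> 0"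
  shows "(LINT x|lebesgue. (v t x)\<^sup>2) \<le> (LINT x|lebesgue. (v 0 x)\<^sup>2)"
proof -
  obtain c where c: "c > 0" "\<And>m t. m \<ge> 1 \<Longrightarrow> t > 0 \<Longrightarrow>
     \<exists>D. ((\<lambda>s. LINT x|lebesgue. v s x ^ (2 * m)) has_real_derivative D) (at t) \<and>
         D \<le> - (real (2 * m) * real (2 * m - 1) * c) * (LINT x|lebesgue. (v t x ^ (m - 1) * g t x)\<^sup>2)"
    using power_integral_derivative_le[OF sol] by blast
  have "(LINT x|lebesgue. v t x ^ (2 * 1)) \<le> (LINT x|lebesgue. v 0 x ^ (2 * 1))"
  proof (rule DERIV_nonpos_imp_decreasing_open[OF t])
    fix s assume s: "0 < s" "s < t"
    obtain D where D: "((\<lambda>s. LINT x|lebesgue. v s x ^ (2 * 1)) has_real_derivative D) (at s)"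
         "D \<le> - (real (2 * 1) * real (2 * 1 - 1) * c) * (LINT x|lebesgue. (v s x ^ (1 - 1) * g s x)\<^sup>2)"
      using c(2)[of 1 s] s by auto
    have "0 \<le> (real (2 * 1) * real (2 * 1 - 1) * c) * (LINT x|lebesgue. (v s x ^ (1 - 1) * g s x)\<^sup>2)"
      using c(1) by (intro mult_nonneg_nonneg) auto
    with D show "\<exists>y. ((\<lambda>s. LINT x|lebesgue. v s x ^ (2 * 1)) has_real_derivative y) (at s) \<and> y \<le> 0"
      by (intro exI[of _ D] conjI) auto
  next
    show "continuous_on {0..t} (\<lambda>s. LINT x|lebesgue. v s x ^ (2 * 1))"
      by (rule continuous_on_subset[OF power_integral_continuous[OF sol]]) auto
  qed
  then show ?thesis by simp
qed

text \<open>
  The Nash type inequality turns the energy inequality into \<open>y' \<le> - \<kappa> y\<^sup>1\<^sup>+\<^sup>p\<close> with \<open>p = 2 / (m - 1)\<close>.  For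
  \<open>m = 1\<close> there is nothing to gain and the assertion is the energy bound.
\<close>

lemma power_integral_decay:
  assumes sol: "strong_solution f \<sigma> ut v g w M" and m: "m \<ge> 1"
  obtains C where "C > 0"
    "\<And>t. t \<ge> 0 \<Longrightarrow> (LINT x|lebesgue. v t x ^ (2 * m)) \<le> C * (1 + t) powr (- (real (m - 1) / 2))"
proof (cases "m = 1")
  case True
  define C where "C = (LINT x|lebesgue. (v 0 x)\<^sup>2) + 1"
  have "0 \<le> (LINT x|lebesgue. (v 0 x)\<^sup>2)" by simp
  then have "C > 0" unfolding C_def by linarith
  moreover have "(LINT x|lebesgue. v t x ^ (2 * m)) \<le> C * (1 + t) powr (- (real (m - 1) / 2))" if "t \<ge> 0" for t
    using energy_nonincreasing[OF sol that] that by (simp add: True C_def)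
  ultimately show thesis by (rule that)
next
  case False
  then have m2: "m \<ge> 2" using m by simp
  define E where "E = (LINT x|lebesgue. (v 0 x)\<^sup>2) + 1"
  have E0: "E > 0" "E \<ge> (LINT x|lebesgue. (v 0 x)\<^sup>2)"
  proof -
    have "0 \<le> (LINT x|lebesgue. (v 0 x)\<^sup>2)" by simp
    then show "E > 0" unfolding E_def by linarith
  qed (simp add: E_def)
  obtain c where c: "c > 0" "\<And>m t. m \<ge> 1 \<Longrightarrow> t > 0 \<Longrightarrow>
     \<exists>D. ((\<lambda>s. LINT x|lebesgue. v s x ^ (2 * m)) has_real_derivative D) (at t) \<and>
         D \<le> - (real (2 * m) * real (2 * m - 1) * c) * (LINT x|lebesgue. (v t x ^ (m - 1) * g t x)\<^sup>2)"
    using power_integral_derivative_le[OF sol] by blast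
  define y where "y t = (LINT x|lebesgue. v t x ^ (2 * m))" for t
  define r where "r = real (m - 1)"
  define Q where "Q = (2 * real m) ^ (2 * (m - 1)) * E ^ (2 * m)"
  define a where "a = real (2 * m) * real (2 * m - 1) * c"
  define \<kappa> where "\<kappa> = a * Q powr (- (1 / r))"
  have r0: "r > 0" using m2 by (simp add: r_def)
  have Q0: "Q > 0" using E0(1) m2 by (simp add: Q_def)
  have a0: "a > 0" using c(1) m2 by (simp add: a_def)
  have \<kappa>0: "\<kappa> > 0" using a0 Q0 by (simp add: \<kappa>_def)
  have y0: "y t \<ge> 0" for t by (simp add: y_def)
  have der: "\<exists>D. (y has_real_derivative D) (at t) \<and> D \<le> 0 \<and> (y t > 0 \<longrightarrow> D \<le> - \<kappa> * y t powr (1 + 2 / r))"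
    if t: "t > 0" for t
  proof -
    have t0: "t \<ge> 0" using t by simp
    note S = strong_solutionD[OF sol t0]
    define I where "I = (LINT x|lebesgue. (v t x ^ (m - 1) * g t x)\<^sup>2)"
    have I0: "I \<ge> 0" by (simp add: I_def)
    obtain D where D: "(y has_real_derivative D) (at t)" "D \<le> - a * I"
      using c(2)[OF m t] by (auto simp: y_def[abs_def] a_def I_def)
    have "0 \<le> a * I" using a0 I0 by simp
    then have "D \<le> 0" using D(2) by simp
    moreover have "D \<le> - \<kappa> * y t powr (1 + 2 / r)" if yt: "y t > 0"
    proof -
      have "y t ^ (m + 1) \<le> Q * I ^ (m - 1)"
        unfolding y_def Q_def I_def
        by (rule Nash_type_inequality[OF S(1,2,3) m2 order_trans[OF energy_nonincreasing[OF sol t0] E0(2)]])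
      then have 1: "y t powr (r + 2) \<le> Q * I powr r"
      proof -
        assume le: "y t ^ (m + 1) \<le> Q * I ^ (m - 1)"
        have "real (m + 1) = r + 2" using m2 by (simp add: r_def)
        then have "y t ^ (m + 1) = y t powr (r + 2)"
          using powr_realpow[OF yt, of "m + 1"] by (simp only:)
        moreover have "I ^ (m - 1) = I powr r"
        proof (cases "I = 0")
          case True
          then show ?thesis using m2 by (simp add: r_def power_0_left)
        next
          case False
          then show ?thesis using I0 powr_realpow[of I "m - 1"] by (simp add: r_def)
        qed
        ultimately show ?thesis using le by simp
      qed
      have "(y t powr (r + 2)) powr (1 / r) \<le> (Q * I powr r) powr (1 / r)"
        using 1 r0 by (intro powr_mono2) auto
      also have "\<dots> = Q powr (1 / r) * I"
        using Q0 I0 r0 by (simp add: powr_mult powr_powr)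
      also have "(y t powr (r + 2)) powr (1 / r) = y t powr (1 + 2 / r)"
        using r0 by (simp add: powr_powr field_simps)
      finally have "Q powr (- (1 / r)) * y t powr (1 + 2 / r) \<le> Q powr (- (1 / r)) * (Q powr (1 / r) * I)"
        by (rule mult_left_mono) simp
      also have "\<dots> = I" using Q0 by (simp add: powr_minus field_simps)
      finally have "a * (Q powr (- (1 / r)) * y t powr (1 + 2 / r)) \<le> a * I"
        using a0 by (intro mult_left_mono) auto
      then show ?thesis using D(2) by (simp add: \<kappa>_def mult.assoc)
    qed
    ultimately show ?thesis using D(1) by blast
  qed
  have cont: "continuous_on {0..} y" unfolding y_def[abs_def] by (rule power_integral_continuous[OF sol m])
  obtain C where C: "C > 0" "\<And>t. t \<ge> 0 \<Longrightarrow> y t \<le> C * (1 + t) powr (- (1 / (2 / r)))"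
    using decay_of_superlinear_dissipation[OF cont y0 der \<kappa>0] r0 by (metis divide_pos_pos zero_less_numeral)
  show thesis by (rule that[OF C(1)]) (use C(2) in \<open>simp add: y_def r_def\<close>)
qed

text \<open>
  Interpolation between \<open>L\<^sup>2\<close> and \<open>L\<^sup>2\<^sup>m\<close>.  The claimed rate is affine in \<open>1/q\<close>, so nothing is lost by passing
  through even exponents.  In place of Hoelder's inequality, \<open>s\<^sup>q \<le> s\<^sup>2 + s\<^sup>2\<^sup>m\<close> is applied to
  \<open>s = \<mu> |v|\<close> with the weight \<open>\<mu> = (1 + t)\<^sup>1\<^sup>/\<^sup>4\<close>, for which both integrals are \<open>O((1 + t)\<^sup>1\<^sup>/\<^sup>2)\<close>.
\<close>

lemma Lq_decay:
  assumes sol: "strong_solution f \<sigma> ut v g w M" and q: "q \<ge> 2"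
  obtains C where "C > 0"
    "\<And>t. t \<ge> 0 \<Longrightarrow> integrable lebesgue (\<lambda>x. \<bar>v t x\<bar> powr q)"
    "\<And>t. t \<ge> 0 \<Longrightarrow> (LINT x|lebesgue. \<bar>v t x\<bar> powr q) powr (1 / q) \<le> C * (1 + t) powr (- (1 / 4) * (1 - 2 / q))"
proof -
  obtain m :: nat where m: "q \<le> real m" using real_arch_simple by blast
  then have m1: "m \<ge> 1" and qm: "q \<le> real (2 * m)" using q by auto
  obtain C1 where C1: "C1 > 0"
    "\<And>t. t \<ge> 0 \<Longrightarrow> (LINT x|lebesgue. v t x ^ (2 * 1)) \<le> C1 * (1 + t) powr (- (real (1 - 1) / 2))"
    using power_integral_decay[OF sol, of 1] by auto
  obtain C2 where C2: "C2 > 0"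
    "\<And>t. t \<ge> 0 \<Longrightarrow> (LINT x|lebesgue. v t x ^ (2 * m)) \<le> C2 * (1 + t) powr (- (real (m - 1) / 2))"
    using power_integral_decay[OF sol m1] by blast
  have dom: "\<mu> powr q * \<bar>z\<bar> powr q \<le> \<mu>\<^sup>2 * z\<^sup>2 + \<mu> ^ (2 * m) * z ^ (2 * m)" if \<mu>: "\<mu> \<ge> 1" for \<mu> z :: real
  proof (cases "z = 0")
    case True
    then show ?thesis using q m1 by simp
  next
    case False
    define s where "s = \<mu> * \<bar>z\<bar>"
    have s0: "s > 0" using False \<mu> by (simp add: s_def)
    have "\<mu> powr q * \<bar>z\<bar> powr q = s powr q" using \<mu> by (simp add: s_def powr_mult)
    also have "\<dots> \<le> s\<^sup>2 + s ^ (2 * m)"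
    proof (cases "s \<le> 1")
      case True
      have "s powr q \<le> s powr 2" using True s0 q by (intro powr_mono') auto
      then show ?thesis using s0 by (simp add: powr_numeral add_increasing2)
    next
      case False
      have "s powr q \<le> s powr (real (2 * m))" using False qm by (intro powr_mono) auto
      then show ?thesis using s0 powr_realpow[OF s0, of "2 * m"] by (simp add: add_increasing)
    qed
    also have "\<dots> = \<mu>\<^sup>2 * z\<^sup>2 + \<mu> ^ (2 * m) * z ^ (2 * m)"
      by (simp add: s_def power_mult_distrib power_even_abs)
    finally show ?thesis .
  qed
  have int2: "integrable lebesgue (\<lambda>x. (v t x)\<^sup>2)" and intm: "integrable lebesgue (\<lambda>x. v t x ^ (2 * m))" if "t \<ge> 0" for t
    by (rule sq_integrable_int[OF strong_solutionD(8)[OF sol that]],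
        rule integrable_power_even[OF strong_solutionD(8)[OF sol that] strong_solutionD(3)[OF sol that] m1])
  have int: "integrable lebesgue (\<lambda>x. \<bar>v t x\<bar> powr q)" if t: "t \<ge> 0" for t
  proof (rule Bochner_Integration.integrable_bound)
    show "integrable lebesgue (\<lambda>x. (v t x)\<^sup>2 + v t x ^ (2 * m))" using int2[OF t] intm[OF t] by simp
    show "(\<lambda>x. \<bar>v t x\<bar> powr q) \<in> borel_measurable lebesgue"
      using sq_integrable_meas[OF strong_solutionD(8)[OF sol t]] by measurable
    show "AE x in lebesgue. norm (\<bar>v t x\<bar> powr q) \<le> norm ((v t x)\<^sup>2 + v t x ^ (2 * m))"
    proof (rule AE_I2)
      fix x
      have "\<bar>v t x\<bar> powr q \<le> (v t x)\<^sup>2 + v t x ^ (2 * m)" using dom[of 1 "v t x"] by simp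
      then show "norm (\<bar>v t x\<bar> powr q) \<le> norm ((v t x)\<^sup>2 + v t x ^ (2 * m))" by simp
    qed
  qed
  have bound: "(LINT x|lebesgue. \<bar>v t x\<bar> powr q) \<le> (C1 + C2) * (1 + t) powr ((2 - q) / 4)" if t: "t \<ge> 0" for t
  proof -
    define T where "T = 1 + t"
    define \<mu> where "\<mu> = T powr (1 / 4)"
    have T: "T \<ge> 1" using t by (simp add: T_def)
    have \<mu>1: "\<mu> \<ge> 1" using T by (simp add: \<mu>_def ge_one_powr_ge_zero)
    have \<mu>q: "\<mu> powr q = T powr (q / 4)" "\<mu>\<^sup>2 = T powr (1 / 2)" "\<mu> ^ (2 * m) = T powr (real m / 2)"
      using T by (simp_all add: \<mu>_def powr_powr flip: powr_realpow powr_numeral)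
    have "T powr (q / 4) * (LINT x|lebesgue. \<bar>v t x\<bar> powr q) = (LINT x|lebesgue. \<mu> powr q * \<bar>v t x\<bar> powr q)"
      by (simp add: \<mu>q)
    also have "\<dots> \<le> (LINT x|lebesgue. \<mu>\<^sup>2 * (v t x)\<^sup>2 + \<mu> ^ (2 * m) * v t x ^ (2 * m))"
      using int[OF t] int2[OF t] intm[OF t] dom[OF \<mu>1] by (intro integral_mono) auto
    also have "\<dots> = \<mu>\<^sup>2 * (LINT x|lebesgue. (v t x)\<^sup>2) + \<mu> ^ (2 * m) * (LINT x|lebesgue. v t x ^ (2 * m))"
      using int2[OF t] intm[OF t] by simp
    also have "\<dots> \<le> T powr (1 / 2) * C1 + T powr (real m / 2) * (C2 * T powr (- (real (m - 1) / 2)))"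
      unfolding \<mu>q using C1(2)[OF t] C2(2)[OF t] t by (intro add_mono mult_left_mono) (auto simp: T_def)
    also have "T powr (real m / 2) * (C2 * T powr (- (real (m - 1) / 2))) = C2 * T powr (1 / 2)"
    proof -
      have "real m / 2 + - (real (m - 1) / 2) = 1 / 2" using m1 by (simp add: of_nat_diff field_simps)
      then have "T powr (real m / 2) * T powr (- (real (m - 1) / 2)) = T powr (1 / 2)"
        unfolding powr_add[symmetric] by (simp only:)
      then show ?thesis by (simp add: mult.left_commute)
    qed
    finally have "T powr (q / 4) * (LINT x|lebesgue. \<bar>v t x\<bar> powr q) \<le> (C1 + C2) * T powr (1 / 2)"
      by (simp add: algebra_simps)
    then have "T powr (- (q / 4)) * (T powr (q / 4) * (LINT x|lebesgue. \<bar>v t x\<bar> powr q))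
       \<le> T powr (- (q / 4)) * ((C1 + C2) * T powr (1 / 2))"
      by (rule mult_left_mono) simp
    moreover have "T powr (- (q / 4)) * T powr (q / 4) = 1" using T by (simp flip: powr_add)
    moreover have "T powr (- (q / 4)) * T powr (1 / 2) = T powr ((2 - q) / 4)"
      by (simp flip: powr_add add: field_simps)
    moreover have "T powr (- (q / 4)) * ((C1 + C2) * T powr (1 / 2)) = (C1 + C2) * (T powr (- (q / 4)) * T powr (1 / 2))"
      by (rule mult.left_commute)
    ultimately show ?thesis by (simp only: mult.assoc[symmetric, of "T powr (- (q / 4))" "T powr (q / 4)"]) (simp add: T_def)
  qed
  show thesis
  proof (rule that[OF _ int])
    show "(C1 + C2) powr (1 / q) > 0" using C1(1) C2(1) by simp
    fix t :: real assume t: "t \<ge> 0"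
    have "(LINT x|lebesgue. \<bar>v t x\<bar> powr q) powr (1 / q) \<le> ((C1 + C2) * (1 + t) powr ((2 - q) / 4)) powr (1 / q)"
      using bound[OF t] q by (intro powr_mono2) auto
    also have "\<dots> = (C1 + C2) powr (1 / q) * (1 + t) powr ((2 - q) / 4 * (1 / q))"
      using C1(1) C2(1) by (simp add: powr_mult powr_powr)
    also have "(2 - q) / 4 * (1 / q) = - (1 / 4) * (1 - 2 / q)" using q by (simp add: field_simps)
    finally show "(LINT x|lebesgue. \<bar>v t x\<bar> powr q) powr (1 / q)
        \<le> (C1 + C2) powr (1 / q) * (1 + t) powr (- (1 / 4) * (1 - 2 / q))" .
  qed
qed

text \<open>
  \<open>v\<^sup>2\<^sup>m \<le> 2 m \<integral>|v|\<^sup>2\<^sup>m\<^sup>-\<^sup>1 |\<partial>\<^sub>xv|\<close>, where \<open>\<partial>\<^sub>xv\<close> is bounded in \<open>L\<^sup>2\<close> and \<open>v\<^sup>2\<^sup>m\<^sup>-\<^sup>1\<close> decays there by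
  \<open>power_integral_decay\<close> at the exponent \<open>k = 2 m - 1\<close>.  The resulting rate is \<open>1/4 - 1/(4 m)\<close>; a large \<open>m\<close> makes the loss at most \<open>\<epsilon>\<close>.
\<close>

lemma sup_decay:
  assumes sol: "strong_solution f \<sigma> ut v g w M" and \<epsilon>: "\<epsilon> > 0"
  obtains C where "C > 0" "\<And>t x. t \<ge> 0 \<Longrightarrow> \<bar>v t x\<bar> \<le> C * (1 + t) powr (- (1 / 4) + \<epsilon>)"
proof -
  \<comment> \<open>The loss \<open>1/(4 m)\<close> has to be at most \<open>\<epsilon>\<close>.\<close>
  obtain m :: nat where m: "1 / \<epsilon> \<le> real m" using real_arch_simple by blast
  have "0 < 1 / \<epsilon>" using \<epsilon> by simp
  then have m0: "0 < real m" using m by linarith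
  then have m1: "m \<ge> 1" by simp
  have "1 / real m \<le> \<epsilon>" using m \<epsilon> m0 by (simp add: field_simps)
  then have m\<epsilon>: "1 / (4 * real m) \<le> \<epsilon>" using m0 \<epsilon> by (simp add: field_simps)
  define k where "k = 2 * m - 1"
  have k1: "k \<ge> 1" using m1 by (simp add: k_def)
  obtain C where C: "C > 0"
    "\<And>t. t \<ge> 0 \<Longrightarrow> (LINT x|lebesgue. v t x ^ (2 * k)) \<le> C * (1 + t) powr (- (real (k - 1) / 2))"
    using power_integral_decay[OF sol k1] by blast
  define r where "r = real (2 * m)"
  define A where "A = r * sqrt C * sqrt (M + 1)"
  have M0: "M \<ge> 0" using strong_solutionD(3)[OF sol, of 0 0] by linarith
  have r0: "r > 0" using m1 by (simp add: r_def)
  have A0: "A > 0" using C(1) M0 r0 by (simp add: A_def)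
  show thesis
  proof (rule that[of "A powr (1 / r)"])
    show "A powr (1 / r) > 0" using A0 by simp
    fix t x :: real assume t: "t \<ge> 0"
    note S = strong_solutionD[OF sol t]
    define T where "T = 1 + t"
    have T: "T \<ge> 1" using t by (simp add: T_def)
    have vk: "sq_integrable (\<lambda>x. v t x ^ k)" by (rule sq_integrable_power[OF S(8) S(3) k1])
    have H2: "H1_pair (\<lambda>x. v t x ^ (2 * m)) (\<lambda>x. r * v t x ^ k * g t x)"
      using H1_pair_power[OF S(1,2,3), of "2 * m"] m1 by (simp add: r_def k_def)
    have i: "integrable lebesgue (\<lambda>x. r * v t x ^ k * g t x)"
      unfolding mult.assoc using sq_integrable_mult[OF vk S(9)] by simp
    have "\<bar>v t x ^ (2 * m)\<bar> \<le> (LINT x|lebesgue. \<bar>r * v t x ^ k * g t x\<bar>)"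
      by (rule primitive_abs_le_integral[OF H1_pairD(3)[OF H2] i H1_pair_tendsto_0(2)[OF H2]])
    also have "\<dots> = r * (LINT x|lebesgue. \<bar>v t x ^ k * g t x\<bar>)"
      unfolding mult.assoc abs_mult[of r] using r0 by simp
    also have "\<dots> \<le> r * (sqrt (LINT x|lebesgue. (v t x ^ k)\<^sup>2) * sqrt (LINT x|lebesgue. (g t x)\<^sup>2))"
      using r0 by (intro mult_left_mono Cauchy_Schwarz_LINT_abs[OF vk S(9)]) simp
    also have "\<dots> \<le> r * (sqrt (C * T powr (- (real (k - 1) / 2))) * sqrt (M + 1))"
    proof (intro mult_left_mono mult_mono real_sqrt_le_mono)
      show "(LINT x|lebesgue. (v t x ^ k)\<^sup>2) \<le> C * T powr (- (real (k - 1) / 2))"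
        using C(2)[OF t] by (simp add: T_def power_mult[symmetric] mult.commute)
      show "(LINT x|lebesgue. (g t x)\<^sup>2) \<le> M + 1" using S(5) by simp
    qed (use r0 C(1) in auto)
    also have "\<dots> = A * T powr (- (real (m - 1) / 2))"
    proof -
      have "- (real (k - 1) / 2) = - real (m - 1)"
      proof -
        have "k - 1 = 2 * (m - 1)" by (simp add: k_def)
        then show ?thesis by simp
      qed
      then have "sqrt (T powr (- (real (k - 1) / 2))) = T powr (- (real (m - 1) / 2))"
        by (simp add: powr_half_sqrt[symmetric] powr_powr)
      then show ?thesis by (simp add: A_def real_sqrt_mult mult_ac)
    qed
    finally have le: "\<bar>v t x ^ (2 * m)\<bar> \<le> A * T powr (- (real (m - 1) / 2))" .
    have vr: "\<bar>v t x\<bar> = \<bar>v t x ^ (2 * m)\<bar> powr (1 / r)"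
    proof (cases "v t x = 0")
      case False
      then have "\<bar>v t x\<bar> > 0" by simp
      have "\<bar>v t x ^ (2 * m)\<bar> = \<bar>v t x\<bar> powr r"
        using powr_realpow[OF \<open>\<bar>v t x\<bar> > 0\<close>, of "2 * m"] by (simp add: r_def power_abs)
      then show ?thesis using r0 by (simp add: powr_powr)
    qed (use m1 in simp)
    also have "\<dots> \<le> (A * T powr (- (real (m - 1) / 2))) powr (1 / r)"
      using le r0 by (intro powr_mono2) auto
    also have "\<dots> = A powr (1 / r) * T powr (- (real (m - 1) / 2) * (1 / r))"
      using A0 by (simp add: powr_mult powr_powr)
    also have "\<dots> \<le> A powr (1 / r) * T powr (- (1 / 4) + \<epsilon>)"
    proof (intro mult_left_mono powr_mono)
      have "- (real (m - 1) / 2) * (1 / r) = - (1 / 4) + 1 / (4 * real m)"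
        using m1 by (simp add: r_def of_nat_diff field_simps)
      then show "- (real (m - 1) / 2) * (1 / r) \<le> - (1 / 4) + \<epsilon>" using m\<epsilon> by simp
    qed (use T in auto)
    finally show "\<bar>v t x\<bar> \<le> A powr (1 / r) * (1 + t) powr (- (1 / 4) + \<epsilon>)" by (simp add: T_def)
  qed
qed

end

section \<open>Decay of global solutions\<close>

lemma C_diff_imp_C1:
  assumes "C_diff k f" "k \<ge> 2"
  shows "(f has_real_derivative deriv f x) (at x)" "continuous_on UNIV (deriv f)"
proof -
  have "(deriv ^^ j) f differentiable (at x)" if "j < 2" for j x
    using assms that by (auto simp: C_diff_def)
  from this[of 0] this[of 1] have d: "f differentiable (at x)" "deriv f differentiable (at x)" for x
    by auto
  from d(1) show "(f has_real_derivative deriv f x) (at x)"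
    by (simp add: DERIV_deriv_iff_real_differentiable)
  from d(2) show "continuous_on UNIV (deriv f)"
    by (auto intro!: differentiable_imp_continuous_on simp: differentiable_on_def)
qed

text \<open>
  Every solution with the given datum agrees with one fixed solution, so constants obtained for the
  latter serve for all of them and depend on the datum only.
\<close>

lemma (in viscous_conservation_law) global_solution_AE_eq:
  assumes sol: "global_solution f \<sigma> ut u0 u" and rep: "strong_solution f \<sigma> ut v g w M"
    "AE x in lebesgue. v 0 x = u0 x - ut" and t: "t \<ge> 0"
  shows "AE x in lebesgue. u t x - ut = v t x" "(\<lambda>x. u t x - ut) \<in> borel_measurable lebesgue"
proof -
  obtain v' g' w' M' where rep': "strong_solution f \<sigma> ut v' g' w' M'"
    "\<forall>t\<ge>0. AE x in lebesgue. u t x = ut + v' t x" "AE x in lebesgue. v' 0 x = u0 x - ut"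
    by (rule global_solution_strong[OF sol])
  have init: "AE x in lebesgue. v' 0 x = v 0 x"
    using rep'(3) rep(2) by eventually_elim simp
  have "v' t x = v t x" for x
    using strong_solution_unique[OF strong_solution_mono[OF rep'(1), of "max M' M"]
        strong_solution_mono[OF rep(1), of "max M' M"] init t] by simp
  with rep'(2)[rule_format, OF t] show "AE x in lebesgue. u t x - ut = v t x"
    by (auto elim: eventually_mono)
  have "(\<lambda>x. u t x - ut) \<in> Hk 2"
    using sol t by (auto simp: global_solution_def C0_time_def)
  then show "(\<lambda>x. u t x - ut) \<in> borel_measurable lebesgue"
    by (simp add: Hk_def Lq_def)
qed

theorem theorem1p2:
  fixes p ut :: real and f \<sigma> u0 :: "real \<Rightarrow> real"
  assumes "p > 1 / 3"
    and "C_diff 3 f" and "C_diff 2 \<sigma>"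
    and "\<sigma> 0 = 0" and "\<And>v. deriv \<sigma> v > 0"
    and "comparable_at_infinity (\<lambda>v. \<bar>\<sigma> v\<bar>) (\<lambda>v. \<bar>v\<bar> powr p)"
    and "comparable_at_infinity (\<lambda>v. \<bar>deriv \<sigma> v\<bar>) (\<lambda>v. \<bar>v\<bar> powr (p - 1))"
    and "(\<lambda>x. u0 x - ut) \<in> Hk 2"
    and "(u0 \<longlongrightarrow> ut) at_top" and "(u0 \<longlongrightarrow> ut) at_bot"
  shows "(\<forall>q\<ge>2. \<exists>C>0. \<forall>u. global_solution f \<sigma> ut u0 u \<longrightarrow>
            (\<forall>t\<ge>0. (\<lambda>x. u t x - ut) \<in> Lq q \<and>
               Lq_norm q (\<lambda>x. u t x - ut) \<le> C * (1 + t) powr (- (1 / 4) * (1 - 2 / q)))) \<and>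
         (\<forall>\<epsilon>>0. \<exists>C>0. \<forall>u. global_solution f \<sigma> ut u0 u \<longrightarrow>
            (\<forall>t\<ge>0. Linf_norm (\<lambda>x. u t x - ut) \<le> ereal (C * (1 + t) powr (- (1 / 4) + \<epsilon>))))"
proof (cases "\<exists>u. global_solution f \<sigma> ut u0 u")
  case False
  then show ?thesis by (auto intro: exI[of _ 1])
next
  case True
  interpret viscous_conservation_law f \<sigma> "deriv f" "deriv \<sigma>" ut
  proof
    show "(f has_real_derivative deriv f x) (at x)" "(\<sigma> has_real_derivative deriv \<sigma> x) (at x)" for x
      by (rule C_diff_imp_C1(1)[OF assms(2)] C_diff_imp_C1(1)[OF assms(3)], simp)+
    show "continuous_on UNIV (deriv f)" "continuous_on UNIV (deriv \<sigma>)"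
      by (rule C_diff_imp_C1(2)[OF assms(2)] C_diff_imp_C1(2)[OF assms(3)], simp)+
  qed (fact assms(4,5))+
  from True obtain u1 where u1: "global_solution f \<sigma> ut u0 u1" ..
  obtain v g w M where rep: "strong_solution f \<sigma> ut v g w M" "AE x in lebesgue. v 0 x = u0 x - ut"
    using global_solution_strong[OF u1] by metis
  note eq = global_solution_AE_eq[OF _ rep]
  show ?thesis
  proof (intro conjI allI impI)
    fix q :: real assume "q \<ge> 2"
    obtain C where C: "C > 0" "\<And>t. t \<ge> 0 \<Longrightarrow> integrable lebesgue (\<lambda>x. \<bar>v t x\<bar> powr q)"
      "\<And>t. t \<ge> 0 \<Longrightarrow> (LINT x|lebesgue. \<bar>v t x\<bar> powr q) powr (1 / q) \<le> C * (1 + t) powr (- (1 / 4) * (1 - 2 / q))"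
      using Lq_decay[OF rep(1) \<open>q \<ge> 2\<close>] by blast
    have "(\<lambda>x. u t x - ut) \<in> Lq q \<and> Lq_norm q (\<lambda>x. u t x - ut) \<le> C * (1 + t) powr (- (1 / 4) * (1 - 2 / q))"
      if u: "global_solution f \<sigma> ut u0 u" and t: "t \<ge> 0" for u t
    proof -
      note m = eq(2)[OF u t]
      have ae: "AE x in lebesgue. \<bar>v t x\<bar> powr q = \<bar>u t x - ut\<bar> powr q"
        using eq(1)[OF u t] by eventually_elim simp
      have pm: "(\<lambda>x. \<bar>u t x - ut\<bar> powr q) \<in> borel_measurable lebesgue" using m by measurable
      have int: "integrable lebesgue (\<lambda>x. \<bar>u t x - ut\<bar> powr q)"
        by (rule integrable_cong_AE_imp[OF C(2)[OF t] pm ae])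
      have "(LINT x|lebesgue. \<bar>u t x - ut\<bar> powr q) = (LINT x|lebesgue. \<bar>v t x\<bar> powr q)"
        using ae by (intro integral_cong_AE pm borel_measurable_integrable[OF C(2)[OF t]]) (auto elim: eventually_mono)
      then show ?thesis using m int C(3)[OF t] by (simp add: Lq_def Lq_norm_def)
    qed
    with C(1) show "\<exists>C>0. \<forall>u. global_solution f \<sigma> ut u0 u \<longrightarrow> (\<forall>t\<ge>0. (\<lambda>x. u t x - ut) \<in> Lq q \<and>
        Lq_norm q (\<lambda>x. u t x - ut) \<le> C * (1 + t) powr (- (1 / 4) * (1 - 2 / q)))" by blast
  next
    fix \<epsilon> :: real assume "\<epsilon> > 0"
    obtain C where C: "C > 0" "\<And>t x. t \<ge> 0 \<Longrightarrow> \<bar>v t x\<bar> \<le> C * (1 + t) powr (- (1 / 4) + \<epsilon>)"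
      using sup_decay[OF rep(1) \<open>\<epsilon> > 0\<close>] by blast
    have "Linf_norm (\<lambda>x. u t x - ut) \<le> ereal (C * (1 + t) powr (- (1 / 4) + \<epsilon>))"
      if u: "global_solution f \<sigma> ut u0 u" and t: "t \<ge> 0" for u t
      unfolding Linf_norm_def
    proof (rule esssup_I)
      show "(\<lambda>x. ereal \<bar>u t x - ut\<bar>) \<in> borel_measurable lebesgue" using eq(2)[OF u t] by measurable
      show "AE x in lebesgue. ereal \<bar>u t x - ut\<bar> \<le> ereal (C * (1 + t) powr (- (1 / 4) + \<epsilon>))"
        using eq(1)[OF u t]
      proof eventually_elim
        case (elim x)
        show ?case unfolding elim using C(2)[OF t, of x] by simp
      qed
    qed
    with C(1) show "\<exists>C>0. \<forall>u. global_solution f \<sigma> ut u0 u \<longrightarrow>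
        (\<forall>t\<ge>0. Linf_norm (\<lambda>x. u t x - ut) \<le> ereal (C * (1 + t) powr (- (1 / 4) + \<epsilon>)))" by blast
  qed
qed

end
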